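(* Let $n>1$. Let $\{a_j\}_{j=1}^\infty$ and $\{b_j\}_{j=1}^\infty$ be tame sequences in $\mathbb{C}^n$ (without repetitions). For each $j=1,2,3,\ldots$ let $m_j\ge 1$ be an integer and let $P_j\colon\mathbb{C}^n\to\mathbb{C}^n$ be a holomorphic polynomial map of degree at most $m_j$ such that $P_j(0)=0$ and $JP_j(0)\neq 0$. Then there exists $F\in\operatorname{Aut}\mathbb{C}^n$ such that for every $j=1,2,3,\ldots$ we have $F(a_j)=b_j$ and $$F(z)=b_j+P_j(z-a_j)+O(|z-a_j|^{m_j+1}),\qquad z\to a_j.$$ If in addition the polynomial maps $P_j$ satisfy $$JP_j(z)=1+O(|z|^{m_j}),\quad z\to 0,\qquad j=1,2,3,\ldots,$$ and the sequences $\{a_j\}$ and $\{b_j\}$ are very tame, then $F$ may be chosen in $\operatorname{Aut}_1\mathbb{C}^n$.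
   Context: $\operatorname{Aut}\mathbb{C}^n$ denotes the group of all holomorphic automorphisms of $\mathbb{C}^n$ (biholomorphic maps of $\mathbb{C}^n$ onto itself). For a holomorphic map $G$ with values in $\mathbb{C}^n$ defined on an open subset of $\mathbb{C}^n$, $JG$ denotes its complex Jacobian determinant $\det(\partial G_i/\partial z_k)$. $\operatorname{Aut}_1\mathbb{C}^n$ denotes the group of those $F\in\operatorname{Aut}\mathbb{C}^n$ with $JF\equiv 1$. Write $e_1=(1,0,\ldots,0)\in\mathbb{C}^n$. An infinite sequence $\{a_j\}_{j=1}^\infty\subset\mathbb{C}^n$ without repetition that is discrete (has no accumulation point in $\mathbb{C}^n$) is called tame if there exists $F\in\operatorname{Aut}\mathbb{C}^n$ such that $F(a_j)=je_1=(j,0,\ldots,0)$ for all $j=1,2,3,\ldots$. It is called very tame if this holds for some $F\in\operatorname{Aut}_1\mathbb{C}^n$. *)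

theory Defs
  imports "HOL-Analysis.Analysis" "HOL-Library.Landau_Symbols"
begin

text \<open>
  Complex \<open>n\<close>-space is \<^typ>\<open>complex ^ 'n\<close> with \<open>n = CARD('n)\<close>. The index type carries a linear
  order only so that there is a first coordinate. Sequences indexed by \<open>1, 2, 3, \<dots>\<close> are functions
  on \<^typ>\<open>nat\<close> whose value at \<open>0\<close> is never used.
\<close>

definition e1 :: "complex ^ 'n::{finite,linorder}" where
  "e1 = axis (Min UNIV) 1"

text \<open>The real Frechet derivative is required to be complex linear, i.e. given by a complex matrix.\<close>

definition holomorphic_map :: "(complex ^ 'n::finite \<Rightarrow> complex ^ 'n) \<Rightarrow> bool" where
  "holomorphic_map F \<longleftrightarrow>
     (\<forall>z. \<exists>A :: complex ^ 'n ^ 'n. (F has_derivative (\<lambda>v. A *v v)) (at z))"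

definition partial_deriv ::
  "(complex ^ 'n::finite \<Rightarrow> complex ^ 'n) \<Rightarrow> 'n \<Rightarrow> 'n \<Rightarrow> complex ^ 'n \<Rightarrow> complex" where
  "partial_deriv G i k z = deriv (\<lambda>w. G (\<chi> l. if l = k then w else z $ l) $ i) (z $ k)"

definition jacobian_det :: "(complex ^ 'n::finite \<Rightarrow> complex ^ 'n) \<Rightarrow> complex ^ 'n \<Rightarrow> complex" where
  "jacobian_det G z = det (\<chi> i k. partial_deriv G i k z)"

definition Aut :: "(complex ^ 'n::finite \<Rightarrow> complex ^ 'n) set" where
  "Aut = {F. bij F \<and> holomorphic_map F \<and> holomorphic_map (inv F)}"

definition Aut1 :: "(complex ^ 'n::finite \<Rightarrow> complex ^ 'n) set" where
  "Aut1 = {F \<in> Aut. \<forall>z. jacobian_det F z = 1}"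

definition discrete_seq :: "(nat \<Rightarrow> complex ^ 'n::finite) \<Rightarrow> bool" where
  "discrete_seq a \<longleftrightarrow> inj_on a {1..} \<and> (\<forall>x. \<not> x islimpt a ` {1..})"

definition tame :: "(nat \<Rightarrow> complex ^ 'n::{finite,linorder}) \<Rightarrow> bool" where
  "tame a \<longleftrightarrow> discrete_seq a \<and> (\<exists>F\<in>Aut. \<forall>j\<ge>1. F (a j) = of_nat j *s e1)"

definition very_tame :: "(nat \<Rightarrow> complex ^ 'n::{finite,linorder}) \<Rightarrow> bool" where
  "very_tame a \<longleftrightarrow> discrete_seq a \<and> (\<exists>F\<in>Aut1. \<forall>j\<ge>1. F (a j) = of_nat j *s e1)"

text \<open>Multi-indices of total degree at most \<open>m\<close>; there are finitely many, so the sum in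
  \<open>poly_map_deg_le\<close> below is a genuine finite sum.\<close>

definition multi_indices :: "nat \<Rightarrow> ('n::finite \<Rightarrow> nat) set" where
  "multi_indices m = {\<alpha>. (\<Sum>i\<in>UNIV. \<alpha> i) \<le> m}"

lemma finite_multi_indices: "finite (multi_indices m :: ('n::finite \<Rightarrow> nat) set)"
proof (rule finite_subset)
  show "multi_indices m \<subseteq> (UNIV :: 'n set) \<rightarrow>\<^sub>E {..m}"
  proof
    fix \<alpha> :: "'n \<Rightarrow> nat" assume "\<alpha> \<in> multi_indices m"
    moreover have "\<alpha> i \<le> (\<Sum>i\<in>UNIV. \<alpha> i)" for i
      by (rule member_le_sum) simp_all
    ultimately have "\<alpha> i \<le> m" for i
      unfolding multi_indices_def using le_trans by blast
    then show "\<alpha> \<in> (UNIV :: 'n set) \<rightarrow>\<^sub>E {..m}" by auto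
  qed
  show "finite ((UNIV :: 'n set) \<rightarrow>\<^sub>E {..m})"
    by (intro finite_PiE) auto
qed

definition poly_map_deg_le :: "nat \<Rightarrow> (complex ^ 'n::finite \<Rightarrow> complex ^ 'n) \<Rightarrow> bool" where
  "poly_map_deg_le m P \<longleftrightarrow>
     (\<exists>c :: ('n \<Rightarrow> nat) \<Rightarrow> complex ^ 'n.
        \<forall>z. P z = (\<Sum>\<alpha>\<in>multi_indices m. (\<Prod>i\<in>UNIV. (z $ i) ^ \<alpha> i) *s c \<alpha>))"

end

theory Submission
  imports Defs "HOL-Complex_Analysis.Cauchy_Integral_Formula"
begin

text \<open>
  Straightening both sequences reduces the claim to prescribing jets at the points \<open>j e\<^sub>1\<close>, all of
  which stay fixed. A single jet at \<open>k e\<^sub>1\<close> is realized degree by degree: shears along a hyperplane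
  transversal to \<open>e\<^sub>1\<close>, multiplied by an entire function of one variable that is flat at the other
  integers and small on a disc of radius less than \<open>k\<close>, together with slightly tilted copies of them,
  produce by linear combination every homogeneous field of divergence zero, and with overshears every
  homogeneous field. The transvections obtained in degree one generate the linear part.

  The automorphism is then a limit of maps \<open>F\<close> that are changed to \<open>F \<circ> T\<close> with \<open>T\<close> close to the identity
  on a ball containing the \<open>F\<close>-preimage of the ball of radius \<open>n\<close>; since all jets at the points of
  that ball have been treated before, both the maps and their inverses converge.
\<close>

subsection \<open>Order of vanishing\<close>

text \<open>Locally uniform limits of automorphisms can be injective without being onto. So inverses
  have to be controlled along with the maps, which is why the ball to be protected is a preimage.
  Each correction is close to the identity only on a ball of radius below k. That suffices, because
  the points inside this ball already carry their final jets and the cutoff depends on the one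
  coordinate in which the points differ. A cutoff in that coordinate admits shears in transversal
  directions only; with a single direction e_l all fields obtained would be parallel to e_l. A
  linear shear that fixes the axis pointwise can be used to tilt the direction. It must be small,
  since it enlarges the disc on which the cutoff is small; so the tilt is kept as a parameter t and
  the coefficients of its powers are extracted afterwards. In degree at least 2 the leading terms of
  maps tangent to the identity add under composition, so realizable leading terms form a vector
  space. In degree one they multiply as matrices instead, so the generated group has to be
  identified.\<close>

text \<open>The filter is \<open>nhds p\<close> and not \<open>at p\<close>: the bound includes the
  point itself, so a positive order forces the value 0 at \<open>p\<close>, and inner maps may hit
  \<open>p\<close> without a case distinction.\<close>

definition vanish :: "nat \<Rightarrow> 'a::real_normed_vector \<Rightarrow> ('a \<Rightarrow> 'b::real_normed_vector) \<Rightarrow> bool" where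
  "vanish k p E \<longleftrightarrow> (\<exists>C. \<forall>\<^sub>F x in nhds p. norm (E x) \<le> C * norm (x - p) ^ k)"

lemma vanishI: "(\<forall>\<^sub>F x in nhds p. norm (E x) \<le> C * norm (x - p) ^ k) \<Longrightarrow> vanish k p E"
  unfolding vanish_def by blast

lemma vanishE:
  assumes "vanish k p E"
  obtains C where "C > 0" "\<forall>\<^sub>F x in nhds p. norm (E x) \<le> C * norm (x - p) ^ k"
proof -
  obtain C where C: "\<forall>\<^sub>F x in nhds p. norm (E x) \<le> C * norm (x - p) ^ k"
    using assms unfolding vanish_def by blast
  have "\<forall>\<^sub>F x in nhds p. norm (E x) \<le> (\<bar>C\<bar> + 1) * norm (x - p) ^ k"
    using C
  proof eventually_elim
    case (elim x)
    have "C * norm (x - p) ^ k \<le> (\<bar>C\<bar> + 1) * norm (x - p) ^ k"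
      by (intro mult_right_mono) auto
    then show ?case using elim by linarith
  qed
  then show ?thesis by (intro that[of "\<bar>C\<bar> + 1"]) auto
qed

lemma vanish_ball:
  assumes "vanish k p E"
  obtains C r where "C > 0" "r > 0" "\<And>x. norm (x - p) < r \<Longrightarrow> norm (E x) \<le> C * norm (x - p) ^ k"
proof -
  obtain C where "C > 0" and C: "\<forall>\<^sub>F x in nhds p. norm (E x) \<le> C * norm (x - p) ^ k"
    using assms by (rule vanishE)
  from C obtain r where "r > 0" "\<And>x. dist x p < r \<Longrightarrow> norm (E x) \<le> C * norm (x - p) ^ k"
    unfolding eventually_nhds_metric by blast
  with \<open>C > 0\<close> show ?thesis using that by (auto simp: dist_norm)
qed

lemma vanish_zero [simp]: "vanish k p (\<lambda>x. 0)"
  by (rule vanishI[where C = 0]) simp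

lemma vanish_const [simp]: "vanish 0 p (\<lambda>x. c)"
  by (rule vanishI[where C = "norm c"]) simp

lemma vanish_diff_self [simp]: "vanish (Suc 0) p (\<lambda>x. x - p)"
  by (rule vanishI[where C = 1]) simp

lemma vanish_add:
  assumes "vanish k p E" "vanish k p F"
  shows "vanish k p (\<lambda>x. E x + F x)"
proof -
  obtain C where C: "\<forall>\<^sub>F x in nhds p. norm (E x) \<le> C * norm (x - p) ^ k"
    using assms unfolding vanish_def by blast
  obtain D where D: "\<forall>\<^sub>F x in nhds p. norm (F x) \<le> D * norm (x - p) ^ k"
    using assms unfolding vanish_def by blast
  show ?thesis
  proof (rule vanishI[where C = "C + D"], rule eventually_mono[OF eventually_conj[OF C D]])
    fix x
    assume "norm (E x) \<le> C * norm (x - p) ^ k \<and> norm (F x) \<le> D * norm (x - p) ^ k"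
    then show "norm (E x + F x) \<le> (C + D) * norm (x - p) ^ k"
      using norm_triangle_ineq[of "E x" "F x"] by (simp add: distrib_right)
  qed
qed

lemma vanish_minus: "vanish k p E \<Longrightarrow> vanish k p (\<lambda>x. - E x)"
  unfolding vanish_def by simp

lemma vanish_diff:
  "vanish k p E \<Longrightarrow> vanish k p F \<Longrightarrow> vanish k p (\<lambda>x. E x - F x)"
  using vanish_add[of k p E "\<lambda>x. - F x"] vanish_minus[of k p F] by simp

lemma vanish_sum:
  "(\<And>i. i \<in> I \<Longrightarrow> vanish k p (E i)) \<Longrightarrow> vanish k p (\<lambda>x. \<Sum>i\<in>I. E i x)"
  by (induction I rule: infinite_finite_induct) (auto intro: vanish_add)

lemma vanish_mono:
  assumes "vanish j p E" "k \<le> j"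
  shows "vanish k p E"
proof -
  obtain C where "C > 0" and C: "\<forall>\<^sub>F x in nhds p. norm (E x) \<le> C * norm (x - p) ^ j"
    using assms(1) by (rule vanishE)
  have "\<forall>\<^sub>F x in nhds p. dist x p < 1"
    unfolding eventually_nhds_metric by (intro exI[of _ 1]) auto
  with C have "\<forall>\<^sub>F x in nhds p. norm (E x) \<le> C * norm (x - p) ^ k"
  proof eventually_elim
    case (elim x)
    have "norm (x - p) ^ j \<le> norm (x - p) ^ k"
      using elim(2) assms(2) by (intro power_decreasing) (auto simp: dist_norm)
    then show ?case using elim(1) \<open>C > 0\<close> by (meson mult_left_mono less_imp_le order_trans)
  qed
  then show ?thesis by (rule vanishI)
qed

lemma vanish_mult:
  fixes E F :: "'a::real_normed_vector \<Rightarrow> 'b::real_normed_algebra"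
  assumes "vanish j p E" "vanish k p F"
  shows "vanish (j + k) p (\<lambda>x. E x * F x)"
proof -
  obtain C where "C > 0" and C: "\<forall>\<^sub>F x in nhds p. norm (E x) \<le> C * norm (x - p) ^ j"
    using assms(1) by (rule vanishE)
  obtain D where "D > 0" and D: "\<forall>\<^sub>F x in nhds p. norm (F x) \<le> D * norm (x - p) ^ k"
    using assms(2) by (rule vanishE)
  have "\<forall>\<^sub>F x in nhds p. norm (E x * F x) \<le> (C * D) * norm (x - p) ^ (j + k)"
    using C D
  proof eventually_elim
    case (elim x)
    have "norm (E x * F x) \<le> norm (E x) * norm (F x)" by (rule norm_mult_ineq)
    also have "\<dots> \<le> (C * norm (x - p) ^ j) * (D * norm (x - p) ^ k)"
      using elim \<open>C > 0\<close> by (intro mult_mono) auto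
    finally show ?case by (simp add: power_add mult_ac)
  qed
  then show ?thesis by (rule vanishI)
qed

lemma vanish_power:
  fixes E :: "'a::real_normed_vector \<Rightarrow> 'b::real_normed_algebra_1"
  assumes "vanish j p E"
  shows "vanish (j * n) p (\<lambda>x. E x ^ n)"
proof (induction n)
  case (Suc n)
  show ?case using vanish_mult[OF assms Suc] by (simp add: add.commute)
qed simp

lemma vanish_0_continuous:
  assumes "isCont E p" shows "vanish 0 p E"
proof -
  have "\<forall>\<^sub>F x in nhds p. dist (E x) (E p) < 1"
    using assms by (metis isCont_def tendsto_at_iff_tendsto_nhds tendstoD zero_less_one)
  then have "\<forall>\<^sub>F x in nhds p. norm (E x) \<le> (norm (E p) + 1) * norm (x - p) ^ 0"
  proof eventually_elim
    case (elim x)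
    then show ?case using norm_triangle_sub[of "E x" "E p"] by (simp add: dist_norm)
  qed
  then show ?thesis by (rule vanishI)
qed

lemma vanish_tendsto:
  assumes "vanish (Suc k) p (\<lambda>x. F x - c)"
  shows "(F \<longlongrightarrow> c) (nhds p)"
proof -
  obtain C where "C > 0" and C: "\<forall>\<^sub>F x in nhds p. norm (F x - c) \<le> C * norm (x - p) ^ 1"
    using vanish_mono[OF assms, of 1] by (auto elim: vanishE)
  have "((\<lambda>x. C * norm (x - p)) \<longlongrightarrow> C * norm (p - p)) (nhds p)"
    by (intro tendsto_intros) (simp add: filterlim_ident)
  then have "((\<lambda>x. F x - c) \<longlongrightarrow> 0) (nhds p)"
    using C by (intro Lim_null_comparison[where g = "\<lambda>x. C * norm (x - p)" and f = "\<lambda>x. F x - c"]) auto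
  then show ?thesis by (simp add: LIM_zero_iff)
qed

lemma vanish_at:
  assumes "vanish (Suc k) p E" shows "E p = 0"
proof -
  obtain C where C: "\<forall>\<^sub>F x in nhds p. norm (E x) \<le> C * norm (x - p) ^ Suc k"
    using assms unfolding vanish_def by blast
  from eventually_nhds_x_imp_x[OF this] show ?thesis by simp
qed

lemma vanish_compose:
  assumes "vanish k q E" "vanish (Suc 0) p (\<lambda>x. K x - q)"
  shows "vanish k p (\<lambda>x. E (K x))"
proof -
  obtain C where "C > 0" and C: "\<forall>\<^sub>F x in nhds q. norm (E x) \<le> C * norm (x - q) ^ k"
    using assms(1) by (rule vanishE)
  obtain D where "D > 0" and D: "\<forall>\<^sub>F x in nhds p. norm (K x - q) \<le> D * norm (x - p) ^ Suc 0"
    using assms(2) by (rule vanishE)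
  have "\<forall>\<^sub>F x in nhds p. norm (E (K x)) \<le> C * norm (K x - q) ^ k"
    using eventually_compose_filterlim[OF C vanish_tendsto[OF assms(2)]] .
  with D have "\<forall>\<^sub>F x in nhds p. norm (E (K x)) \<le> (C * D ^ k) * norm (x - p) ^ k"
  proof eventually_elim
    case (elim x)
    have "norm (K x - q) ^ k \<le> (D * norm (x - p)) ^ k"
      using elim(1) by (intro power_mono) auto
    then have "C * norm (K x - q) ^ k \<le> C * (D * norm (x - p)) ^ k"
      using \<open>C > 0\<close> by simp
    then show ?case using elim(2) by (simp add: power_mult_distrib)
  qed
  then show ?thesis by (rule vanishI)
qed

lemma norm_vector_smult [simp]:
  fixes x :: "'a::real_normed_field ^ 'n"
  shows "norm (c *s x) = norm c * norm x"
  by (simp add: norm_vec_def norm_mult L2_set_right_distrib)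

lemma vanish_smult:
  fixes F :: "'a::real_normed_vector \<Rightarrow> 'b::real_normed_field ^ 'n"
  assumes "vanish j p E" "vanish k p F"
  shows "vanish (j + k) p (\<lambda>x. E x *s F x)"
proof -
  have "vanish (j + k) p (\<lambda>x. norm (E x) * norm (F x))"
    by (rule vanish_mult) (use assms in \<open>simp_all add: vanish_def\<close>)
  then show ?thesis by (simp add: vanish_def)
qed

lemma vanish_cmul:
  fixes E :: "'a::real_normed_vector \<Rightarrow> 'b::real_normed_algebra_1"
  assumes "vanish k p E" shows "vanish k p (\<lambda>x. c * E x)"
  using vanish_mult[OF vanish_const assms, of c] by simp

lemma vanish_scmul:
  fixes F :: "'a::real_normed_vector \<Rightarrow> 'b::real_normed_field ^ 'n"
  assumes "vanish k p F" shows "vanish k p (\<lambda>x. c *s F x)"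
  using vanish_smult[OF vanish_const assms, of c] by simp

lemma vanish_vec_iff:
  fixes F :: "'a::real_normed_vector \<Rightarrow> 'b::real_normed_vector ^ 'n"
  shows "vanish k p F \<longleftrightarrow> (\<forall>i. vanish k p (\<lambda>x. F x $ i))"
proof
  assume "vanish k p F"
  then obtain C where C: "\<forall>\<^sub>F x in nhds p. norm (F x) \<le> C * norm (x - p) ^ k"
    unfolding vanish_def by blast
  show "\<forall>i. vanish k p (\<lambda>x. F x $ i)"
  proof
    fix i
    show "vanish k p (\<lambda>x. F x $ i)"
      using C by (intro vanishI[where C = C], eventually_elim) (meson Finite_Cartesian_Product.norm_nth_le order_trans)
  qed
next
  assume "\<forall>i. vanish k p (\<lambda>x. F x $ i)"
  then have "vanish k p (\<lambda>x. \<Sum>i\<in>UNIV. norm (F x $ i))"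
    by (intro vanish_sum) (simp add: vanish_def)
  then obtain C where C: "\<forall>\<^sub>F x in nhds p. norm (\<Sum>i\<in>UNIV. norm (F x $ i)) \<le> C * norm (x - p) ^ k"
    unfolding vanish_def by blast
  have "norm (F x) \<le> norm (\<Sum>i\<in>UNIV. norm (F x $ i))" for x
    unfolding norm_vec_def by (rule order_trans[OF L2_set_le_sum]) auto
  then show "vanish k p F"
    by (intro vanishI[where C = C] eventually_mono[OF C]) (meson order_trans)
qed

section \<open>Jets and their behaviour under composition\<close>

definition jet_eq :: "nat \<Rightarrow> 'a::real_normed_vector \<Rightarrow> ('a \<Rightarrow> 'b::real_normed_vector) \<Rightarrow> ('a \<Rightarrow> 'b) \<Rightarrow> bool"
  where "jet_eq m p F G \<longleftrightarrow> vanish (Suc m) p (\<lambda>x. F x - G x)"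

lemma jet_eq_refl [simp]: "jet_eq m p F F"
  by (simp add: jet_eq_def)

lemma jet_eq_sym: "jet_eq m p F G \<Longrightarrow> jet_eq m p G F"
  unfolding jet_eq_def using vanish_minus by fastforce

lemma jet_eq_trans: "jet_eq m p F G \<Longrightarrow> jet_eq m p G H \<Longrightarrow> jet_eq m p F H"
  unfolding jet_eq_def using vanish_add by fastforce

lemma jet_eq_mono: "jet_eq m p F G \<Longrightarrow> k \<le> m \<Longrightarrow> jet_eq k p F G"
  unfolding jet_eq_def by (rule vanish_mono) auto

lemma jet_eq_at: "jet_eq m p F G \<Longrightarrow> F p = G p"
  unfolding jet_eq_def by (drule vanish_at) simp

definition lipschitz_at :: "'a::real_normed_vector \<Rightarrow> ('a \<Rightarrow> 'b::real_normed_vector) \<Rightarrow> bool" where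
  "lipschitz_at p F \<longleftrightarrow> vanish (Suc 0) p (\<lambda>x. F x - F p)"

lemma lipschitz_at_jet_eq:
  assumes "lipschitz_at p F" "jet_eq m p F G" shows "lipschitz_at p G"
proof -
  have "vanish (Suc 0) p (\<lambda>x. (F x - F p) - (F x - G x))"
    using assms unfolding lipschitz_at_def jet_eq_def by (intro vanish_diff[of _ _ "\<lambda>x. F x - F p"]) (auto elim: vanish_mono)
  then show ?thesis unfolding lipschitz_at_def using jet_eq_at[OF assms(2)] by simp
qed

lemma lipschitz_at_tendsto: "lipschitz_at p F \<Longrightarrow> (F \<longlongrightarrow> F p) (nhds p)"
  unfolding lipschitz_at_def by (rule vanish_tendsto)

lemma jet_eq_compose_right:
  assumes "jet_eq m (K p) F G" "lipschitz_at p K"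
  shows "jet_eq m p (\<lambda>x. F (K x)) (\<lambda>x. G (K x))"
  using vanish_compose[of "Suc m" "K p" "\<lambda>y. F y - G y" p K] assms
  unfolding jet_eq_def lipschitz_at_def by simp

text \<open>An outer map is evaluated along two different inner maps, so it needs a bound between
  two moving points. An inner map needs only the weaker \<open>lipschitz_at\<close>.\<close>

definition locally_lipschitz :: "'a::real_normed_vector \<Rightarrow> ('a \<Rightarrow> 'b::real_normed_vector) \<Rightarrow> bool" where
  "locally_lipschitz q H \<longleftrightarrow> (\<exists>L r. r > 0 \<and> (\<forall>x\<in>ball q r. \<forall>y\<in>ball q r. norm (H x - H y) \<le> L * norm (x - y)))"

lemma locally_lipschitz_imp_lipschitz_at:
  assumes "locally_lipschitz q H" shows "lipschitz_at q H"
proof -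
  obtain L r where r: "r > 0" and L: "\<And>x y. x \<in> ball q r \<Longrightarrow> y \<in> ball q r \<Longrightarrow> norm (H x - H y) \<le> L * norm (x - y)"
    using assms unfolding locally_lipschitz_def by blast
  have "\<forall>\<^sub>F x in nhds q. x \<in> ball q r" using r by (intro eventually_nhds_in_open) auto
  then show ?thesis unfolding lipschitz_at_def
    by (intro vanishI[where C = L], eventually_elim) (use L r in auto)
qed

lemma jet_eq_compose_left:
  assumes "jet_eq m p F G" "locally_lipschitz (F p) H" "lipschitz_at p F"
  shows "jet_eq m p (\<lambda>x. H (F x)) (\<lambda>x. H (G x))"
proof -
  obtain L r where r: "r > 0"
    and L: "\<And>x y. x \<in> ball (F p) r \<Longrightarrow> y \<in> ball (F p) r \<Longrightarrow> norm (H x - H y) \<le> L * norm (x - y)"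
    using assms(2) unfolding locally_lipschitz_def by blast
  have FG: "F p = G p" using assms(1) by (rule jet_eq_at)
  have near: "\<forall>\<^sub>F x in nhds (F p). x \<in> ball (F p) r"
    using r by (intro eventually_nhds_in_open) auto
  have "\<forall>\<^sub>F x in nhds p. F x \<in> ball (F p) r"
    using eventually_compose_filterlim[OF near lipschitz_at_tendsto[OF assms(3)]] .
  moreover have "\<forall>\<^sub>F x in nhds p. G x \<in> ball (F p) r"
    using eventually_compose_filterlim[OF near[unfolded FG] lipschitz_at_tendsto[OF lipschitz_at_jet_eq[OF assms(3,1)]]]
    unfolding FG .
  moreover obtain C where "\<forall>\<^sub>F x in nhds p. norm (F x - G x) \<le> C * norm (x - p) ^ Suc m"
    using assms(1) unfolding jet_eq_def vanish_def by blast
  ultimately have "\<forall>\<^sub>F x in nhds p. norm (H (F x) - H (G x)) \<le> (\<bar>L\<bar> * C) * norm (x - p) ^ Suc m"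
  proof eventually_elim
    case (elim x)
    have "norm (H (F x) - H (G x)) \<le> L * norm (F x - G x)" using L elim by blast
    also have "\<dots> \<le> \<bar>L\<bar> * norm (F x - G x)" by (intro mult_right_mono) auto
    also have "\<dots> \<le> \<bar>L\<bar> * (C * norm (x - p) ^ Suc m)" using elim by (intro mult_left_mono) auto
    finally show ?case by simp
  qed
  then show ?thesis unfolding jet_eq_def by (rule vanishI)
qed

subsection \<open>Entire functions of several variables\<close>

lemma continuous_on_smult [continuous_intros]:
  fixes f :: "'a::topological_space \<Rightarrow> 'b::real_normed_field" and g :: "'a \<Rightarrow> 'b ^ 'n"
  assumes "continuous_on S f" "continuous_on S g"
  shows "continuous_on S (\<lambda>x. f x *s g x)"
  unfolding vector_scalar_mult_def using assms by (intro continuous_intros)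

text \<open>For continuous functions, holomorphy on every complex line is holomorphy. In this form
  limits, Taylor terms and Cauchy estimates reduce to one variable; the link to
  \<open>holomorphic_map\<close> is \<open>holomorphic_map_iff\<close>.\<close>

definition entire :: "(complex ^ 'n::finite \<Rightarrow> complex) \<Rightarrow> bool" where
  "entire f \<longleftrightarrow> continuous_on UNIV f \<and> (\<forall>z v. (\<lambda>\<zeta>. f (z + \<zeta> *s v)) holomorphic_on UNIV)"

lemma entire_line: "entire f \<Longrightarrow> (\<lambda>\<zeta>. f (z + \<zeta> *s v)) holomorphic_on S"
  unfolding entire_def using holomorphic_on_subset by blast

lemma entire_continuous: "entire f \<Longrightarrow> continuous_on S f"
  unfolding entire_def using continuous_on_subset by blast

lemma entire_isCont: "entire f \<Longrightarrow> isCont f z"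
  unfolding entire_def by (simp add: continuous_on_eq_continuous_at)

lemma entire_const [simp]: "entire (\<lambda>z. c)"
  by (simp add: entire_def)

lemma entire_coord [simp]: "entire (\<lambda>z. z $ i)"
  by (auto simp: entire_def intro!: continuous_intros holomorphic_intros)

lemma entire_add: "entire f \<Longrightarrow> entire g \<Longrightarrow> entire (\<lambda>z. f z + g z)"
  by (auto simp: entire_def intro!: continuous_intros holomorphic_intros)

lemma entire_diff: "entire f \<Longrightarrow> entire g \<Longrightarrow> entire (\<lambda>z. f z - g z)"
  by (auto simp: entire_def intro!: continuous_intros holomorphic_intros)

lemma entire_minus: "entire f \<Longrightarrow> entire (\<lambda>z. - f z)"
  by (auto simp: entire_def intro!: continuous_intros holomorphic_intros)

lemma entire_mult: "entire f \<Longrightarrow> entire g \<Longrightarrow> entire (\<lambda>z. f z * g z)"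
  by (auto simp: entire_def intro!: continuous_intros holomorphic_intros)

lemma entire_power: "entire f \<Longrightarrow> entire (\<lambda>z. f z ^ k)"
  by (auto simp: entire_def intro!: continuous_intros holomorphic_intros)

lemma entire_sum: "(\<And>i. i \<in> I \<Longrightarrow> entire (f i)) \<Longrightarrow> entire (\<lambda>z. \<Sum>i\<in>I. f i z)"
  by (induction I rule: infinite_finite_induct) (auto intro: entire_add)

lemma entire_prod: "(\<And>i. i \<in> I \<Longrightarrow> entire (f i)) \<Longrightarrow> entire (\<lambda>z. \<Prod>i\<in>I. f i z)"
  by (induction I rule: infinite_finite_induct) (auto intro: entire_mult)

lemma entire_compose_univ:
  assumes "entire f" "g holomorphic_on UNIV"
  shows "entire (\<lambda>z. g (f z))"
  unfolding entire_def
proof (intro conjI allI)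
  show "continuous_on UNIV (\<lambda>z. g (f z))"
    using holomorphic_on_imp_continuous_on[OF assms(2)] entire_continuous[OF assms(1)]
    by (rule continuous_on_compose2) auto
  fix z v
  show "(\<lambda>\<zeta>. g (f (z + \<zeta> *s v))) holomorphic_on UNIV"
    using holomorphic_on_compose_gen[OF entire_line[OF assms(1)] assms(2)] by (auto simp: o_def)
qed

lemma entire_compose_affine:
  assumes "entire f" "continuous_on UNIV A" "\<And>z v \<zeta>. A (z + \<zeta> *s v) = A z + \<zeta> *s B v"
  shows "entire (\<lambda>z. f (A z))"
  unfolding entire_def assms(3)
  using continuous_on_compose2[OF entire_continuous[OF assms(1), of UNIV] assms(2)] entire_line[OF assms(1)]
  by auto

lemma entire_shift: "entire f \<Longrightarrow> entire (\<lambda>z. f (z + p))"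
  by (rule entire_compose_affine[where B = "\<lambda>v. v"]) (auto intro!: continuous_intros simp: algebra_simps)

lemma entire_shift': "entire f \<Longrightarrow> entire (\<lambda>z. f (z - p))"
  using entire_shift[of f "- p"] by simp

lemma entire_shift_scale: "entire f \<Longrightarrow> entire (\<lambda>z. f (p + c *s z))"
  by (rule entire_compose_affine[where B = "\<lambda>v. c *s v"])
    (auto intro!: continuous_intros simp: algebra_simps vector_add_ldistrib vector_smult_assoc)

text \<open>Discs on a line lie in balls, so the convergence is locally uniform on each line and
  Weierstrass' theorem in one variable applies.\<close>

lemma entire_limit:
  assumes "\<And>n. entire (f n)" and "\<And>R. uniform_limit (cball 0 R) f g sequentially"
  shows "entire g"
  unfolding entire_def
proof (intro conjI allI)
  have c: "continuous_on (cball 0 R) g" for R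
    by (rule uniform_limit_theorem[OF _ assms(2)]) (auto intro: always_eventually entire_continuous assms(1))
  have "isCont g z" for z
  proof -
    have "continuous_on (ball 0 (norm z + 1)) g" by (rule continuous_on_subset[OF c[of "norm z + 1"]]) auto
    moreover have "z \<in> ball 0 (norm z + 1)" by simp
    ultimately show ?thesis by (metis continuous_on_eq_continuous_at open_ball)
  qed
  then show "continuous_on UNIV g" by (simp add: continuous_on_eq_continuous_at)
  fix z v
  show "(\<lambda>\<zeta>. g (z + \<zeta> *s v)) holomorphic_on UNIV"
  proof (rule holomorphic_uniform_sequence[where f = "\<lambda>n \<zeta>. f n (z + \<zeta> *s v)"])
    fix x :: complex
    have sub: "z + \<zeta> *s v \<in> cball 0 (norm z + (cmod x + 1) * norm v)" if "\<zeta> \<in> cball x 1" for \<zeta>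
    proof -
      have "cmod \<zeta> \<le> cmod x + 1" using that by (metis add.commute dist_commute dist_norm mem_cball norm_triangle_sub order_trans add_le_cancel_right)
      then show ?thesis using norm_triangle_ineq[of z "\<zeta> *s v"]
        by (simp add: mult_right_mono order_trans)
    qed
    have "uniform_limit (cball x 1) (\<lambda>n \<zeta>. f n (z + \<zeta> *s v)) (\<lambda>\<zeta>. g (z + \<zeta> *s v)) sequentially"
    proof (rule uniform_limitI)
      fix e :: real assume "e > 0"
      from uniform_limitD[OF assms(2) this, of "norm z + (cmod x + 1) * norm v"]
      show "\<forall>\<^sub>F n in sequentially. \<forall>\<zeta>\<in>cball x 1. dist (f n (z + \<zeta> *s v)) (g (z + \<zeta> *s v)) < e"
        by eventually_elim (use sub in blast)
    qed
    then show "\<exists>d>0. cball x d \<subseteq> UNIV \<and> uniform_limit (cball x d) (\<lambda>n \<zeta>. f n (z + \<zeta> *s v)) (\<lambda>\<zeta>. g (z + \<zeta> *s v)) sequentially"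
      by (intro exI[of _ 1]) auto
  qed (auto intro: entire_line assms(1))
qed

section \<open>Taylor expansion and homogeneous parts\<close>

text \<open>Cauchy's inequality bounds coefficient s by M / r^s, so the tail is dominated by a
  geometric series of ratio at most 1/2, whence the factor 2. The evaluation point 1 fits the
  functions \<open>f (p + \<zeta> *s v)\<close> of \<zeta>.\<close>

lemma taylor_remainder_1d:
  assumes hol: "g holomorphic_on UNIV" and r: "r \<ge> 2"
    and M: "\<And>\<zeta>. cmod \<zeta> \<le> r \<Longrightarrow> cmod (g \<zeta>) \<le> M"
  shows "cmod (g 1 - (\<Sum>s\<le>m. (deriv ^^ s) g 0 / fact s)) \<le> 2 * M / r ^ Suc m"
proof -
  define c where "c s = (deriv ^^ s) g 0 / fact s" for s
  have M0: "M \<ge> 0" using M[of 0] r by (auto intro: order_trans[OF norm_ge_zero])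
  have cb: "cmod (c s) \<le> M / r ^ s" for s
  proof -
    have "cmod ((deriv ^^ s) g 0) \<le> fact s * M / r ^ s"
      by (rule Cauchy_inequality)
        (use r M in \<open>auto intro!: holomorphic_on_subset[OF hol] holomorphic_on_imp_continuous_on\<close>)
    then show ?thesis by (simp add: c_def norm_divide field_simps)
  qed
  have "(\<lambda>s. (deriv ^^ s) g 0 / fact s * (1 - 0) ^ s) sums g 1"
    by (rule holomorphic_power_series[where r = 2]) (auto intro: holomorphic_on_subset[OF hol])
  then have sums: "c sums g 1" by (simp add: c_def[abs_def])
  have "(\<lambda>s. c (s + Suc m)) sums (g 1 - (\<Sum>s<Suc m. c s))"
    using sums by (rule sums_split_initial_segment)
  then have tail: "(\<lambda>s. c (s + Suc m)) sums (g 1 - (\<Sum>s\<le>m. c s))"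
    by (simp add: lessThan_Suc_atMost)
  have g: "(\<lambda>s. M / r ^ Suc m * (1/2) ^ s) sums (M / r ^ Suc m * (1 / (1 - 1/2)))"
    by (intro sums_mult geometric_sums) simp
  have le: "cmod (c (s + Suc m)) \<le> M / r ^ Suc m * (1/2) ^ s" for s
  proof -
    have "cmod (c (s + Suc m)) \<le> M / r ^ Suc m * (1 / r) ^ s"
      using cb[of "s + Suc m"] by (simp add: power_add power_divide field_simps)
    also have "\<dots> \<le> M / r ^ Suc m * (1/2) ^ s"
      using r M0 by (intro mult_left_mono power_mono) (auto simp: field_simps)
    finally show ?thesis .
  qed
  have "cmod (\<Sum>s. c (s + Suc m)) \<le> (\<Sum>s. M / r ^ Suc m * (1/2) ^ s)"
    by (rule norm_suminf_le[OF le]) (use g in \<open>auto simp: sums_iff\<close>)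
  then show ?thesis using tail g by (simp add: sums_iff c_def mult.commute[of 2 M])
qed

text \<open>The homogeneous part of degree s of f at p, read off on the line through v. That it is
  entire in v, and hence a polynomial, follows from \<open>taylor_term_entire\<close> and
  \<open>homogeneous_hpoly\<close>.\<close>

definition taylor_term :: "(complex ^ 'n::finite \<Rightarrow> complex) \<Rightarrow> complex ^ 'n \<Rightarrow> nat \<Rightarrow> complex ^ 'n \<Rightarrow> complex" where
  "taylor_term f p s v = (deriv ^^ s) (\<lambda>\<zeta>. f (p + \<zeta> *s v)) 0 / fact s"

lemma taylor_term_0 [simp]: "taylor_term f p 0 v = f p"
  by (simp add: taylor_term_def)

definition homogeneous :: "nat \<Rightarrow> (complex ^ 'n::finite \<Rightarrow> complex) \<Rightarrow> bool" where
  "homogeneous s f \<longleftrightarrow> (\<forall>c v. f (c *s v) = c ^ s * f v)"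

lemma taylor_term_homogeneous:
  assumes "entire f" shows "homogeneous s (taylor_term f p s)"
  unfolding homogeneous_def
proof (intro allI)
  fix c v
  have "(deriv ^^ s) (\<lambda>w. (\<lambda>\<zeta>. f (p + \<zeta> *s v)) (c * w)) 0 = c ^ s * (deriv ^^ s) (\<lambda>\<zeta>. f (p + \<zeta> *s v)) (c * 0)"
    by (rule higher_deriv_compose_linear[where S = UNIV and T = UNIV]) (auto intro: entire_line assms)
  then show "taylor_term f p s (c *s v) = c ^ s * taylor_term f p s v"
    by (simp add: taylor_term_def vector_smult_assoc mult.commute)
qed

text \<open>On the line through v the ball of radius 2 becomes a disc of radius 2 / norm v. The
  one-variable remainder then yields norm v ^ (m+1) with a constant independent of the
  direction.\<close>

lemma taylor_term_remainder:
  assumes f: "entire f" and M: "\<And>w. norm w \<le> 2 \<Longrightarrow> cmod (f (p + w)) \<le> M" and v: "norm v \<le> 1"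
  shows "cmod (f (p + v) - (\<Sum>s\<le>m. taylor_term f p s v)) \<le> M * norm v ^ Suc m"
proof (cases "v = 0")
  case True
  have "(\<Sum>s\<le>m. taylor_term f p s v) = (\<Sum>s\<le>m. if s = 0 then f p else 0)"
    by (rule sum.cong) (auto simp: taylor_term_def True)
  then show ?thesis using True by simp
next
  case False
  have r: "2 / norm v \<ge> 2" using v False by (simp add: field_simps)
  have "cmod (f (p + 1 *s v) - (\<Sum>s\<le>m. (deriv ^^ s) (\<lambda>\<zeta>. f (p + \<zeta> *s v)) 0 / fact s)) \<le> 2 * M / (2 / norm v) ^ Suc m"
  proof (rule taylor_remainder_1d[OF entire_line[OF f] r])
    fix \<zeta> :: complex assume "cmod \<zeta> \<le> 2 / norm v"
    then show "cmod (f (p + \<zeta> *s v)) \<le> M" using False by (intro M) (simp add: field_simps)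
  qed
  also have "2 * M / (2 / norm v) ^ Suc m = M * norm v ^ Suc m / 2 ^ m"
    using False by (simp add: field_simps)
  also have "\<dots> \<le> M * norm v ^ Suc m"
  proof -
    have "0 \<le> M" using M[of 0] by (auto intro: order_trans[OF norm_ge_zero])
    then have "M * norm v ^ Suc m / 2 ^ m \<le> M * norm v ^ Suc m / 1" by (intro divide_left_mono) auto
    then show ?thesis by simp
  qed
  finally show ?thesis by (simp add: taylor_term_def)
qed

lemma entire_bounded:
  assumes "entire f" obtains M where "M > 0" "\<And>w. norm w \<le> R \<Longrightarrow> cmod (f (p + w)) \<le> M"
proof -
  have "compact ((\<lambda>w. f (p + w)) ` cball 0 R)"
    using entire_continuous[OF entire_shift[OF assms, of p]]
    by (intro compact_continuous_image) (auto simp: add.commute)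
  then obtain M where "\<And>x. x \<in> (\<lambda>w. f (p + w)) ` cball 0 R \<Longrightarrow> norm x \<le> M"
    by (meson bounded_iff compact_imp_bounded)
  then have "\<And>w. norm w \<le> R \<Longrightarrow> cmod (f (p + w)) \<le> max M 1" by fastforce
  then show ?thesis using that[of "max M 1"] by simp
qed

text \<open>Induction on the degree: subtract the lower terms at v / N and multiply by N^s. By the
  remainder estimate these entire functions converge to the term of degree s, on each ball with an
  error of size 1 / N.\<close>

lemma taylor_term_entire:
  assumes f: "entire f" shows "entire (taylor_term f p s)"
proof (induction s rule: less_induct)
  case (less s)
  show ?case
  proof (cases s)
    case 0
    then have "taylor_term f p s = (\<lambda>v. f p)" by (auto simp: fun_eq_iff)
    then show ?thesis by simp
  next
    case (Suc k)
    define a :: "nat \<Rightarrow> complex" where "a N = inverse (of_nat (Suc N))" for N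
    define g where "g N v = (f (p + a N *s v) - (\<Sum>r\<le>k. taylor_term f p r (a N *s v))) * of_nat (Suc N) ^ s" for N v
    have an: "cmod (a N) = 1 / real (Suc N)" for N
      unfolding a_def norm_inverse norm_of_nat by (simp add: divide_inverse)
    have a0: "a N * of_nat (Suc N) = 1" for N
      unfolding a_def by (rule left_inverse) (simp del: of_nat_Suc)
    obtain M where M: "M > 0" "\<And>w. norm w \<le> 2 \<Longrightarrow> cmod (f (p + w)) \<le> M"
      using entire_bounded[OF f] by blast
    have gx: "cmod (g N v - taylor_term f p s v) \<le> M * norm v ^ Suc s / real (Suc N)" if "norm v \<le> real (Suc N)" for N v
    proof -
      have "norm (a N *s v) \<le> 1" using that by (simp add: an)
      from taylor_term_remainder[OF f M(2) this, of s]
      have le: "cmod (f (p + a N *s v) - (\<Sum>r\<le>s. taylor_term f p r (a N *s v))) \<le> M * norm (a N *s v) ^ Suc s" by simp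
      have "taylor_term f p s v = taylor_term f p s (a N *s v) * of_nat (Suc N) ^ s"
        using taylor_term_homogeneous[OF f, of s p] a0[of N]
        by (simp add: homogeneous_def power_mult_distrib[symmetric] mult.commute mult.left_commute del: of_nat_Suc)
      then have "g N v - taylor_term f p s v = (f (p + a N *s v) - (\<Sum>r\<le>s. taylor_term f p r (a N *s v))) * of_nat (Suc N) ^ s"
        unfolding g_def Suc by (simp add: algebra_simps del: of_nat_Suc)
      also have "cmod \<dots> \<le> M * norm (a N *s v) ^ Suc s * real (Suc N) ^ s"
        unfolding norm_mult norm_power norm_of_nat by (intro mult_right_mono le) auto
      also have "\<dots> = M * norm v ^ Suc s / real (Suc N)"
        unfolding norm_vector_smult an by (simp add: power_mult_distrib power_divide field_simps del: of_nat_Suc)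
      finally show ?thesis .
    qed
    show ?thesis
    proof (rule entire_limit[where f = g])
      fix N
      have "entire (\<lambda>v. taylor_term f p r (0 + a N *s v))" if "r \<le> k" for r
        by (rule entire_shift_scale) (use less.IH that Suc in auto)
      then show "entire (g N)"
        unfolding g_def using entire_shift_scale[OF f]
        by (intro entire_mult entire_diff entire_sum) auto
    next
      fix R :: real
      show "uniform_limit (cball 0 R) g (taylor_term f p s) sequentially"
      proof (rule uniform_limitI)
        fix e :: real assume "e > 0"
        obtain K where K: "real K > \<bar>R\<bar> + M * \<bar>R\<bar> ^ Suc s / e" using reals_Archimedean2 by blast
        have q: "M * \<bar>R\<bar> ^ Suc s / e \<ge> 0" using M \<open>e > 0\<close> by simp
        show "\<forall>\<^sub>F N in sequentially. \<forall>v\<in>cball 0 R. dist (g N v) (taylor_term f p s v) < e"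
          using eventually_ge_at_top[of K]
        proof eventually_elim
          case (elim N)
          show ?case
          proof
            fix v :: "complex ^ 'a" assume "v \<in> cball 0 R"
            then have v: "norm v \<le> \<bar>R\<bar>" by simp
            have N: "real (Suc N) > \<bar>R\<bar> + M * \<bar>R\<bar> ^ Suc s / e" using K elim by simp
            have "cmod (g N v - taylor_term f p s v) \<le> M * norm v ^ Suc s / real (Suc N)"
              using v N q by (intro gx) linarith
            also have "\<dots> \<le> M * \<bar>R\<bar> ^ Suc s / real (Suc N)"
              using v M by (intro divide_right_mono mult_left_mono power_mono) auto
            also have "\<dots> < e"
            proof -
              have "M * \<bar>R\<bar> ^ Suc s / e < real (Suc N)" using N by linarith
              then show ?thesis using \<open>e > 0\<close> by (simp add: field_simps del: of_nat_Suc)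
            qed
            finally show "dist (g N v) (taylor_term f p s v) < e" by (simp add: dist_norm)
          qed
        qed
      qed
    qed
  qed
qed

lemma taylor_term_vanish:
  assumes "entire f" shows "vanish (Suc m) p (\<lambda>x. f x - (\<Sum>s\<le>m. taylor_term f p s (x - p)))"
proof -
  obtain M where M: "M > 0" "\<And>w. norm w \<le> 2 \<Longrightarrow> cmod (f (p + w)) \<le> M"
    using entire_bounded[OF assms] by blast
  have "\<forall>\<^sub>F x in nhds p. dist x p < 1"
    unfolding eventually_nhds_metric by (intro exI[of _ 1]) auto
  then have "\<forall>\<^sub>F x in nhds p. norm (f x - (\<Sum>s\<le>m. taylor_term f p s (x - p))) \<le> M * norm (x - p) ^ Suc m"
  proof eventually_elim
    case (elim x)
    then show ?case using taylor_term_remainder[OF assms M(2), of "x - p" m] by (simp add: dist_norm)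
  qed
  then show ?thesis by (rule vanishI)
qed

lemma taylor_term_bound:
  assumes f: "entire f" and r: "r > 0" and M: "\<And>w. norm w \<le> r \<Longrightarrow> cmod (f (p + w)) \<le> M"
  shows "cmod (taylor_term f p s v) \<le> M * (norm v / r) ^ s"
proof (cases "v = 0")
  case True
  have "taylor_term f p s v = (if s = 0 then f p else 0)" by (auto simp: taylor_term_def True)
  then show ?thesis using M[of 0] r True by (cases s) auto
next
  case False
  have "cmod ((deriv ^^ s) (\<lambda>\<zeta>. f (p + \<zeta> *s v)) 0) \<le> fact s * M / (r / norm v) ^ s"
  proof (rule Cauchy_inequality)
    show "r / norm v > 0" using r False by simp
    fix x :: complex assume "cmod (0 - x) = r / norm v"
    then show "cmod (f (p + x *s v)) \<le> M" using False by (intro M) simp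
  qed (auto intro!: entire_line f holomorphic_on_imp_continuous_on)
  then show ?thesis using False r by (simp add: taylor_term_def norm_divide power_divide field_simps)
qed

lemma homogeneous_vanish:
  assumes f: "entire f" and h: "homogeneous s f" shows "vanish s p (\<lambda>x. f (x - p))"
proof -
  obtain M where M: "M > 0" "\<And>w. norm w \<le> 1 \<Longrightarrow> cmod (f (0 + w)) \<le> M"
    using entire_bounded[OF f] by blast
  have "cmod (f v) \<le> M * norm v ^ s" for v
  proof (cases "v = 0")
    case True
    have "f (0 *s v) = 0 ^ s * f v" using h unfolding homogeneous_def by blast
    then show ?thesis using M(2)[of 0] True by (cases s) auto
  next
    case False
    define c where "c = complex_of_real (norm v)"
    have "v = c *s (inverse c *s v)" using False by (simp add: c_def vector_smult_assoc)
    then have "f v = c ^ s * f (inverse c *s v)" using h unfolding homogeneous_def by metis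
    moreover have "cmod (f (inverse c *s v)) \<le> M"
      using M(2)[of "inverse c *s v"] False by (simp add: c_def norm_inverse)
    ultimately show ?thesis
      by (simp add: norm_mult norm_power c_def mult_right_mono mult.commute[of _ "cmod _"])
  qed
  then show ?thesis by (intro vanishI[where C = M] always_eventually allI)
qed

text \<open>Along t w the value is t^s f w while the bound is of size t^(s+1); divide by t^s and let
  t tend to 0.\<close>

lemma homogeneous_vanish_zero:
  assumes h: "homogeneous s f" and v: "vanish (Suc s) p (\<lambda>x. f (x - p))"
  shows "f w = 0"
proof -
  obtain C r where C: "C > 0" "r > 0" "\<And>x. norm (x - p) < r \<Longrightarrow> cmod (f (x - p)) \<le> C * norm (x - p) ^ Suc s"
    using v by (rule vanish_ball) blast
  define B where "B = C * norm w ^ Suc s"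
  have le: "cmod (f w) \<le> t * B" if t: "0 < t" "t * (norm w + 1) < r" for t :: real
  proof -
    have "t * norm w < r" using t by (simp add: distrib_left)
    then have "norm ((p + complex_of_real t *s w) - p) < r" using t by simp
    from C(3)[OF this] have "cmod (f (complex_of_real t *s w)) \<le> C * (t * norm w) ^ Suc s" using t by simp
    moreover have "f (complex_of_real t *s w) = complex_of_real t ^ s * f w"
      using h by (simp add: homogeneous_def)
    ultimately have "t ^ s * cmod (f w) \<le> t ^ s * (t * B)"
      using t by (simp add: norm_mult norm_power B_def power_mult_distrib mult_ac)
    then show ?thesis using t by (simp add: mult_le_cancel_left)
  qed
  have "cmod (f w) \<le> 0"
  proof (rule field_le_epsilon)
    fix e :: real assume e: "e > 0"
    \<comment> \<open>The first entry makes t * B at most e, the second keeps t w inside the ball of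
      radius r.\<close>
    define t where "t = min (e / (B + 1)) (r / (2 * (norm w + 1)))"
    have B: "B \<ge> 0" using C by (simp add: B_def)
    have nw: "norm w + 1 > 0" by (simp add: add_nonneg_pos)
    have "t > 0" using e B C nw by (auto simp: t_def)
    have "t * (norm w + 1) \<le> r / (2 * (norm w + 1)) * (norm w + 1)"
      using nw by (intro mult_right_mono) (auto simp: t_def)
    also have "\<dots> = r / 2" using nw by (simp add: field_simps)
    finally have "t * (norm w + 1) < r" using C by simp
    then have "cmod (f w) \<le> t * B" using \<open>t > 0\<close> by (intro le)
    also have "\<dots> \<le> e / (B + 1) * B" using B by (intro mult_right_mono) (auto simp: t_def)
    also have "\<dots> \<le> e" using e B by (simp add: field_simps)
    finally show "cmod (f w) \<le> 0 + e" by simp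
  qed
  then show ?thesis by simp
qed

text \<open>Once all lower terms vanish, the term of degree s is itself of order s + 1 at p, which a
  nonzero homogeneous function of degree s cannot be.\<close>

lemma taylor_term_zero_of_vanish:
  assumes f: "entire f" and v: "vanish q p f" and s: "s < q"
  shows "taylor_term f p s w = 0"
  using s
proof (induction s arbitrary: w rule: less_induct)
  case (less s)
  have "vanish (Suc s) p (\<lambda>x. f x - (f x - (\<Sum>r\<le>s. taylor_term f p r (x - p))))"
    by (rule vanish_diff[OF vanish_mono[OF v] taylor_term_vanish[OF f]]) (use less(2) in simp)
  moreover have "(\<Sum>r\<le>s. taylor_term f p r x) = taylor_term f p s x" for x
  proof -
    have "(\<Sum>r\<le>s. taylor_term f p r x) = (\<Sum>r\<in>{s}. taylor_term f p r x)"
      by (rule sum.mono_neutral_right) (use less in auto)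
    then show ?thesis by simp
  qed
  ultimately have "vanish (Suc s) p (\<lambda>x. taylor_term f p s (x - p))" by simp
  then show ?case by (rule homogeneous_vanish_zero[OF taylor_term_homogeneous[OF f]])
qed

lemma vanish_minus_taylor_term:
  assumes f: "entire f" and v: "vanish q p f"
  shows "vanish (Suc q) p (\<lambda>x. f x - taylor_term f p q (x - p))"
proof -
  have "(\<Sum>r\<le>q. taylor_term f p r x) = taylor_term f p q x" for x
  proof -
    have "(\<Sum>r\<le>q. taylor_term f p r x) = (\<Sum>r\<in>{q}. taylor_term f p r x)"
      by (rule sum.mono_neutral_right) (use taylor_term_zero_of_vanish[OF f v] in auto)
    then show ?thesis by simp
  qed
  then show ?thesis using taylor_term_vanish[OF f, of q p] by simp
qed

lemma entire_tendsto_line: "entire f \<Longrightarrow> ((\<lambda>\<zeta>. f (z + \<zeta> *s v)) \<longlongrightarrow> f z) (at 0)"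
  using holomorphic_on_imp_continuous_on[OF entire_line[of f z v UNIV]]
  unfolding continuous_on_eq_continuous_at[OF open_UNIV] isCont_def
  by (metis UNIV_I add.right_neutral vector_smult_lzero)

text \<open>The case c = 0 follows from the others by continuity along a line.\<close>

lemma homogeneousI:
  assumes f: "entire f" and h: "\<And>c v. c \<noteq> 0 \<Longrightarrow> f (c *s v) = c ^ s * f v"
  shows "homogeneous s f"
  unfolding homogeneous_def
proof (intro allI)
  fix c v
  have 1: "((\<lambda>c. f (0 + c *s v)) \<longlongrightarrow> f 0) (at 0)" by (rule entire_tendsto_line[OF f])
  have 2: "((\<lambda>c. c ^ s * f v) \<longlongrightarrow> 0 ^ s * f v) (at (0::complex))"
    by (intro tendsto_intros)
  have 3: "\<forall>\<^sub>F c in at (0::complex). f (0 + c *s v) = c ^ s * f v"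
    using h by (auto simp: eventually_at intro!: exI[of _ 1])
  have "f 0 = 0 ^ s * f v"
    by (rule tendsto_unique[OF at_neq_bot 1 iffD2[OF tendsto_cong[OF 3] 2]])
  then show "f (c *s v) = c ^ s * f v" using h by (cases "c = 0") auto
qed

text \<open>On the line v + \<zeta> w the function grows at most linearly, since v + z w = z (v / z
  + w) and v / z + w stays bounded. By Liouville it is affine, f v + b \<zeta>. The same rescaling
  of w + \<zeta> v, with \<zeta> tending to 0, identifies the slope b as f w.\<close>

lemma homogeneous_1_add:
  assumes f: "entire f" and h: "homogeneous 1 f"
  shows "f (v + w) = f v + f w"
proof -
  have hc: "f (c *s v) = c * f v" for c v using h by (simp add: homogeneous_def)
  obtain M where M: "M > 0" "\<And>w. norm w \<le> 1 \<Longrightarrow> cmod (f (0 + w)) \<le> M"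
    using entire_bounded[OF f] by blast
  define g where "g \<zeta> = f (v + \<zeta> *s w)" for \<zeta>
  have bd: "cmod (g z) \<le> (M * (norm v + norm w)) * cmod z ^ 1" if "1 \<le> cmod z" for z
  proof -
    define K where "K = norm v + cmod z * norm w + 1"
    have K: "K > 0" by (simp add: K_def add_nonneg_pos)
    have "z \<noteq> 0" using that by auto
    then have "v + z *s w = z *s (inverse z *s v + w)"
      by (auto simp: vector_add_ldistrib vector_smult_assoc)
    then have gz: "g z = z * f (inverse z *s v + w)" unfolding g_def by (simp only: hc)
    define N where "N = norm v + norm w"
    have nl: "norm (inverse z *s v + w) \<le> N"
    proof -
      have "inverse (cmod z) * norm v \<le> 1 * norm v" using that by (intro mult_right_mono) (auto simp: inverse_le_1_iff)
      then show ?thesis unfolding N_def using norm_triangle_ineq[of "inverse z *s v" w] by (simp add: norm_inverse)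
    qed
    have "cmod (f (inverse z *s v + w)) \<le> M * N"
    proof (cases "N = 0")
      case True
      then have "inverse z *s v + w = 0 *s v" using nl by simp
      then show ?thesis using hc[of 0 v] True by simp
    next
      case False
      then have N: "N > 0" by (simp add: N_def add_nonneg_eq_0_iff order_less_le)
      define c where "c = complex_of_real N"
      have "inverse z *s v + w = c *s (inverse c *s (inverse z *s v + w))"
        using False by (simp add: c_def vector_smult_assoc)
      then have "f (inverse z *s v + w) = c * f (inverse c *s (inverse z *s v + w))"
        using hc by metis
      moreover have "cmod (f (inverse c *s (inverse z *s v + w))) \<le> M"
      proof -
        have "norm (inverse c *s (inverse z *s v + w)) \<le> inverse N * N"
          unfolding norm_vector_smult using nl N by (intro mult_mono) (auto simp: c_def norm_inverse)
        then show ?thesis using M(2)[of "inverse c *s (inverse z *s v + w)"] N by simp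
      qed
      ultimately show ?thesis using N by (simp add: norm_mult c_def mult.commute)
    qed
    then have "cmod z * cmod (f (inverse z *s v + w)) \<le> cmod z * (M * N)" by (rule mult_left_mono) simp
    then show ?thesis unfolding gz N_def by (simp add: norm_mult mult_ac)
  qed
  have ghol: "g holomorphic_on UNIV" unfolding g_def by (rule entire_line[OF f])
  define b where "b = deriv g 0"
  have lin: "g z = f v + b * z" for z
    using Liouville_polynomial[where \<xi> = z and A = 1 and f = g, OF ghol bd] by (simp add: b_def g_def[of 0])
  have 1: "((\<lambda>\<zeta>. f (w + \<zeta> *s v)) \<longlongrightarrow> f w) (at 0)" by (rule entire_tendsto_line[OF f])
  have 2: "((\<lambda>\<zeta>. \<zeta> * f v + b) \<longlongrightarrow> 0 * f v + b) (at 0)" by (intro tendsto_intros)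
  have "f (w + \<zeta> *s v) = \<zeta> * f v + b" if "\<zeta> \<noteq> 0" for \<zeta>
  proof -
    have "w + \<zeta> *s v = \<zeta> *s (v + inverse \<zeta> *s w)"
      using that by (simp add: vector_add_ldistrib vector_smult_assoc add.commute)
    then have "f (w + \<zeta> *s v) = \<zeta> * g (inverse \<zeta>)" unfolding g_def by (simp only: hc)
    moreover have "\<zeta> * inverse \<zeta> = 1" using that by simp
    ultimately show ?thesis by (metis (no_types, lifting) distrib_left lin mult.left_commute mult.right_neutral)
  qed
  then have 3: "\<forall>\<^sub>F \<zeta> in at 0. f (w + \<zeta> *s v) = \<zeta> * f v + b"
    by (auto simp: eventually_at intro!: exI[of _ 1])
  have "f w = b"
    using tendsto_unique[OF at_neq_bot 1 iffD2[OF tendsto_cong[OF 3] 2]] by simp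
  then show ?thesis using lin[of 1] by (simp add: g_def)
qed

lemma homogeneous_1_sum:
  assumes f: "entire f" and h: "homogeneous 1 f"
  shows "f v = (\<Sum>i\<in>UNIV. v $ i * f (axis i 1))"
proof -
  have hc: "f (c *s v) = c * f v" for c v using h by (simp add: homogeneous_def)
  have "f (\<Sum>i\<in>I. v $ i *s axis i 1) = (\<Sum>i\<in>I. v $ i * f (axis i 1))" for I :: "'a set"
  proof (induction I rule: infinite_finite_induct)
    case (insert i I)
    then show ?case by (simp add: homogeneous_1_add[OF f h] hc)
  qed (use hc[of 0] in auto)
  from this[of UNIV] show ?thesis unfolding basis_expansion .
qed

section \<open>Directional derivatives and Cauchy estimates\<close>

lemma entire_line_derivative:
  assumes "entire f"
  shows "((\<lambda>\<zeta>. f (z + \<zeta> *s v)) has_field_derivative taylor_term f (z + c *s v) 1 v) (at c)"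
proof -
  have "(\<lambda>\<zeta>. f ((z + c *s v) + \<zeta> *s v)) field_differentiable at 0"
    using entire_line[OF assms, of "z + c *s v" v UNIV] by (simp add: holomorphic_on_open field_differentiable_def)
  then have "((\<lambda>\<zeta>. f ((z + c *s v) + \<zeta> *s v)) has_field_derivative taylor_term f (z + c *s v) 1 v) (at 0)"
    by (simp add: taylor_term_def DERIV_deriv_iff_field_differentiable)
  then have "((\<lambda>\<zeta>. f (z + (\<zeta> + c) *s v)) has_field_derivative taylor_term f (z + c *s v) 1 v) (at 0)"
    by (simp add: vector_sadd_rdistrib add_ac)
  then show ?thesis using DERIV_shift[of "\<lambda>\<zeta>. f (z + \<zeta> *s v)" "taylor_term f (z + c *s v) 1 v" 0 c] by simp
qed

text \<open>Difference quotients with step 1 / N are entire in p. They converge uniformly for p in a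
  ball, because one bound of f on a slightly larger ball serves in the quadratic remainder for all
  these p.\<close>

lemma entire_derivative:
  assumes f: "entire f" shows "entire (\<lambda>p. taylor_term f p 1 v)"
proof -
  define a :: "nat \<Rightarrow> complex" where "a N = inverse (of_nat (Suc N))" for N
  define g where "g N p = (f (p + a N *s v) - f p) * of_nat (Suc N)" for N p
  have an: "cmod (a N) = 1 / real (Suc N)" for N
    unfolding a_def norm_inverse norm_of_nat by (simp add: divide_inverse)
  have a0: "a N * of_nat (Suc N) = 1" for N
    unfolding a_def by (rule left_inverse) (simp del: of_nat_Suc)
  show ?thesis
  proof (rule entire_limit[where f = g])
    fix N
    show "entire (g N)"
      unfolding g_def using entire_shift[OF f, of "a N *s v"]
      by (intro entire_mult entire_diff f) auto
  next
    fix R :: real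
    obtain M where M: "M > 0" "\<And>w. norm w \<le> \<bar>R\<bar> + 2 \<Longrightarrow> cmod (f (0 + w)) \<le> M"
      using entire_bounded[OF f] by blast
    have gx: "cmod (g N p - taylor_term f p 1 v) \<le> M * norm v ^ 2 / real (Suc N)"
      if N: "norm v \<le> real (Suc N)" and p: "norm p \<le> \<bar>R\<bar>" for N p
    proof -
      have "norm (a N *s v) \<le> 1" using N by (simp add: an)
      moreover have "cmod (f (p + w)) \<le> M" if "norm w \<le> 2" for w
        using M(2)[of "p + w"] p that norm_triangle_ineq[of p w] by simp
      ultimately have "cmod (f (p + a N *s v) - (\<Sum>r\<le>1. taylor_term f p r (a N *s v))) \<le> M * norm (a N *s v) ^ Suc 1"
        by (intro taylor_term_remainder[OF f])
      then have le: "cmod (f (p + a N *s v) - f p - taylor_term f p 1 (a N *s v)) \<le> M * norm (a N *s v) ^ 2"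
        by (simp add: diff_diff_eq numeral_2_eq_2)
      have "taylor_term f p 1 v = taylor_term f p 1 (a N *s v) * of_nat (Suc N)"
        using taylor_term_homogeneous[OF f, of 1 p] a0[of N]
        by (simp add: homogeneous_def mult.commute mult.left_commute del: of_nat_Suc)
      then have "g N p - taylor_term f p 1 v = (f (p + a N *s v) - f p - taylor_term f p 1 (a N *s v)) * of_nat (Suc N)"
        unfolding g_def by (simp add: algebra_simps del: of_nat_Suc)
      also have "cmod \<dots> \<le> M * norm (a N *s v) ^ 2 * real (Suc N)"
        unfolding norm_mult norm_power norm_of_nat by (intro mult_right_mono le) auto
      also have "\<dots> = M * norm v ^ 2 / real (Suc N)"
        unfolding norm_vector_smult an by (simp add: power_mult_distrib power_divide power2_eq_square field_simps del: of_nat_Suc)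
      finally show ?thesis .
    qed
    show "uniform_limit (cball 0 R) g (\<lambda>p. taylor_term f p 1 v) sequentially"
    proof (rule uniform_limitI)
      fix e :: real assume "e > 0"
      obtain K where K: "real K > norm v + M * norm v ^ 2 / e" using reals_Archimedean2 by blast
      have q: "M * norm v ^ 2 / e \<ge> 0" using M \<open>e > 0\<close> by simp
      show "\<forall>\<^sub>F N in sequentially. \<forall>p\<in>cball 0 R. dist (g N p) (taylor_term f p 1 v) < e"
        using eventually_ge_at_top[of K]
      proof eventually_elim
        case (elim N)
        show ?case
        proof
          fix p :: "complex ^ 'a" assume "p \<in> cball 0 R"
          then have p: "norm p \<le> \<bar>R\<bar>" by simp
          have N: "real (Suc N) > norm v + M * norm v ^ 2 / e" using K elim by simp
          have "cmod (g N p - taylor_term f p 1 v) \<le> M * norm v ^ 2 / real (Suc N)"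
            using p N q by (intro gx) auto
          also have "\<dots> < e"
          proof -
            have "M * norm v ^ 2 / e < real (Suc N)" using N by (smt (verit) norm_ge_zero)
            then show ?thesis using \<open>e > 0\<close> by (simp add: field_simps del: of_nat_Suc)
          qed
          finally show "dist (g N p) (taylor_term f p 1 v) < e" by (simp add: dist_norm)
        qed
      qed
    qed
  qed
qed

text \<open>The segment between the two points stays in the ball of radius r, and about each of its
  points a ball of radius r fits into that of radius 2 r; Cauchy's estimate there bounds the
  derivative.\<close>

lemma entire_lipschitz:
  assumes f: "entire f" and r: "r > 0" and M: "\<And>w. norm (w - p) \<le> 2 * r \<Longrightarrow> cmod (f w) \<le> M"
    and x: "norm (x - p) \<le> r" and y: "norm (y - p) \<le> r"
  shows "cmod (f x - f y) \<le> M / r * norm (x - y)"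
proof -
  define g where "g \<zeta> = f (y + \<zeta> *s (x - y))" for \<zeta>
  have "cmod (g 1 - g 0) \<le> M * (norm (x - y) / r) ^ 1 * cmod (1 - 0)"
  proof (rule field_differentiable_bound[where S = "closed_segment 0 1"])
    fix z :: complex assume "z \<in> closed_segment 0 1"
    then obtain u where u: "0 \<le> u" "u \<le> 1" "z = of_real u" by (auto simp: closed_segment_def scaleR_conv_of_real)
    have "y + z *s (x - y) - p = (1 - u) *\<^sub>R (y - p) + u *\<^sub>R (x - p)"
      unfolding u by (simp add: vec_eq_iff) (simp add: scaleR_conv_of_real algebra_simps)
    also have "norm \<dots> \<le> (1 - u) * norm (y - p) + u * norm (x - p)"
      by (rule norm_triangle_le) (use u in simp)
    also have "\<dots> \<le> (1 - u) * r + u * r" using u x y by (intro add_mono mult_left_mono) auto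
    finally have zr: "norm (y + z *s (x - y) - p) \<le> r" by (simp add: algebra_simps)
    show "cmod (taylor_term f (y + z *s (x - y)) 1 (x - y)) \<le> M * (norm (x - y) / r) ^ 1"
    proof (rule taylor_term_bound[OF f r])
      fix w :: "complex ^ 'a" assume "norm w \<le> r"
      then show "cmod (f (y + z *s (x - y) + w)) \<le> M"
        using norm_triangle_ineq[of "y + z *s (x - y) - p" w] zr by (intro M) (simp add: algebra_simps)
    qed
    show "(g has_field_derivative taylor_term f (y + z *s (x - y)) 1 (x - y)) (at z within closed_segment 0 1)"
      unfolding g_def by (rule has_field_derivative_at_within[OF entire_line_derivative[OF f]])
  qed auto
  then show ?thesis by (simp add: g_def)
qed

text \<open>Cauchy's estimate on the ball of radius norm (x - p) about x loses exactly one power of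
  that distance.\<close>

lemma vanish_derivative:
  assumes f: "entire f" and v: "vanish (Suc k) p f"
  shows "vanish k p (\<lambda>x. taylor_term f x 1 w)"
proof (cases k)
  case 0
  then show ?thesis using entire_isCont[OF entire_derivative[OF f]] by (simp add: vanish_0_continuous)
next
  case (Suc j)
  obtain C r where C: "C > 0" "r > 0" "\<And>x. norm (x - p) < r \<Longrightarrow> cmod (f x) \<le> C * norm (x - p) ^ Suc k"
    using v by (rule vanish_ball) blast
  have le: "cmod (taylor_term f x 1 w) \<le> (C * 2 ^ Suc k * norm w) * norm (x - p) ^ k" if x: "norm (x - p) < r / 2" for x
  proof (cases "x = p")
    \<comment> \<open>At p the radius degenerates. There the derivative is 0, because k > 0 makes f
      vanish to order at least 2.\<close>
    case True
    then show ?thesis using taylor_term_zero_of_vanish[OF f v, of 1] Suc by simp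
  next
    case False
    define \<rho> where "\<rho> = norm (x - p)"
    have \<rho>: "\<rho> > 0" "\<rho> < r / 2" using False x by (auto simp: \<rho>_def)
    have "cmod (taylor_term f x 1 w) \<le> (C * (2 * \<rho>) ^ Suc k) * (norm w / \<rho>) ^ 1"
    proof (rule taylor_term_bound[OF f \<rho>(1)])
      fix u :: "complex ^ 'a" assume u: "norm u \<le> \<rho>"
      have n: "norm (x + u - p) \<le> 2 * \<rho>" using norm_triangle_ineq[of "x - p" u] u by (simp add: \<rho>_def algebra_simps)
      then have "cmod (f (x + u)) \<le> C * norm (x + u - p) ^ Suc k" using \<rho> by (intro C) simp
      also have "\<dots> \<le> C * (2 * \<rho>) ^ Suc k" using C n by (intro mult_left_mono power_mono) auto
      finally show "cmod (f (x + u)) \<le> C * (2 * \<rho>) ^ Suc k" .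
    qed
    also have "\<dots> = (C * 2 ^ Suc k * norm w) * \<rho> ^ k"
      using \<rho> by (simp add: power_mult_distrib field_simps)
    finally show ?thesis by (simp add: \<rho>_def)
  qed
  have "\<forall>\<^sub>F x in nhds p. dist x p < r / 2"
    unfolding eventually_nhds_metric using C by (intro exI[of _ "r / 2"]) auto
  then show ?thesis
    by (intro vanishI[where C = "C * 2 ^ Suc k * norm w"], eventually_elim) (use le in \<open>auto simp: dist_norm\<close>)
qed

text \<open>A mean value estimate: the derivative of f has order k at p and the displacement has
  order j + 1, so the orders add.\<close>

lemma vanish_perturb:
  assumes f: "entire f" and v: "vanish (Suc k) p f" and K: "vanish (Suc j) p (\<lambda>x. K x - x)"
  shows "vanish (k + Suc j) p (\<lambda>x. f (K x) - f x)"
proof -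
  obtain C r where C: "C > 0" "r > 0" "\<And>x. norm (x - p) < r \<Longrightarrow> cmod (f x) \<le> C * norm (x - p) ^ Suc k"
    using v by (rule vanish_ball) blast
  obtain D where D: "D > 0" "\<forall>\<^sub>F x in nhds p. norm (K x - x) \<le> D * norm (x - p) ^ Suc j"
    using K by (rule vanishE)
  have D1: "\<forall>\<^sub>F x in nhds p. dist x p < min 1 (r / (2 * (1 + D)))"
    unfolding eventually_nhds_metric using C D by (intro exI[of _ "min 1 (r / (2 * (1 + D)))"]) (auto intro: add_pos_pos)
  define B where "B = C * 2 ^ Suc k * (1 + D) ^ k * D"
  have "\<forall>\<^sub>F x in nhds p. cmod (f (K x) - f x) \<le> B * norm (x - p) ^ (k + Suc j)"
    using D(2) D1
  proof eventually_elim
    case (elim x)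
    show ?case
    proof (cases "x = p")
      case True
      then show ?thesis using elim by simp
    next
      case False
      define t where "t = norm (x - p)"
      have t: "0 < t" "t < 1" "t < r / (2 * (1 + D))" using elim False by (auto simp: t_def dist_norm)
      \<comment> \<open>Large enough for both x and K x, yet comparable to the distance t from
        p.\<close>
      define \<rho> where "\<rho> = (1 + D) * t"
      have \<rho>: "\<rho> > 0" "2 * \<rho> < r" "t \<le> \<rho>" using t D(1) by (auto simp: \<rho>_def field_simps intro: add_pos_pos)
      have "D * t ^ Suc j \<le> D * t" using t D by (auto simp: mult_left_le power_le_one)
      then have Kx: "norm (K x - p) \<le> \<rho>"
        using elim(1) norm_triangle_ineq[of "K x - x" "x - p"] by (simp add: t_def \<rho>_def algebra_simps)
      have "cmod (f (K x) - f x) \<le> (C * (2 * \<rho>) ^ Suc k) / \<rho> * norm (K x - x)"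
      proof (rule entire_lipschitz[OF f \<rho>(1)])
        fix w assume w: "norm (w - p) \<le> 2 * \<rho>"
        then have "cmod (f w) \<le> C * norm (w - p) ^ Suc k" using \<rho> by (intro C) simp
        also have "\<dots> \<le> C * (2 * \<rho>) ^ Suc k" using C w by (intro mult_left_mono power_mono) auto
        finally show "cmod (f w) \<le> C * (2 * \<rho>) ^ Suc k" .
      qed (use Kx \<rho> in \<open>auto simp: t_def\<close>)
      also have "\<dots> \<le> (C * (2 * \<rho>) ^ Suc k) / \<rho> * (D * t ^ Suc j)"
        using elim(1) \<rho> C by (intro mult_left_mono) (auto simp: t_def)
      also have "\<dots> = B * t ^ (k + Suc j)"
      proof -
        have "(C * (2 * \<rho>) ^ Suc k) / \<rho> = C * 2 ^ Suc k * \<rho> ^ k" using \<rho> by (simp add: power_mult_distrib field_simps)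
        then show ?thesis by (simp add: B_def \<rho>_def power_mult_distrib power_add mult_ac)
      qed
      finally show ?thesis by (simp add: t_def)
    qed
  qed
  then show ?thesis by (rule vanishI)
qed

subsection \<open>Holomorphic maps and their Jacobians\<close>

lemma taylor_term_1_sum:
  assumes "entire f"
  shows "taylor_term f p 1 v = (\<Sum>i\<in>UNIV. v $ i * taylor_term f p 1 (axis i 1))"
  by (rule homogeneous_1_sum[OF taylor_term_entire[OF assms] taylor_term_homogeneous[OF assms]])

lemma has_derivative_of_vanish:
  assumes D: "bounded_linear D" and v: "vanish (Suc (Suc 0)) p (\<lambda>x. F x - F p - D (x - p))"
  shows "(F has_derivative D) (at p)"
  unfolding has_derivative_at_alt
proof (intro conjI allI impI D)
  fix e :: real assume e: "e > 0"
  obtain C r where C: "C > 0" "r > 0"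
    "\<And>x. norm (x - p) < r \<Longrightarrow> norm (F x - F p - D (x - p)) \<le> C * norm (x - p) ^ Suc (Suc 0)"
    using v by (rule vanish_ball) blast
  show "\<exists>d>0. \<forall>y. norm (y - p) < d \<longrightarrow> norm (F y - F p - D (y - p)) \<le> e * norm (y - p)"
  proof (intro exI[of _ "min r (e / C)"] conjI allI impI)
    fix y assume y: "norm (y - p) < min r (e / C)"
    then have "norm (F y - F p - D (y - p)) \<le> (C * norm (y - p)) * norm (y - p)"
      using C(3)[of y] by (simp add: mult.assoc)
    also have "\<dots> \<le> e * norm (y - p)"
      using y C by (intro mult_right_mono) (auto simp: field_simps)
    finally show "norm (F y - F p - D (y - p)) \<le> e * norm (y - p)" .
  qed (use C e in auto)
qed

definition jac :: "(complex ^ 'n::finite \<Rightarrow> complex ^ 'n) \<Rightarrow> complex ^ 'n \<Rightarrow> complex ^ 'n ^ 'n" where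
  "jac F z = (\<chi> i k. partial_deriv F i k z)"

lemma jacobian_det_jac: "jacobian_det F z = det (jac F z)"
  by (simp add: jacobian_det_def jac_def)

lemma partial_deriv_taylor_term:
  assumes "entire (\<lambda>z. G z $ i)"
  shows "partial_deriv G i k z = taylor_term (\<lambda>z. G z $ i) z 1 (axis k 1)"
proof -
  \<comment> \<open>Coordinate k is set to 0, so that replacing it by w is the point with parameter
    w on an axis-parallel line.\<close>
  define z' where "z' = z - (z $ k) *s axis k 1"
  have e: "(\<chi> l. if l = k then w else z $ l) = z' + w *s axis k 1" for w
    by (auto simp: z'_def vec_eq_iff axis_def)
  have "((\<lambda>w. G (z' + w *s axis k 1) $ i) has_field_derivative taylor_term (\<lambda>z. G z $ i) (z' + (z $ k) *s axis k 1) 1 (axis k 1)) (at (z $ k))"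
    by (rule entire_line_derivative[OF assms])
  then show ?thesis unfolding partial_deriv_def e by (simp add: DERIV_imp_deriv z'_def)
qed

lemma holomorphic_map_imp_entire:
  fixes F :: "complex ^ 'n::finite \<Rightarrow> complex ^ 'n"
  assumes "holomorphic_map F" shows "entire (\<lambda>z. F z $ i)"
  unfolding entire_def
proof (intro conjI allI)
  have "isCont F z" for z
    using assms has_derivative_continuous unfolding holomorphic_map_def by blast
  then have "continuous_on UNIV F" by (simp add: continuous_on_eq_continuous_at)
  then show "continuous_on UNIV (\<lambda>z. F z $ i)" by (intro continuous_intros)
  fix z v
  show "(\<lambda>\<zeta>. F (z + \<zeta> *s v) $ i) holomorphic_on UNIV"
    unfolding holomorphic_on_open[OF open_UNIV]
  proof
    fix c :: complex
    obtain A where A: "(F has_derivative (\<lambda>v. A *v v)) (at (z + c *s v))"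
      using assms unfolding holomorphic_map_def by blast
    have "bounded_linear (\<lambda>\<zeta>::complex. \<zeta> *s v)"
    proof (rule bounded_linear_intro[where K = "norm v"])
      show "(r *\<^sub>R x) *s v = r *\<^sub>R (x *s v)" for r x
        by (auto simp: vec_eq_iff)
    qed (auto simp: algebra_simps)
    then have "((\<lambda>\<zeta>. \<zeta> *s v) has_derivative (\<lambda>\<zeta>. \<zeta> *s v)) (at c)" by (rule bounded_linear_imp_has_derivative)
    then have "((\<lambda>\<zeta>. z + \<zeta> *s v) has_derivative (\<lambda>\<zeta>. \<zeta> *s v)) (at c)"
      by (auto intro!: derivative_eq_intros)
    then have "((\<lambda>\<zeta>. F (z + \<zeta> *s v)) has_derivative (\<lambda>\<zeta>. A *v (\<zeta> *s v))) (at c)"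
      by (rule has_derivative_compose[where g = F]) (rule A)
    then have "((\<lambda>\<zeta>. F (z + \<zeta> *s v) $ i) has_derivative (\<lambda>\<zeta>. (A *v (\<zeta> *s v)) $ i)) (at c)"
      by (rule bounded_linear.has_derivative[OF bounded_linear_vec_nth])
    moreover have "(\<lambda>\<zeta>. (A *v (\<zeta> *s v)) $ i) = (*) ((A *v v) $ i)"
      by (auto simp: fun_eq_iff
          matrix_vector_mult_def sum_distrib_left mult_ac)
    ultimately show "\<exists>f'. ((\<lambda>\<zeta>. F (z + \<zeta> *s v) $ i) has_field_derivative f') (at c)"
      unfolding has_field_derivative_def by auto
  qed
qed

lemma jac_vanish:
  assumes "\<And>i. entire (\<lambda>z. F z $ i)"
  shows "vanish (Suc (Suc 0)) z (\<lambda>x. F x - F z - jac F z *v (x - z))"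
proof -
  have comp: "(jac F z *v v) $ i = taylor_term (\<lambda>z. F z $ i) z 1 v" for i v
    using taylor_term_1_sum[OF assms, of i z v]
    by (simp add: jac_def matrix_vector_mult_def partial_deriv_taylor_term[OF assms] mult.commute)
  show ?thesis
    unfolding vanish_vec_iff
  proof
    fix i
    show "vanish (Suc (Suc 0)) z (\<lambda>x. (F x - F z - jac F z *v (x - z)) $ i)"
      using taylor_term_vanish[OF assms[of i], of "Suc 0" z] by (simp add: comp diff_diff_eq)
  qed
qed

lemma entire_imp_has_derivative:
  assumes "\<And>i. entire (\<lambda>z. F z $ i)"
  shows "(F has_derivative (\<lambda>v. jac F z *v v)) (at z)"
  by (rule has_derivative_of_vanish[OF _ jac_vanish[OF assms]]) simp

text \<open>In one direction the complex linear derivative is restricted to lines; in the other the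
  quadratic Taylor remainder exhibits \<open>jac\<close> as the derivative.\<close>

lemma holomorphic_map_iff: "holomorphic_map F \<longleftrightarrow> (\<forall>i. entire (\<lambda>z. F z $ i))"
  using holomorphic_map_imp_entire entire_imp_has_derivative unfolding holomorphic_map_def by blast

lemma holomorphic_map_entire: "holomorphic_map F \<Longrightarrow> entire (\<lambda>z. F z $ i)"
  by (simp add: holomorphic_map_iff)

lemma holomorphic_map_jac: "holomorphic_map F \<Longrightarrow> (F has_derivative (\<lambda>v. jac F z *v v)) (at z)"
  by (rule entire_imp_has_derivative) (simp add: holomorphic_map_iff)

lemma holomorphic_map_isCont: "holomorphic_map F \<Longrightarrow> isCont F z"
  using holomorphic_map_jac has_derivative_continuous by blast

lemma holomorphic_map_continuous: "holomorphic_map F \<Longrightarrow> continuous_on S F"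
  by (simp add: continuous_at_imp_continuous_on holomorphic_map_isCont)

lemma jac_unique:
  assumes "holomorphic_map F" "(F has_derivative (\<lambda>v. A *v v)) (at z)"
  shows "jac F z = A"
  using has_derivative_unique[OF holomorphic_map_jac[OF assms(1)] assms(2)]
  by (metis matrix_eq)

lemma jac_has_derivative_compose:
  assumes "holomorphic_map F" "holomorphic_map G"
  shows "((\<lambda>z. F (G z)) has_derivative (\<lambda>v. (jac F (G z) ** jac G z) *v v)) (at z)"
  using has_derivative_compose[OF holomorphic_map_jac[OF assms(2)] holomorphic_map_jac[OF assms(1)]]
  by (simp add: matrix_vector_mul_assoc)

lemma holomorphic_map_compose:
  "holomorphic_map F \<Longrightarrow> holomorphic_map G \<Longrightarrow> holomorphic_map (\<lambda>z. F (G z))"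
  using jac_has_derivative_compose unfolding holomorphic_map_def by blast

lemma jac_compose:
  assumes "holomorphic_map F" "holomorphic_map G"
  shows "jac (\<lambda>z. F (G z)) z = jac F (G z) ** jac G z"
  by (rule jac_unique[OF holomorphic_map_compose[OF assms] jac_has_derivative_compose[OF assms]])

lemma jacobian_det_compose:
  assumes "holomorphic_map F" "holomorphic_map G"
  shows "jacobian_det (\<lambda>z. F (G z)) z = jacobian_det F (G z) * jacobian_det G z"
  by (simp add: jacobian_det_jac jac_compose[OF assms] det_mul)

lemma holomorphic_map_const [simp]: "holomorphic_map (\<lambda>z. c)"
  by (simp add: holomorphic_map_iff)

lemma holomorphic_map_id [simp]: "holomorphic_map (\<lambda>z. z)"
  by (simp add: holomorphic_map_iff)

lemma holomorphic_map_add: "holomorphic_map F \<Longrightarrow> holomorphic_map G \<Longrightarrow> holomorphic_map (\<lambda>z. F z + G z)"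
  by (simp add: holomorphic_map_iff entire_add)

lemma holomorphic_map_diff: "holomorphic_map F \<Longrightarrow> holomorphic_map G \<Longrightarrow> holomorphic_map (\<lambda>z. F z - G z)"
  by (simp add: holomorphic_map_iff entire_diff)

lemma holomorphic_map_smult: "entire f \<Longrightarrow> holomorphic_map G \<Longrightarrow> holomorphic_map (\<lambda>z. f z *s G z)"
  by (simp add: holomorphic_map_iff entire_mult)

lemma holomorphic_map_linear [simp]: "holomorphic_map (\<lambda>z. A *v z)"
  by (auto simp: holomorphic_map_iff matrix_vector_mult_def intro!: entire_sum entire_mult)

lemma jac_affine:
  "jac (\<lambda>z. c + A *v (z - p)) z = A"
proof (rule jac_unique)
  show "holomorphic_map (\<lambda>z. c + A *v (z - p))"
    by (intro holomorphic_map_add holomorphic_map_const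
        holomorphic_map_compose[OF holomorphic_map_linear holomorphic_map_diff]) simp_all
  have l: "((*v) A has_derivative (*v) A) (at (z - p))"
    by (rule bounded_linear_imp_has_derivative) simp
  have "((\<lambda>z. z - p) has_derivative (\<lambda>v. v)) (at z)" by (auto intro!: derivative_eq_intros)
  from has_derivative_compose[OF this l]
  show "((\<lambda>z. c + A *v (z - p)) has_derivative (*v) A) (at z)"
    by (auto intro!: derivative_eq_intros)
qed

lemma jac_id [simp]: "jac (\<lambda>z. z) z = mat 1"
  using jac_affine[of 0 "mat 1" 0 z] by simp

lemma jac_shift [simp]: "jac (\<lambda>z. z - p) z = mat 1"
  using jac_affine[of 0 "mat 1" p z] by simp

lemma jac_shift' [simp]: "jac (\<lambda>z. c + z) z = mat 1"
  using jac_affine[of c "mat 1" 0 z] by simp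

lemma holomorphic_map_lipschitz:
  assumes "holomorphic_map F"
  obtains L where "L > 0" "\<And>x y. norm (x - p) \<le> R \<Longrightarrow> norm (y - p) \<le> R \<Longrightarrow> norm (F x - F y) \<le> L * norm (x - y)"
proof -
  define r where "r = max R 1"
  have "\<exists>M>0. \<forall>w. norm w \<le> 2 * r \<longrightarrow> cmod (F (p + w) $ i) \<le> M" for i
    using entire_bounded[OF holomorphic_map_entire[OF assms, of i], of "2 * r" p] by metis
  then obtain M where M: "\<And>i. M i > 0" "\<And>i w. norm w \<le> 2 * r \<Longrightarrow> cmod (F (p + w) $ i) \<le> M i"
    by metis
  have r: "r > 0" "R \<le> r" by (auto simp: r_def)
  show ?thesis
  proof (rule that[of "(\<Sum>i\<in>UNIV. M i / r)"])
    show "(\<Sum>i\<in>UNIV. M i / r) > 0" using M r by (intro sum_pos) auto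
    fix x y assume xy: "norm (x - p) \<le> R" "norm (y - p) \<le> R"
    have "cmod (F x $ i - F y $ i) \<le> M i / r * norm (x - y)" for i
    proof (rule entire_lipschitz[OF holomorphic_map_entire[OF assms] r(1)])
      fix w assume "norm (w - p) \<le> 2 * r"
      then show "cmod (F w $ i) \<le> M i" using M(2)[of "w - p" i] by simp
    qed (use xy r in auto)
    then have "(\<Sum>i\<in>UNIV. norm ((F x - F y) $ i)) \<le> (\<Sum>i\<in>UNIV. M i / r * norm (x - y))"
      by (intro sum_mono) simp
    moreover have "norm (F x - F y) \<le> (\<Sum>i\<in>UNIV. norm ((F x - F y) $ i))"
      unfolding norm_vec_def by (rule L2_set_le_sum) auto
    ultimately show "norm (F x - F y) \<le> (\<Sum>i\<in>UNIV. M i / r) * norm (x - y)"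
      by (simp add: sum_distrib_right)
  qed
qed

lemma holomorphic_map_locally_lipschitz: 
  assumes "holomorphic_map F" shows "locally_lipschitz p F"
proof -
  obtain L where "\<And>x y. norm (x - p) \<le> 1 \<Longrightarrow> norm (y - p) \<le> 1 \<Longrightarrow> norm (F x - F y) \<le> L * norm (x - y)"
    using holomorphic_map_lipschitz[OF assms, of p 1] by metis
  then show ?thesis unfolding locally_lipschitz_def
    by (intro exI[of _ L] exI[of _ 1]) (auto simp: dist_norm norm_minus_commute)
qed

lemma holomorphic_map_lipschitz_at: "holomorphic_map F \<Longrightarrow> lipschitz_at p F"
  by (rule locally_lipschitz_imp_lipschitz_at[OF holomorphic_map_locally_lipschitz])

lemma entire_partial: "holomorphic_map F \<Longrightarrow> entire (\<lambda>z. jac F z $ i $ k)"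
  using entire_derivative[OF holomorphic_map_entire] by (simp add: jac_def partial_deriv_taylor_term[OF holomorphic_map_entire])

lemma entire_det: "(\<And>i k. entire (\<lambda>z. M z $ i $ k)) \<Longrightarrow> entire (\<lambda>z. det (M z))"
  unfolding det_def by (intro entire_sum entire_mult entire_prod) auto

lemma entire_jacobian_det: "holomorphic_map F \<Longrightarrow> entire (jacobian_det F)"
  unfolding jacobian_det_jac[abs_def] by (intro entire_det entire_partial)

subsection \<open>Automorphism groups\<close>

text \<open>The flag lets one argument prove both halves of the theorem.\<close>

definition Gr :: "bool \<Rightarrow> (complex ^ 'n::finite \<Rightarrow> complex ^ 'n) set" where
  "Gr vol = (if vol then Aut1 else Aut)"

lemma GrI:
  assumes "holomorphic_map F" "holomorphic_map G" "\<And>z. F (G z) = z" "\<And>z. G (F z) = z"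
    "vol \<Longrightarrow> (\<And>z. jacobian_det F z = 1)"
  shows "F \<in> Gr vol" "inv F = G"
proof -
  have "bij F" by (rule bij_betw_byWitness[where f' = G]) (use assms in auto)
  moreover show "inv F = G" by (rule inv_equality) (use assms in auto)
  ultimately show "F \<in> Gr vol" using assms by (auto simp: Gr_def Aut_def Aut1_def)
qed

lemma Gr_Aut: "F \<in> Gr vol \<Longrightarrow> F \<in> Aut"
  by (auto simp: Gr_def Aut1_def split: if_splits)

lemma Gr_holo: "F \<in> Gr vol \<Longrightarrow> holomorphic_map F"
  using Gr_Aut by (auto simp: Aut_def)

lemma Gr_inv_holo: "F \<in> Gr vol \<Longrightarrow> holomorphic_map (inv F)"
  using Gr_Aut by (auto simp: Aut_def)

lemma Gr_inv_f [simp]: "F \<in> Gr vol \<Longrightarrow> inv F (F z) = z"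
  using Gr_Aut[of F vol] by (auto simp: Aut_def bij_is_inj inv_f_f)

lemma Gr_f_inv [simp]: "F \<in> Gr vol \<Longrightarrow> F (inv F z) = z"
  using Gr_Aut[of F vol] by (auto simp: Aut_def bij_is_surj surj_f_inv_f)

lemma Gr_jac: "F \<in> Gr True \<Longrightarrow> jacobian_det F z = 1"
  by (auto simp: Gr_def Aut1_def)

lemma Gr_id [simp]: "(\<lambda>z. z) \<in> Gr vol"
  by (rule GrI(1)[where G = "\<lambda>z. z"]) (simp_all add: jacobian_det_jac)

lemma Gr_comp:
  assumes "F \<in> Gr vol" "G \<in> Gr vol"
  shows "(\<lambda>z. F (G z)) \<in> Gr vol" "inv (\<lambda>z. F (G z)) = (\<lambda>z. inv G (inv F z))"
proof -
  have *: "holomorphic_map (\<lambda>z. F (G z))" "holomorphic_map (\<lambda>z. inv G (inv F z))"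
    using assms by (auto intro: holomorphic_map_compose Gr_holo Gr_inv_holo)
  have j: "jacobian_det (\<lambda>z. F (G z)) z = 1" if vol for z
    using assms that by (simp add: jacobian_det_compose Gr_holo Gr_jac)
  show "(\<lambda>z. F (G z)) \<in> Gr vol" by (rule GrI(1)[OF *]) (use assms j in auto)
  show "inv (\<lambda>z. F (G z)) = (\<lambda>z. inv G (inv F z))"
    by (rule GrI(2)[OF *, of vol]) (use assms j in auto)
qed

lemma Gr_inv:
  assumes "F \<in> Gr vol" shows "inv F \<in> Gr vol" "inv (inv F) = F"
proof -
  have j: "jacobian_det (inv F) z = 1" if vol for z
  proof -
    have "jacobian_det (\<lambda>z. F (inv F z)) z = jacobian_det F (inv F z) * jacobian_det (inv F) z"
      using assms by (intro jacobian_det_compose Gr_holo Gr_inv_holo)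
    then show ?thesis using assms that by (auto simp: Gr_jac jacobian_det_jac Gr_jac[unfolded jacobian_det_jac])
  qed
  show "inv F \<in> Gr vol"
    by (rule GrI(1)[where G = F]) (use assms j in \<open>auto intro: Gr_holo Gr_inv_holo\<close>)
  show "inv (inv F) = F"
    by (rule GrI(2)[where G = F and vol = vol]) (use assms j in \<open>auto intro: Gr_holo Gr_inv_holo\<close>)
qed

subsection \<open>Homogeneous polynomials\<close>

text \<open>Given inductively, so that statements linear in the polynomial have to be checked on
  monomials only.\<close>

inductive hpoly :: "nat \<Rightarrow> (complex ^ 'n::finite \<Rightarrow> complex) \<Rightarrow> bool" where
  zero: "hpoly s (\<lambda>x. 0)"
| mono: "(\<Sum>i\<in>UNIV. \<alpha> i) = s \<Longrightarrow> hpoly s (\<lambda>x. c * (\<Prod>i\<in>UNIV. x $ i ^ \<alpha> i))"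
| add: "hpoly s f \<Longrightarrow> hpoly s g \<Longrightarrow> hpoly s (\<lambda>x. f x + g x)"

lemma hpoly_coord:
  fixes f :: "complex ^ 'n::finite \<Rightarrow> complex"
  assumes "hpoly s f" shows "hpoly (Suc s) (\<lambda>x. x $ i * f x)"
  using assms
proof induction
  case (zero s)
  then show ?case using hpoly.zero by simp
next
  case (mono \<alpha> s c)
  define \<beta> where "\<beta> = \<alpha>(i := Suc (\<alpha> i))"
  have s: "(\<Sum>j\<in>UNIV. \<beta> j) = Suc s"
    using mono by (simp add: \<beta>_def sum.remove[of UNIV i] )
  have "(\<Prod>j\<in>UNIV. x $ j ^ \<beta> j) = x $ i * (\<Prod>j\<in>UNIV. x $ j ^ \<alpha> j)" for x :: "complex ^ 'n"
    by (simp add: \<beta>_def prod.remove[of UNIV i])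
  then have "(\<lambda>x. x $ i * (c * (\<Prod>j\<in>UNIV. x $ j ^ \<alpha> j))) = (\<lambda>x. c * (\<Prod>j\<in>UNIV. x $ j ^ \<beta> j))"
    by (auto simp: fun_eq_iff)
  then show ?case using hpoly.mono[OF s, of c] by simp
next
  case (add s f g)
  show ?case using hpoly.add[OF add.IH] by (simp add: distrib_left)
qed

lemma hpoly_cmul:
  assumes "hpoly s f" shows "hpoly s (\<lambda>x. c * f x)"
  using assms
proof induction
  case (zero s)
  then show ?case using hpoly.zero by simp
next
  case (mono \<alpha> s d)
  show ?case using hpoly.mono[OF mono, of "c * d"] by (simp add: mult.assoc)
next
  case (add s f g)
  show ?case using hpoly.add[OF add.IH] by (simp add: distrib_left)
qed

lemma hpoly_sum: "(\<And>i. i \<in> I \<Longrightarrow> hpoly s (f i)) \<Longrightarrow> hpoly s (\<lambda>x. \<Sum>i\<in>I. f i x)"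
  by (induction I rule: infinite_finite_induct) (auto intro: hpoly.intros)

text \<open>Differentiate f (c v + \<zeta> c w) = c^(s+1) f (v + \<zeta> w) at \<zeta> = 0; the left
  side contributes one factor c, which cancels.\<close>

lemma homogeneous_derivative:
  assumes f: "entire f" and h: "homogeneous (Suc s) f"
  shows "homogeneous s (\<lambda>x. taylor_term f x 1 w)"
proof (rule homogeneousI[OF entire_derivative[OF f]])
  fix c :: complex and v assume c: "c \<noteq> 0"
  have "((\<lambda>\<zeta>. f (c *s v + \<zeta> *s (c *s w))) has_field_derivative taylor_term f (c *s v + 0 *s (c *s w)) 1 (c *s w)) (at 0)"
    by (rule entire_line_derivative[OF f])
  moreover have "(\<lambda>\<zeta>. f (c *s v + \<zeta> *s (c *s w))) = (\<lambda>\<zeta>. c ^ Suc s * f (v + \<zeta> *s w))"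
  proof
    fix \<zeta>
    have "c *s v + \<zeta> *s (c *s w) = c *s (v + \<zeta> *s w)"
      by (simp add: vector_add_ldistrib vector_smult_assoc mult.commute)
    then show "f (c *s v + \<zeta> *s (c *s w)) = c ^ Suc s * f (v + \<zeta> *s w)"
      using h unfolding homogeneous_def by metis
  qed
  ultimately have "((\<lambda>\<zeta>. c ^ Suc s * f (v + \<zeta> *s w)) has_field_derivative taylor_term f (c *s v) 1 (c *s w)) (at 0)"
    by simp
  moreover have "((\<lambda>\<zeta>. c ^ Suc s * f (v + \<zeta> *s w)) has_field_derivative c ^ Suc s * taylor_term f (v + 0 *s w) 1 w) (at 0)"
    by (intro DERIV_cmult entire_line_derivative[OF f])
  ultimately have "taylor_term f (c *s v) 1 (c *s w) = c ^ Suc s * taylor_term f v 1 w"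
    using DERIV_unique by fastforce
  moreover have "taylor_term f (c *s v) 1 (c *s w) = c * taylor_term f (c *s v) 1 w"
    using taylor_term_homogeneous[OF f, of 1 "c *s v"] by (simp add: homogeneous_def)
  ultimately show "taylor_term f (c *s v) 1 w = c ^ s * taylor_term f v 1 w" using c by simp
qed

lemma homogeneous_Euler:
  assumes f: "entire f" and h: "homogeneous (Suc s) f"
  shows "of_nat (Suc s) * f p = (\<Sum>i\<in>UNIV. p $ i * taylor_term f p 1 (axis i 1))"
proof -
  have "((\<lambda>\<zeta>. f (p + \<zeta> *s p)) has_field_derivative taylor_term f (p + 0 *s p) 1 p) (at 0)"
    by (rule entire_line_derivative[OF f])
  moreover have "(\<lambda>\<zeta>. f (p + \<zeta> *s p)) = (\<lambda>\<zeta>. (1 + \<zeta>) ^ Suc s * f p)"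
  proof
    fix \<zeta>
    have "p + \<zeta> *s p = (1 + \<zeta>) *s p" by (simp add: vector_sadd_rdistrib)
    then show "f (p + \<zeta> *s p) = (1 + \<zeta>) ^ Suc s * f p"
      using h unfolding homogeneous_def by metis
  qed
  ultimately have "((\<lambda>\<zeta>. (1 + \<zeta>) ^ Suc s * f p) has_field_derivative taylor_term f p 1 p) (at 0)"
    by simp
  moreover have "((\<lambda>\<zeta>. (1 + \<zeta>) ^ Suc s * f p) has_field_derivative of_nat (Suc s) * f p) (at 0)"
    by (auto intro!: derivative_eq_intros)
  ultimately have "of_nat (Suc s) * f p = taylor_term f p 1 p" by (rule DERIV_unique[symmetric])
  also have "\<dots> = (\<Sum>i\<in>UNIV. p $ i * taylor_term f p 1 (axis i 1))" by (rule taylor_term_1_sum[OF f])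
  finally show ?thesis .
qed

text \<open>Euler's identity writes f through products of a coordinate with a first derivative, and
  the latter is homogeneous of one degree less.\<close>

lemma homogeneous_hpoly:
  assumes "entire f" "homogeneous s f" shows "hpoly s f"
  using assms
proof (induction s arbitrary: f)
  case 0
  have "f v = f 0" for v
  proof -
    have "f (0 *s v) = 0 ^ 0 * f v" using 0(2) unfolding homogeneous_def by blast
    then show ?thesis by simp
  qed
  then obtain c where "f = (\<lambda>x. c)" by blast
  then show ?case using hpoly.mono[of "\<lambda>_. 0" 0 c] by simp
next
  case (Suc s)
  have "hpoly (Suc s) (\<lambda>x. inverse (of_nat (Suc s)) * (\<Sum>i\<in>UNIV. x $ i * taylor_term f x 1 (axis i 1)))"
    by (intro hpoly_cmul hpoly_sum hpoly_coord Suc.IH entire_derivative homogeneous_derivative Suc.prems)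
  moreover have "inverse (of_nat (Suc s)) * (\<Sum>i\<in>UNIV. x $ i * taylor_term f x 1 (axis i 1)) = f x" for x
    unfolding homogeneous_Euler[OF Suc.prems, symmetric] by (simp add: field_simps del: of_nat_Suc)
  ultimately show ?case by simp
qed

lemma entire_independent:
  assumes f: "entire f" and z: "\<And>x. taylor_term f x 1 v = 0"
  shows "f (x + c *s v) = f x"
proof -
  have "\<exists>k. \<forall>\<zeta>\<in>UNIV. f (x + \<zeta> *s v) = k"
    using entire_line_derivative[OF f, of x v] z by (intro has_field_derivative_zero_constant) auto
  then show ?thesis by (metis UNIV_I add.right_neutral vector_smult_lzero)
qed

subsection \<open>The divergence of the leading term of a volume preserving jet\<close>

text \<open>Each term of the expanded product beyond the linear ones contains at least two of the
  \<open>a i\<close>.\<close>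

lemma prod_vanish:
  fixes a :: "'i \<Rightarrow> 'a::real_normed_vector \<Rightarrow> 'b::real_normed_field"
  assumes "finite I" "\<And>i. i \<in> I \<Longrightarrow> vanish k p (a i)"
  shows "vanish (k + k) p (\<lambda>x. (\<Prod>i\<in>I. 1 + a i x) - 1 - (\<Sum>i\<in>I. a i x))"
  using assms
proof (induction I rule: finite_induct)
  case (insert i I)
  define S where "S x = (\<Sum>i\<in>I. a i x)" for x
  define R where "R x = (\<Prod>i\<in>I. 1 + a i x) - 1 - S x" for x
  have R: "vanish (k + k) p R" unfolding R_def S_def by (rule insert.IH) (use insert in auto)
  have S: "vanish k p S" unfolding S_def by (rule vanish_sum) (use insert in auto)
  have "vanish (k + k) p (\<lambda>x. a i x * (S x + R x))"
    using insert by (intro vanish_mult vanish_add S vanish_mono[OF R]) auto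
  from vanish_add[OF R this]
  have v: "vanish (k + k) p (\<lambda>x. R x + a i x * (S x + R x))" .
  have "(\<lambda>x. (\<Prod>i\<in>insert i I. 1 + a i x) - 1 - (\<Sum>i\<in>insert i I. a i x)) = (\<lambda>x. R x + a i x * (S x + R x))"
    using insert by (auto simp: R_def S_def fun_eq_iff algebra_simps)
  with v show ?case by simp
qed simp

text \<open>A permutation other than the identity moves at least two indices, so its term has two
  off-diagonal factors of order k. What is left is the diagonal product, whose linear part is the
  trace.\<close>

lemma det_vanish:
  fixes B :: "'a::real_normed_vector \<Rightarrow> 'b::real_normed_field ^ 'n::finite ^ 'n"
  assumes B: "\<And>i j. vanish k p (\<lambda>x. B x $ i $ j - (if i = j then 1 else 0))"
  shows "vanish (k + k) p (\<lambda>x. det (B x) - 1 - (\<Sum>i\<in>UNIV. B x $ i $ i - 1))"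
proof -
  let ?P = "{\<pi>. \<pi> permutes (UNIV :: 'n set)}"
  define T where "T \<pi> x = of_int (sign \<pi>) * (\<Prod>i\<in>UNIV. B x $ i $ \<pi> i)" for \<pi> and x
  have v0: "vanish 0 p (\<lambda>x. B x $ i $ j)" for i j
  proof -
    have "vanish 0 p (\<lambda>x. (B x $ i $ j - (if i = j then 1 else 0)) + (if i = j then 1 else 0))"
      by (rule vanish_add[OF vanish_mono[OF B] vanish_const]) simp
    then show ?thesis by simp
  qed
  have vprod: "vanish 0 p (\<lambda>x. \<Prod>i\<in>I. B x $ i $ \<pi> i)" for I and \<pi> :: "'n \<Rightarrow> 'n"
    by (induction I rule: infinite_finite_induct) (use v0 vanish_mult[of 0 p _ 0] in auto)
  have "vanish (k + k) p (T \<pi>)" if "\<pi> \<in> ?P - {id}" for \<pi>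
  proof -
    have perm: "\<pi> permutes UNIV" using that by simp
    have "\<pi> \<noteq> id" using that by simp
    then obtain i where i: "\<pi> i \<noteq> i" by (metis ext id_apply)
    \<comment> \<open>By injectivity of the permutation, the image of a moved index is a second
      moved index.\<close>
    define j where "j = \<pi> i"
    have j: "j \<noteq> i" "\<pi> j \<noteq> j" using i permutes_inj[OF perm] by (auto simp: j_def inj_eq)
    have "T \<pi> = (\<lambda>x. (B x $ i $ \<pi> i * B x $ j $ \<pi> j) * (of_int (sign \<pi>) * (\<Prod>i\<in>UNIV - {i} - {j}. B x $ i $ \<pi> i)))"
      using j by (auto simp: T_def fun_eq_iff prod.remove[of UNIV i] prod.remove[of "UNIV - {i}" j] mult_ac)
    moreover have "vanish ((k + k) + 0) p (\<lambda>x. (B x $ i $ \<pi> i * B x $ j $ \<pi> j) * (of_int (sign \<pi>) * (\<Prod>i\<in>UNIV - {i} - {j}. B x $ i $ \<pi> i)))"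
    proof (intro vanish_mult[of "k + k"] vanish_mult[of k _ _ k] vanish_cmul vprod)
      show "vanish k p (\<lambda>x. B x $ i $ \<pi> i)" using B[of i "\<pi> i"] i by auto
      show "vanish k p (\<lambda>x. B x $ j $ \<pi> j)" using B[of j "\<pi> j"] j by auto
    qed
    ultimately show ?thesis by simp
  qed
  then have 1: "vanish (k + k) p (\<lambda>x. \<Sum>\<pi>\<in>?P - {id}. T \<pi> x)" by (rule vanish_sum)
  have 2: "vanish (k + k) p (\<lambda>x. (\<Prod>i\<in>UNIV. 1 + (B x $ i $ i - 1)) - 1 - (\<Sum>i\<in>UNIV. B x $ i $ i - 1))"
  proof (rule prod_vanish)
    fix i show "vanish k p (\<lambda>x. B x $ i $ i - 1)" using B[of i i] by simp
  qed simp
  have d: "det (B x) = (\<Prod>i\<in>UNIV. B x $ i $ i) + (\<Sum>\<pi>\<in>?P - {id}. T \<pi> x)" for x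
    unfolding det_def T_def
    by (subst sum.remove[of _ id]) (auto simp: permutes_id finite_permutations sign_id)
  show ?thesis using vanish_add[OF 2 1] by (simp add: d algebra_simps)
qed

lemma jac_add:
  assumes "holomorphic_map F" "holomorphic_map G"
  shows "jac (\<lambda>z. F z + G z) z = jac F z + jac G z"
proof (rule jac_unique[OF holomorphic_map_add[OF assms]])
  show "((\<lambda>z. F z + G z) has_derivative (*v) (jac F z + jac G z)) (at z)"
  proof -
    have e: "(*v) (jac F z + jac G z) = (\<lambda>v. jac F z *v v + jac G z *v v)"
      by (auto simp: fun_eq_iff matrix_vector_mult_add_rdistrib)
    show ?thesis unfolding e
      by (rule has_derivative_add[OF holomorphic_map_jac[OF assms(1)] holomorphic_map_jac[OF assms(2)]])
  qed
qed

text \<open>Up to order q + 1 the Jacobian determinant of R is 1 plus the divergence of X at x - p.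
  Thus the divergence, homogeneous of degree q, vanishes to order q + 1.\<close>

lemma divergence_zero:
  assumes R: "holomorphic_map R" and X: "holomorphic_map X"
    and h: "\<And>i. homogeneous (Suc q) (\<lambda>x. X x $ i)" and q: "q \<ge> 1"
    and jet: "jet_eq (Suc q) p R (\<lambda>x. x + X (x - p))"
    and det: "vanish (Suc q) p (\<lambda>x. jacobian_det R x - 1)"
  shows "(\<Sum>i\<in>UNIV. jac X y $ i $ i) = 0"
proof -
  define G where "G x = x + X (x - p)" for x
  define E where "E x = R x - G x" for x
  have sh: "holomorphic_map (\<lambda>x. x - p)" by (intro holomorphic_map_diff) auto
  have XS: "holomorphic_map (\<lambda>x. X (x - p))" by (rule holomorphic_map_compose[OF X sh])
  have G: "holomorphic_map G" unfolding G_def by (intro holomorphic_map_add XS) auto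
  have E: "holomorphic_map E" unfolding E_def by (intro holomorphic_map_diff R G)
  have "R = (\<lambda>x. G x + E x)" by (simp add: E_def)
  then have jR: "jac R x = jac G x + jac E x" for x using jac_add[OF G E] by simp
  have jG: "jac G x = mat 1 + jac X (x - p)" for x
    unfolding G_def using jac_add[OF holomorphic_map_id XS] jac_compose[OF X sh] by simp
  have vE: "vanish (Suc q) p (\<lambda>x. jac E x $ i $ k)" for i k
  proof -
    have "vanish (Suc (Suc q)) p (\<lambda>x. E x $ i)"
      using jet unfolding jet_eq_def E_def G_def vanish_vec_iff by blast
    from vanish_derivative[OF holomorphic_map_entire[OF E] this]
    show ?thesis by (simp add: jac_def partial_deriv_taylor_term[OF holomorphic_map_entire[OF E]])
  qed
  have jX: "jac X y $ i $ k = taylor_term (\<lambda>x. X x $ i) y 1 (axis k 1)" for y i k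
    by (simp add: jac_def partial_deriv_taylor_term[OF holomorphic_map_entire[OF X]])
  have hX: "homogeneous q (\<lambda>y. jac X y $ i $ k)" for i k
    unfolding jX by (rule homogeneous_derivative[OF holomorphic_map_entire[OF X] h])
  have vX: "vanish q p (\<lambda>x. jac X (x - p) $ i $ k)" for i k
    by (rule homogeneous_vanish[OF entire_partial[OF X] hX])
  have "vanish (q + q) p (\<lambda>x. det (jac R x) - 1 - (\<Sum>i\<in>UNIV. jac R x $ i $ i - 1))"
  proof (rule det_vanish)
    fix i j
    have "vanish q p (\<lambda>x. jac X (x - p) $ i $ j + jac E x $ i $ j)"
      by (intro vanish_add vX vanish_mono[OF vE]) simp
    then show "vanish q p (\<lambda>x. jac R x $ i $ j - (if i = j then 1 else 0))"
      by (simp add: jR jG mat_def)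
  qed
  \<comment> \<open>The error of the trace approximation has order 2 q, which is at least q + 1 for
    positive q.\<close>
  then have "vanish (Suc q) p (\<lambda>x. det (jac R x) - 1 - (\<Sum>i\<in>UNIV. jac R x $ i $ i - 1))"
    by (rule vanish_mono) (use q in simp)
  from vanish_diff[OF det this]
  have "vanish (Suc q) p (\<lambda>x. (\<Sum>i\<in>UNIV. jac R x $ i $ i - 1))"
    by (simp add: jacobian_det_jac)
  then have t: "vanish (Suc q) p (\<lambda>x. (\<Sum>i\<in>UNIV. jac X (x - p) $ i $ i) + (\<Sum>i\<in>UNIV. jac E x $ i $ i))"
    by (simp add: jR jG mat_def sum.distrib sum_subtractf)
  have "vanish (Suc q) p (\<lambda>x. \<Sum>i\<in>UNIV. jac E x $ i $ i)" by (rule vanish_sum) (rule vE)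
  from vanish_diff[OF t this]
  have "vanish (Suc q) p (\<lambda>x. (\<lambda>y. \<Sum>i\<in>UNIV. jac X y $ i $ i) (x - p))"
    by simp
  moreover have "homogeneous q (\<lambda>y. \<Sum>i\<in>UNIV. jac X y $ i $ i)"
    using hX by (simp add: homogeneous_def sum_distrib_left)
  ultimately show ?thesis by (rule homogeneous_vanish_zero[rotated])
qed

subsection \<open>Cutoff functions\<close>

lemma vanish_of_field_differentiable:
  fixes f :: "'a::real_normed_field \<Rightarrow> 'a"
  assumes "f field_differentiable at p"
  shows "vanish (Suc 0) p (\<lambda>x. f x - f p)"
proof -
  obtain D where "(f has_field_derivative D) (at p)" using assms by (auto simp: field_differentiable_def)
  then have "(f has_derivative (\<lambda>h. D * h)) (at p)" by (simp add: has_field_derivative_def)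
  then obtain d where d: "d > 0" "\<And>y. norm (y - p) < d \<Longrightarrow> norm (f y - f p - D * (y - p)) \<le> 1 * norm (y - p)"
    unfolding has_derivative_at_alt by (metis zero_less_one)
  have "\<forall>\<^sub>F x in nhds p. dist x p < d"
    unfolding eventually_nhds_metric using d by (intro exI[of _ d]) auto
  then have "\<forall>\<^sub>F x in nhds p. norm (f x - f p) \<le> (norm D + 1) * norm (x - p) ^ Suc 0"
  proof eventually_elim
    case (elim x)
    then have "norm (f x - f p - D * (x - p)) \<le> norm (x - p)" using d by (simp add: dist_norm)
    then show ?case
      using norm_triangle_sub[of "f x - f p" "D * (x - p)"] by (simp add: norm_mult distrib_right)
  qed
  then show ?thesis by (rule vanishI)
qed

text \<open>The expression is w times a polynomial in w, so it is as flat as w. Where w equals 1 it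
  differs from 1 only by (1 - w)^n. The cutoff uses both properties.\<close>

lemma vanish_one_minus:
  fixes w :: "'a::real_normed_vector \<Rightarrow> 'b::real_normed_field"
  assumes w: "vanish a p w" shows "vanish a p (\<lambda>x. 1 - (1 - w x) ^ n)"
proof (induction n)
  case (Suc n)
  have "vanish 0 p (\<lambda>x. (1 - w x) ^ n)"
  proof -
    have "vanish 0 p (\<lambda>x. 1 - w x)" by (rule vanish_diff[OF vanish_const vanish_mono[OF w]]) simp
    from vanish_power[OF this, of n] show ?thesis by simp
  qed
  from vanish_mult[OF w this] have "vanish a p (\<lambda>x. w x * (1 - w x) ^ n)" by simp
  from vanish_add[OF Suc this] show ?case by (simp add: algebra_simps)
qed simp

lemma norm_one_minus:
  fixes w :: "'b::real_normed_field"
  assumes w: "norm w \<le> 1" shows "norm (1 - (1 - w) ^ n) \<le> norm w * (real n * 2 ^ n)"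
proof (induction n)
  case (Suc n)
  have "norm (1 - w) \<le> 2" using norm_triangle_ineq4[of 1 w] w by simp
  then have p: "norm ((1 - w) ^ n) \<le> 2 ^ n" unfolding norm_power by (rule power_mono) simp
  have "1 - (1 - w) ^ Suc n = (1 - (1 - w) ^ n) + w * (1 - w) ^ n" by (simp add: algebra_simps)
  then have "norm (1 - (1 - w) ^ Suc n) \<le> norm (1 - (1 - w) ^ n) + norm w * norm ((1 - w) ^ n)"
    by (metis norm_mult norm_triangle_ineq)
  also have "\<dots> \<le> norm w * (real n * 2 ^ n) + norm w * 2 ^ n"
    by (intro add_mono Suc mult_left_mono p) simp
  also have "\<dots> \<le> norm w * (real (Suc n) * 2 ^ Suc n)"
  proof -
    have "real n * 2 ^ n + 2 ^ n \<le> real (Suc n) * 2 ^ Suc n" by (simp add: algebra_simps)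
    then have "norm w * (real n * 2 ^ n + 2 ^ n) \<le> norm w * (real (Suc n) * 2 ^ Suc n)" by (rule mult_left_mono) simp
    then show ?thesis by (simp add: algebra_simps)
  qed
  finally show ?case .
qed simp

text \<open>The function sin (pi z) / (z - k), normalized at k. Its removable singularity is filled
  by the derivative of the sine there, which is pi times a sign.\<close>

lemma interpolating_sinc:
  obtains s :: "complex \<Rightarrow> complex"
  where "s holomorphic_on UNIV" "s (of_nat k) = 1" "\<And>j. j \<noteq> k \<Longrightarrow> s (of_nat j) = 0"
proof -
  define g :: "complex \<Rightarrow> complex" where "g z = sin (of_real pi * z)" for z
  have gz: "g (of_nat j) = 0" for j
  proof -
    have "of_real pi * of_nat j = (of_real (real j * pi) :: complex)" by simp
    then show ?thesis unfolding g_def by (metis of_real_0 sin_npi sin_of_real)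
  qed
  have dg: "(g has_field_derivative of_real pi * cos (of_real pi * z)) (at z)" for z
    unfolding g_def by (auto intro!: derivative_eq_intros)
  define d where "d = deriv g (of_nat k)"
  have "of_real pi * of_nat k = (of_real (real k * pi) :: complex)" by simp
  then have "cos (of_real pi * of_nat k :: complex) = of_real ((-1) ^ k)" by (metis cos_npi cos_of_real)
  then have d: "d \<noteq> 0" using DERIV_imp_deriv[OF dg, of "of_nat k"] by (simp add: d_def)
  define s where "s z = (if z = of_nat k then d else (g z - g (of_nat k)) / (z - of_nat k)) / d" for z
  have "g holomorphic_on UNIV" using dg by (auto simp: holomorphic_on_open)
  then have "(\<lambda>z. if z = of_nat k then d else (g z - g (of_nat k)) / (z - of_nat k)) holomorphic_on UNIV"
    unfolding d_def by (rule pole_lemma) simp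
  then have "s holomorphic_on UNIV" unfolding s_def using d by (intro holomorphic_intros) auto
  moreover have "s (of_nat k) = 1" using d by (simp add: s_def)
  moreover have "s (of_nat j) = 0" if "j \<noteq> k" for j using that by (simp add: s_def gz)
  ultimately show ?thesis using that by blast
qed

text \<open>A product of two factors. With s interpolating, F = (1 - (1 - s)^n)^n equals 1 at k and
  0 at the other integers, both to order n. The factor H = 1 - (1 - (z / k)^M)^n equals 1 at k to
  order n and, for large M, is arbitrarily small on a disc of radius below k.\<close>

lemma cutoff_exists:
  fixes k m :: nat
  assumes k: "k \<ge> 1" and R: "R < real k" and e: "e > 0"
  obtains u :: "complex \<Rightarrow> complex"
  where "u holomorphic_on UNIV" "vanish (Suc m) (of_nat k) (\<lambda>z. u z - 1)"
    "\<And>j. j \<noteq> k \<Longrightarrow> vanish (Suc m) (of_nat j) u" "\<And>z. cmod z \<le> R \<Longrightarrow> cmod (u z) \<le> e"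
proof -
  obtain s :: "complex \<Rightarrow> complex" where s: "s holomorphic_on UNIV" "s (of_nat k) = 1"
    "\<And>j. j \<noteq> k \<Longrightarrow> s (of_nat j) = 0"
    by (rule interpolating_sinc[of k]) blast
  define n where "n = Suc m"
  define F where "F z = (1 - (1 - s z) ^ n) ^ n" for z
  have Fh: "F holomorphic_on UNIV" unfolding F_def by (intro holomorphic_intros s)
  have sd: "vanish (Suc 0) z (\<lambda>x. s x - s z)" for z
    using s(1) by (intro vanish_of_field_differentiable) (auto simp: holomorphic_on_open field_differentiable_def)
  \<comment> \<open>R may be negative, while the ratio q below has to lie in the interval from 0 to
    1.\<close>
  define R' where "R' = max R 0"
  obtain B where B: "B > 0" "\<And>z. cmod z \<le> R' \<Longrightarrow> cmod (F z) \<le> B"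
  proof -
    have "compact (F ` cball 0 R')"
      by (intro compact_continuous_image holomorphic_on_imp_continuous_on holomorphic_on_subset[OF Fh]) auto
    then obtain B where "\<forall>x\<in>F ` cball 0 R'. norm x \<le> B" by (meson bounded_iff compact_imp_bounded)
    then show ?thesis by (intro that[of "max B 1"]) (auto simp: le_max_iff_disj)
  qed
  define q where "q = R' / real k"
  have q: "0 \<le> q" "q < 1" using R k by (auto simp: q_def R'_def)
  have "(\<lambda>M. B * (real n * 2 ^ n) * q ^ M) \<longlonglongrightarrow> B * (real n * 2 ^ n) * 0"
    using q by (intro tendsto_mult tendsto_const LIMSEQ_power_zero) auto
  then have "\<forall>\<^sub>F M in sequentially. B * (real n * 2 ^ n) * q ^ M < e"
    using e by (intro order_tendstoD(2)) auto
  \<comment> \<open>M is chosen after the bound B for F, so that the smallness of H outweighs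
    it.\<close>
  then obtain M where M: "B * (real n * 2 ^ n) * q ^ M < e" using eventually_sequentially by auto
  define H where "H z = 1 - (1 - (z / of_nat k) ^ M) ^ n" for z :: complex
  have Hh: "H holomorphic_on UNIV" unfolding H_def using k by (intro holomorphic_intros) auto
  show ?thesis
  proof (rule that[of "\<lambda>z. F z * H z"])
    show "(\<lambda>z. F z * H z) holomorphic_on UNIV" by (intro holomorphic_intros Fh Hh)
    have "vanish (1 * n) (of_nat k) (\<lambda>z. (1 - s z) ^ n)"
      using vanish_minus[OF sd[of "of_nat k"]] s(2) by (intro vanish_power) simp
    then have "vanish n (of_nat k) (\<lambda>z. 1 - (1 - (1 - s z) ^ n) ^ n)"
      by (intro vanish_one_minus) simp
    then have F1: "vanish n (of_nat k) (\<lambda>z. F z - 1)"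
      unfolding F_def using vanish_minus by fastforce
    have "(\<lambda>z. 1 - (z / of_nat k) ^ M) holomorphic_on (UNIV :: complex set)"
      using k by (intro holomorphic_intros) auto
    then have "vanish (Suc 0) (of_nat k) (\<lambda>z::complex. (1 - (z / of_nat k) ^ M) - (1 - (of_nat k / of_nat k) ^ M))"
      by (intro vanish_of_field_differentiable) (auto simp: holomorphic_on_open field_differentiable_def)
    then have "vanish (1 * n) (of_nat k) (\<lambda>z::complex. (1 - (z / of_nat k) ^ M) ^ n)"
      using k by (intro vanish_power) simp
    then have H1: "vanish n (of_nat k) (\<lambda>z. H z - 1)"
      unfolding H_def using vanish_minus by fastforce
    have H0: "vanish 0 z H" for z
      using holomorphic_on_imp_continuous_on[OF Hh]
      by (intro vanish_0_continuous) (simp add: continuous_on_eq_continuous_at)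
    have "vanish n (of_nat k) (\<lambda>z. (F z - 1) * H z + (H z - 1))"
      using vanish_mult[OF F1 H0] by (intro vanish_add H1) simp
    then show "vanish (Suc m) (of_nat k) (\<lambda>z. F z * H z - 1)" by (simp add: n_def algebra_simps)
    fix j assume j: "j \<noteq> k"
    have "vanish (1 * n) (of_nat j) F" unfolding F_def
      using sd[of "of_nat j"] s(3)[OF j] by (intro vanish_power vanish_one_minus) simp
    from vanish_mult[OF this H0] show "vanish (Suc m) (of_nat j) (\<lambda>z. F z * H z)" by (simp add: n_def)
  next
    fix z :: complex assume z: "cmod z \<le> R"
    have zq: "cmod ((z / of_nat k) ^ M) \<le> q ^ M"
      unfolding norm_power norm_divide norm_of_nat q_def using z by (intro power_mono divide_right_mono) (auto simp: R'_def)
    have "cmod ((z / of_nat k) ^ M) \<le> 1" using zq q by (meson order_trans power_le_one less_imp_le)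
    then have "cmod (H z) \<le> cmod ((z / of_nat k) ^ M) * (real n * 2 ^ n)"
      unfolding H_def by (rule norm_one_minus)
    also have "\<dots> \<le> q ^ M * (real n * 2 ^ n)" by (intro mult_right_mono zq) simp
    finally have "cmod (F z * H z) \<le> B * (q ^ M * (real n * 2 ^ n))"
      unfolding norm_mult using z B by (intro mult_mono) (auto simp: R'_def)
    then show "cmod (F z * H z) \<le> e" using M by (simp add: mult_ac)
  qed
qed

subsection \<open>Shears\<close>

text \<open>What is added to row l is a combination of the other rows of the identity.\<close>

lemma det_add_row:
  fixes x :: "'a::field ^ 'n::finite"
  assumes "x $ l = 0"
  shows "det (mat 1 + (\<chi> i. if i = l then x else 0)) = 1"
proof -
  have rj: "row j (mat 1 :: 'a ^ 'n ^ 'n) = axis j 1" for j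
    by (auto simp: row_def mat_def axis_def vec_eq_iff)
  have "x = (\<Sum>i\<in>UNIV. x $ i *s axis i 1)" by (rule basis_expansion[symmetric])
  also have "\<dots> = (\<Sum>i\<in>UNIV - {l}. x $ i *s axis i 1)"
    by (rule sum.mono_neutral_right) (use assms in auto)
  also have "\<dots> \<in> vec.span {row j (mat 1 :: 'a ^ 'n ^ 'n) |j. j \<noteq> l}"
    unfolding rj by (intro vec.span_sum vec.span_scale vec.span_base) auto
  finally have "det (\<chi> i. if i = l then row l (mat 1 :: 'a ^ 'n ^ 'n) + x else row i (mat 1)) = det (mat 1 :: 'a ^ 'n ^ 'n)"
    by (rule det_row_span)
  moreover have "(\<chi> i. if i = l then row l (mat 1 :: 'a ^ 'n ^ 'n) + x else row i (mat 1)) = mat 1 + (\<chi> i. if i = l then x else 0)"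
    by (auto simp: vec_eq_iff row_def)
  ultimately show ?thesis by simp
qed

text \<open>Only row l of the Jacobian matrix differs from the identity, and not on the diagonal,
  since g does not depend on coordinate l. For the same reason g has equal values at a point and its
  image, which gives the inverse.\<close>

lemma shear_Gr:
  fixes g :: "complex ^ 'n::finite \<Rightarrow> complex"
  assumes g: "entire g" and ind: "\<And>y c. g (y + c *s axis l 1) = g y"
  shows "(\<lambda>y. y + g y *s axis l 1) \<in> Gr vol" "inv (\<lambda>y. y + g y *s axis l 1) = (\<lambda>y. y - g y *s axis l 1)"
proof -
  let ?S = "\<lambda>y. y + g y *s axis l 1" and ?V = "\<lambda>y. g y *s axis l 1 :: complex ^ 'n"
  have V: "holomorphic_map ?V" by (intro holomorphic_map_smult g) simp
  have S: "holomorphic_map ?S" by (intro holomorphic_map_add V) simp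
  have S': "holomorphic_map (\<lambda>y. y - g y *s axis l 1)" by (intro holomorphic_map_diff V) simp
  have ind': "g (y - c *s axis l 1) = g y" for y c using ind[of y "- c"] by simp
  have "jac ?V z = (\<chi> i. if i = l then (\<chi> k. taylor_term g z 1 (axis k 1)) else 0)" for z
  proof -
    have c: "(\<lambda>z. ?V z $ i) = (if i = l then g else (\<lambda>_. 0))" for i by (auto simp: axis_def fun_eq_iff)
    have "partial_deriv ?V i k z = taylor_term (\<lambda>z. ?V z $ i) z 1 (axis k 1)" for i k
      by (rule partial_deriv_taylor_term[OF holomorphic_map_entire[OF V]])
    then show ?thesis unfolding c by (simp add: vec_eq_iff jac_def taylor_term_def)
  qed
  moreover have "taylor_term g z 1 (axis l 1) = 0" for z unfolding taylor_term_def ind by simp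
  ultimately have "det (jac ?S z) = 1" for z
    using jac_add[OF holomorphic_map_id V, of z] by (simp add: det_add_row)
  then have j: "jacobian_det ?S z = 1" for z by (simp add: jacobian_det_jac)
  show "?S \<in> Gr vol" by (rule GrI(1)[OF S S']) (auto simp: j ind ind')
  show "inv ?S = (\<lambda>y. y - g y *s axis l 1)" by (rule GrI(2)[OF S S', of vol]) (auto simp: j ind ind')
qed

text \<open>Coordinate l is multiplied by exp (g y), and g is unchanged by the map, so
  \<open>- g\<close> gives the inverse. The Jacobian determinant is exp (g y), hence membership in
  the full group only.\<close>

lemma overshear_Gr:
  fixes g :: "complex ^ 'n::finite \<Rightarrow> complex"
  assumes g: "entire g" and ind: "\<And>y c. g (y + c *s axis l 1) = g y"
  shows "(\<lambda>y. y + ((exp (g y) - 1) * y $ l) *s axis l 1) \<in> Gr False"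
proof (rule GrI(1)[where G = "\<lambda>y. y + ((exp (- g y) - 1) * y $ l) *s axis l 1"])
  have e: "entire (\<lambda>y. exp (g y))" "entire (\<lambda>y. exp (- g y))"
    by (intro entire_compose_univ[OF g] entire_compose_univ[OF entire_minus[OF g]] holomorphic_intros)+
  show "holomorphic_map (\<lambda>y. y + ((exp (g y) - 1) * y $ l) *s axis l 1)"
    "holomorphic_map (\<lambda>y. y + ((exp (- g y) - 1) * y $ l) *s axis l 1)"
    by (intro holomorphic_map_add holomorphic_map_smult entire_mult entire_diff e; simp)+
  fix z
  have a: "exp (g z) * exp (- g z) = 1" by (simp add: exp_minus)
  show "z + ((exp (- g z) - 1) * z $ l) *s axis l 1 +
         ((exp (g (z + ((exp (- g z) - 1) * z $ l) *s axis l 1)) - 1) * (z + ((exp (- g z) - 1) * z $ l) *s axis l 1) $ l) *s axis l 1 = z"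
    using a unfolding ind by (auto simp: vec_eq_iff axis_def algebra_simps)
  show "z + ((exp (g z) - 1) * z $ l) *s axis l 1 +
         ((exp (- g (z + ((exp (g z) - 1) * z $ l) *s axis l 1)) - 1) * (z + ((exp (g z) - 1) * z $ l) *s axis l 1) $ l) *s axis l 1 = z"
    using a unfolding ind by (auto simp: vec_eq_iff axis_def algebra_simps)
qed simp

text \<open>Brouwer's theorem on the ball of radius R gives a fixed point of y - (T x - x), as a
  function of x. It is a preimage of y, hence equal to \<open>inv T y\<close>, and it lies where T
  is known to be close to the identity.\<close>

lemma near_identity_inverse:
  fixes T :: "complex ^ 'n::finite \<Rightarrow> complex ^ 'n"
  assumes T: "T \<in> Gr vol" and near: "\<And>x. norm x \<le> R \<Longrightarrow> norm (T x - x) \<le> e"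
    and e: "e > 0" and y: "norm y \<le> r" and r: "r + e \<le> R"
  shows "norm (inv T y - y) \<le> e"
proof -
  have R: "R > 0" using y r e norm_ge_zero[of y] by linarith
  define f where "f x = y - (T x - x)" for x
  have "continuous_on (cball 0 R) f"
    unfolding f_def by (intro continuous_intros holomorphic_map_continuous Gr_holo[OF T])
  moreover have "f x \<in> cball 0 R" if "x \<in> cball 0 R" for x
  proof -
    have "norm (f x) \<le> norm y + norm (T x - x)" unfolding f_def by (rule norm_triangle_ineq4)
    then show ?thesis using near[of x] that y r by simp
  qed
  ultimately obtain x where x: "x \<in> cball 0 R" "f x = x"
    using brouwer_ball[OF R, of 0 f] by blast
  then have "T x = y" by (simp add: f_def algebra_simps)
  then have "inv T y = x" using T by auto
  then show ?thesis using near[of x] x \<open>T x = y\<close> by (simp add: norm_minus_commute)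
qed

lemma hpoly_homogeneous: 
  fixes f :: "complex ^ 'n::finite \<Rightarrow> complex"
  assumes "hpoly s f" shows "homogeneous s f"
  using assms
proof induction
  case (zero s)
  then show ?case by (simp add: homogeneous_def)
next
  case (mono \<alpha> s c)
  show ?case unfolding mono[symmetric]
    by (simp add: homogeneous_def power_mult_distrib prod.distrib power_sum)
next
  case (add s f g)
  then show ?case by (simp add: homogeneous_def distrib_left)
qed

lemma hpoly_entire: "hpoly s f \<Longrightarrow> entire f"
  by (induction rule: hpoly.induct) (auto intro!: entire_add entire_mult entire_prod entire_power)

lemma hpoly_vanish:
  assumes "hpoly s f" shows "vanish s 0 f"
  using homogeneous_vanish[OF hpoly_entire[OF assms] hpoly_homogeneous[OF assms], of 0] by simp

subsection \<open>Jets realized by automorphisms close to the identity\<close>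

text \<open>At \<open>p\<close> a jet of order \<open>m\<close> is prescribed, at the other integer
  points the identity to order \<open>mo\<close>. The axis has direction \<open>i0\<close>, and
  \<open>l\<close> is the direction of all untilted shears.\<close>

locale jet_realization =
  fixes vol :: bool and k m mo :: nat and R0 :: real and i0 l :: "'n::finite" and p :: "complex ^ 'n"
  assumes k: "k \<ge> 1" and R0: "0 < R0" "R0 < real k" and l: "l \<noteq> i0" and p: "p = of_nat k *s axis i0 1"
begin

text \<open>Closeness is asked on all balls of radius below R0: composition needs a slightly larger
  radius for the outer map, and the open range absorbs this.\<close>

definition realizable :: "(complex ^ 'n \<Rightarrow> complex ^ 'n) \<Rightarrow> bool" where
  "realizable F \<longleftrightarrow> F p = p \<and> (\<forall>R<R0. \<forall>e>0. \<exists>T\<in>Gr vol. jet_eq m p T F \<and>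
      (\<forall>j. j \<noteq> k \<longrightarrow> jet_eq mo (of_nat j *s axis i0 1) T (\<lambda>x. x)) \<and>
      (\<forall>x. norm x \<le> R \<longrightarrow> norm (T x - x) \<le> e))"

lemma realizableE:
  assumes "realizable F" "R < R0" "e > 0"
  obtains T where "T \<in> Gr vol" "jet_eq m p T F"
    "\<And>j. j \<noteq> k \<Longrightarrow> jet_eq mo (of_nat j *s axis i0 1) T (\<lambda>x. x)"
    "\<And>x. norm x \<le> R \<Longrightarrow> norm (T x - x) \<le> e" "T p = p"
proof -
  obtain T where T: "T \<in> Gr vol" "jet_eq m p T F"
    "\<And>j. j \<noteq> k \<Longrightarrow> jet_eq mo (of_nat j *s axis i0 1) T (\<lambda>x. x)"
    "\<And>x. norm x \<le> R \<Longrightarrow> norm (T x - x) \<le> e"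
    using assms unfolding realizable_def by metis
  moreover have "T p = p" using jet_eq_at[OF T(2)] assms(1) by (simp add: realizable_def)
  ultimately show ?thesis using that by blast
qed

lemma realizable_map:
  assumes "realizable F" obtains T where "T \<in> Gr vol" "jet_eq m p T F" "T p = p"
  using realizableE[OF assms, of 0 1] R0 by auto

lemma realizable_id [simp]: "realizable (\<lambda>x. x)"
  unfolding realizable_def by (auto intro!: bexI[of _ "\<lambda>x. x"])

lemma realizable_jet:
  assumes "realizable F" "jet_eq m p F G" shows "realizable G"
  unfolding realizable_def
proof (intro conjI allI impI)
  show "G p = p" using assms jet_eq_at[OF assms(2)] by (simp add: realizable_def)
  fix R e :: real assume "R < R0" "e > 0"
  from realizableE[OF assms(1) this] show "\<exists>T\<in>Gr vol. jet_eq m p T G \<and>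
      (\<forall>j. j \<noteq> k \<longrightarrow> jet_eq mo (of_nat j *s axis i0 1) T (\<lambda>x. x)) \<and>
      (\<forall>x. norm x \<le> R \<longrightarrow> norm (T x - x) \<le> e)"
    by (metis jet_eq_trans[OF _ assms(2)])
qed

lemma realizable_lips: "realizable F \<Longrightarrow> lipschitz_at p F"
  by (metis realizable_map lipschitz_at_jet_eq holomorphic_map_lipschitz_at Gr_holo)

lemma realizable_compose:
  assumes F: "realizable F" and G: "realizable G" shows "realizable (\<lambda>x. F (G x))"
  unfolding realizable_def
proof (intro conjI allI impI)
  show "F (G p) = p" using assms by (simp add: realizable_def)
  fix R e :: real assume R: "R < R0" and e: "e > 0"
  \<comment> \<open>Half of the gap to R0 is spent: T maps the ball of radius R into that of radius
    R', where S is controlled.\<close>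
  define R' where "R' = (R + R0) / 2"
  define e' where "e' = min (e / 2) ((R0 - R) / 2)"
  have R': "R' < R0" and e': "e' > 0" using R e by (auto simp: R'_def e'_def)
  obtain S where S: "S \<in> Gr vol" "jet_eq m p S F"
    "\<And>j. j \<noteq> k \<Longrightarrow> jet_eq mo (of_nat j *s axis i0 1) S (\<lambda>x. x)"
    "\<And>x. norm x \<le> R' \<Longrightarrow> norm (S x - x) \<le> e'" "S p = p"
    using realizableE[OF F R' e'] by blast
  obtain T where T: "T \<in> Gr vol" "jet_eq m p T G"
    "\<And>j. j \<noteq> k \<Longrightarrow> jet_eq mo (of_nat j *s axis i0 1) T (\<lambda>x. x)"
    "\<And>x. norm x \<le> R \<Longrightarrow> norm (T x - x) \<le> e'" "T p = p"
    using realizableE[OF G R e'] by blast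
  show "\<exists>T\<in>Gr vol. jet_eq m p T (\<lambda>x. F (G x)) \<and>
      (\<forall>j. j \<noteq> k \<longrightarrow> jet_eq mo (of_nat j *s axis i0 1) T (\<lambda>x. x)) \<and>
      (\<forall>x. norm x \<le> R \<longrightarrow> norm (T x - x) \<le> e)"
  proof (intro bexI[of _ "\<lambda>x. S (T x)"] conjI allI impI)
    show "(\<lambda>x. S (T x)) \<in> Gr vol" by (rule Gr_comp(1)[OF S(1) T(1)])
    have "jet_eq m p (\<lambda>x. S (T x)) (\<lambda>x. S (G x))"
      by (rule jet_eq_compose_left[OF T(2) holomorphic_map_locally_lipschitz[OF Gr_holo[OF S(1)]] holomorphic_map_lipschitz_at[OF Gr_holo[OF T(1)]]])
    moreover have "jet_eq m p (\<lambda>x. S (G x)) (\<lambda>x. F (G x))"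
      by (rule jet_eq_compose_right[where K = G, OF _ realizable_lips[OF G]]) (use G S(2) in \<open>auto simp: realizable_def\<close>)
    ultimately show "jet_eq m p (\<lambda>x. S (T x)) (\<lambda>x. F (G x))" by (rule jet_eq_trans)
  next
    fix j assume j: "j \<noteq> k"
    let ?q = "of_nat j *s axis i0 1 :: complex ^ 'n"
    have q: "T ?q = ?q" using jet_eq_at[OF T(3)[OF j]] .
    have "jet_eq mo ?q (\<lambda>x. S (T x)) (\<lambda>x. T x)"
      by (rule jet_eq_compose_right[where K = T, OF _ holomorphic_map_lipschitz_at[OF Gr_holo[OF T(1)]]]) (use S(3)[OF j] in \<open>simp add: q\<close>)
    then show "jet_eq mo ?q (\<lambda>x. S (T x)) (\<lambda>x. x)" using T(3)[OF j] by (rule jet_eq_trans)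
  next
    fix x :: "complex ^ 'n" assume x: "norm x \<le> R"
    have Tx: "norm (T x - x) \<le> e'" using T x by blast
    then have "norm (T x) \<le> R'" using x norm_triangle_sub[of "T x" x] by (simp add: R'_def e'_def field_simps)
    then have "norm (S (T x) - T x) \<le> e'" by (rule S(4))
    then show "norm (S (T x) - x) \<le> e"
      using Tx norm_triangle_ineq[of "S (T x) - T x" "T x - x"] by (simp add: e'_def)
  qed
qed

section \<open>Tilted shears and overshears with a cutoff\<close>

text \<open>Fixes the axis pointwise, as coordinate l is 0 there. Conjugation with it turns the
  direction e_l into e_l - t e_r without moving the integer points.\<close>

definition tilt :: "complex \<Rightarrow> 'n \<Rightarrow> complex ^ 'n \<Rightarrow> complex ^ 'n" where
  "tilt t r x = x + (t * x $ l) *s axis r 1"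

lemma tilt_add_axis: "tilt t r (y + c *s axis l 1) = tilt t r y + c *s (axis l 1 + t *s axis r 1)"
  by (simp add: tilt_def vec_eq_iff axis_def algebra_simps)

lemma tilt_diff: "tilt t r (x - y) = tilt t r x - tilt t r y"
  by (simp add: tilt_def vec_eq_iff axis_def algebra_simps)

lemma p_l [simp]: "p $ l = 0"
  using l by (simp add: p axis_def)

lemma tilt_p [simp]: "tilt t r p = p"
  by (simp add: tilt_def)

lemma norm_tilt: "norm (tilt t r x) \<le> (1 + cmod t) * norm x"
proof -
  have "norm (tilt t r x) \<le> norm x + norm ((t * x $ l) *s axis r (1::complex))"
    unfolding tilt_def by (rule norm_triangle_ineq)
  also have "\<dots> \<le> norm x + cmod t * norm x"
    by (simp add: norm_mult mult_left_mono Finite_Cartesian_Product.norm_nth_le)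
  finally show ?thesis by (simp add: distrib_right)
qed

lemma holomorphic_tilt: "holomorphic_map (tilt t r)"
  unfolding tilt_def by (intro holomorphic_map_add holomorphic_map_smult entire_mult) simp_all

lemma tilt_Gr:
  assumes "r \<noteq> l"
  shows "tilt t r \<in> Gr vol" "inv (tilt t r) = tilt (- t) r"
proof -
  have e: "entire (\<lambda>y. t * y $ l :: complex)" by (intro entire_mult) auto
  have i: "t * (y + c *s axis r 1) $ l = t * y $ l" for y :: "complex ^ 'n" and c using assms by (simp add: axis_def)
  show "tilt t r \<in> Gr vol" unfolding tilt_def[abs_def] by (rule shear_Gr(1)[OF e i])
  show "inv (tilt t r) = tilt (- t) r"
    unfolding tilt_def[abs_def] using shear_Gr(2)[OF e i] by (simp add: fun_eq_iff vec_eq_iff)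
qed

lemma vanish_coord: "vanish (Suc 0) q (\<lambda>x. tilt t r x $ i - tilt t r q $ i)"
  using holomorphic_map_lipschitz_at[OF holomorphic_tilt, of q t r] unfolding lipschitz_at_def vanish_vec_iff by simp

text \<open>The cutoff \<open>u\<close> enters through the first coordinate after the tilt; the generator
  \<open>G\<close> is switched off for \<open>u = 0\<close> and fully active for \<open>u = 1\<close>.\<close>

lemma realizable_generator:
  fixes G :: "complex \<Rightarrow> complex ^ 'n \<Rightarrow> complex"
  assumes r: "r \<noteq> l" and t: "(1 + cmod t) * R0 < real k"
    and Gr: "\<And>u. entire u \<Longrightarrow> (\<And>y c. u (y + c *s axis l 1) = u y) \<Longrightarrow> (\<lambda>y. y + G (u y) y *s axis l 1) \<in> Gr vol"
    and G0: "\<And>y. G 0 y = 0" and Gp: "G 1 p = 0"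
    and lip: "\<And>\<rho>. \<exists>L>0. \<forall>y w w'. norm y \<le> \<rho> \<longrightarrow> cmod w \<le> 2 \<longrightarrow> cmod w' \<le> 2 \<longrightarrow> cmod (G w y - G w' y) \<le> L * cmod (w - w')"
  shows "realizable (\<lambda>x. x + G 1 (tilt t r x) *s (axis l 1 - t *s axis r 1))"
proof -
  define v where "v = (axis l 1 - t *s axis r 1 :: complex ^ 'n)"
  define K where "K = tilt t r"
  \<comment> \<open>The Lipschitz bound in the first argument of G carries the flatness of the
    cutoff over to G. Near q the cutoff stays within distance 1 of its value w, which is 0 or 1 in
    the applications; hence the radius 2 in the Lipschitz assumption.\<close>
  have near_lip: "vanish a q (\<lambda>x. G (u (K x $ i0)) (K x) - G w (K x))"
    if v: "vanish a (K q $ i0) (\<lambda>z. u z - w)" "a \<ge> 1" and w: "cmod w \<le> 1" for u a q w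
  proof -
    have vu: "vanish a q (\<lambda>x. u (K x $ i0) - w)"
      using vanish_compose[OF v(1), of q "\<lambda>x. K x $ i0"] vanish_coord by (simp add: K_def)
    obtain b where b: "a = Suc b" using v(2) by (cases a) auto
    have "((\<lambda>x. u (K x $ i0)) \<longlongrightarrow> w) (nhds q)" using vu unfolding b by (rule vanish_tendsto)
    then have ev: "\<forall>\<^sub>F x in nhds q. dist (u (K x $ i0)) w < 1" by (rule tendstoD) simp
    have ev1: "\<forall>\<^sub>F x in nhds q. dist x q < 1"
      unfolding eventually_nhds_metric by (intro exI[of _ 1]) auto
    obtain L where L: "L > 0" "\<And>y w w'. norm y \<le> (1 + cmod t) * (norm q + 1) \<Longrightarrow> cmod w \<le> 2 \<Longrightarrow> cmod w' \<le> 2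
        \<Longrightarrow> cmod (G w y - G w' y) \<le> L * cmod (w - w')"
      using lip[of "(1 + cmod t) * (norm q + 1)"] by blast
    obtain C where "\<forall>\<^sub>F x in nhds q. cmod (u (K x $ i0) - w) \<le> C * norm (x - q) ^ a"
      using vu unfolding vanish_def by blast
    with ev1 ev have "\<forall>\<^sub>F x in nhds q. cmod (G (u (K x $ i0)) (K x) - G w (K x)) \<le> (L * C) * norm (x - q) ^ a"
    proof eventually_elim
      case (elim x)
      have "norm x \<le> norm q + 1" using elim(1) norm_triangle_sub[of x q] by (simp add: dist_norm)
      then have "(1 + cmod t) * norm x \<le> (1 + cmod t) * (norm q + 1)" by (intro mult_left_mono) auto
      then have "norm (K x) \<le> (1 + cmod t) * (norm q + 1)" using norm_tilt[of t r x] unfolding K_def by linarith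
      moreover have "cmod (u (K x $ i0)) \<le> 2"
        using elim(2) w norm_triangle_sub[of "u (K x $ i0)" w] by (simp add: dist_norm)
      ultimately have "cmod (G (u (K x $ i0)) (K x) - G w (K x)) \<le> L * cmod (u (K x $ i0) - w)"
        using w by (intro L(2)) auto
      also have "\<dots> \<le> L * (C * norm (x - q) ^ a)" using elim L(1) by (intro mult_left_mono) auto
      finally show ?case by simp
    qed
    then show ?thesis by (rule vanishI)
  qed
  have "realizable (\<lambda>x. x + G 1 (K x) *s v)"
    unfolding realizable_def
  proof (intro conjI allI impI)
    show "p + G 1 (K p) *s v = p" by (simp add: K_def Gp)
    fix R e :: real assume R: "R < R0" and e: "e > 0"
    obtain L where L: "L > 0" "\<And>y w w'. norm y \<le> (1 + cmod t) * R0 \<Longrightarrow> cmod w \<le> 2 \<Longrightarrow> cmod w' \<le> 2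
        \<Longrightarrow> cmod (G w y - G w' y) \<le> L * cmod (w - w')"
      using lip[of "(1 + cmod t) * R0"] by blast
    have nv: "norm v + 1 > 0" by (simp add: add_nonneg_pos)
    \<comment> \<open>The displacement will be at most L * d * (norm v + 1). The 1 in the minimum
      keeps the cutoff values where L is valid.\<close>
    define d where "d = min 1 (e / (L * (norm v + 1)))"
    have d: "d > 0" "d \<le> 1" "d * (L * (norm v + 1)) \<le> e"
    proof -
      have Lv: "L * (norm v + 1) > 0" using L nv by simp
      then show "d > 0" "d \<le> 1" using e by (auto simp: d_def)
      have "d * (L * (norm v + 1)) \<le> e / (L * (norm v + 1)) * (L * (norm v + 1))"
        using Lv by (intro mult_right_mono) (auto simp: d_def)
      also have "\<dots> = e" using Lv by (metis less_irrefl nonzero_divide_eq_eq)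
      finally show "d * (L * (norm v + 1)) \<le> e" .
    qed
    \<comment> \<open>One cutoff serves all integer points, so it is flat to the larger of the two
      orders. The disc contains coordinate i0 of every point of the tilted ball.\<close>
    obtain u :: "complex \<Rightarrow> complex" where u: "u holomorphic_on UNIV"
      "vanish (Suc (max m mo)) (of_nat k) (\<lambda>z. u z - 1)"
      "\<And>j. j \<noteq> k \<Longrightarrow> vanish (Suc (max m mo)) (of_nat j) u" "\<And>z. cmod z \<le> (1 + cmod t) * R0 \<Longrightarrow> cmod (u z) \<le> d"
      using cutoff_exists[OF k t d(1), of "max m mo"] by blast
    have u2: "vanish (Suc m) (of_nat k) (\<lambda>z. u z - 1)" by (rule vanish_mono[OF u(2)]) simp
    have u3: "vanish (Suc mo) (of_nat j) u" if "j \<noteq> k" for j by (rule vanish_mono[OF u(3)[OF that]]) simp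
    define T where "T x = x + G (u (K x $ i0)) (K x) *s v" for x
    \<comment> \<open>The untilted map: its cutoff is independent of coordinate l because l differs
      from i0. \<open>T\<close> is its conjugate by the tilt.\<close>
    have "(\<lambda>y. y + G (u (y $ i0)) y *s axis l 1) \<in> Gr vol"
      using l by (intro Gr entire_compose_univ[OF _ u(1)]) (auto simp: axis_def)
    from Gr_comp(1)[OF this tilt_Gr(1)[OF r, of t]]
    have "(\<lambda>x. tilt (- t) r (K x + G (u (K x $ i0)) (K x) *s axis l 1)) \<in> Gr vol"
      unfolding K_def by (rule Gr_comp(1)[OF tilt_Gr(1)[OF r]])
    moreover have "tilt (- t) r (K x) = x" for x
      using r by (simp add: K_def tilt_def vec_eq_iff axis_def)
    ultimately have TG: "T \<in> Gr vol"
      unfolding T_def[abs_def] v_def by (simp add: tilt_add_axis)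
    have Kq: "K (of_nat j *s axis i0 1) = of_nat j *s axis i0 1" for j
      using l by (simp add: K_def tilt_def axis_def)
    have Kq0: "K (of_nat j *s axis i0 1) $ i0 = of_nat j" for j unfolding Kq by (simp add: axis_def)
    have "p $ i0 = of_nat k" by (simp add: p axis_def)
    then have Kp: "K p $ i0 = of_nat k" by (simp add: K_def)
    show "\<exists>T\<in>Gr vol. jet_eq m p T (\<lambda>x. x + G 1 (K x) *s v) \<and>
        (\<forall>j. j \<noteq> k \<longrightarrow> jet_eq mo (of_nat j *s axis i0 1) T (\<lambda>x. x)) \<and>
        (\<forall>x. norm x \<le> R \<longrightarrow> norm (T x - x) \<le> e)"
    proof (intro bexI[OF _ TG] conjI allI impI)
      have "vanish (Suc m) p (\<lambda>x. G (u (K x $ i0)) (K x) - G 1 (K x))"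
        by (rule near_lip) (use u2 in \<open>simp_all add: Kp\<close>)
      from vanish_smult[OF this vanish_const[of p v]]
      show "jet_eq m p T (\<lambda>x. x + G 1 (K x) *s v)"
        by (simp add: jet_eq_def T_def vector_sub_rdistrib)
    next
      fix j assume j: "j \<noteq> k"
      have "vanish (Suc mo) (of_nat j *s axis i0 1) (\<lambda>x. G (u (K x $ i0)) (K x) - G 0 (K x))"
        by (rule near_lip) (use u3[OF j] in \<open>simp_all add: Kq0\<close>)
      from vanish_smult[OF this vanish_const[of _ v]]
      show "jet_eq mo (of_nat j *s axis i0 1) T (\<lambda>x. x)"
        by (simp add: jet_eq_def T_def G0)
    next
      fix x :: "complex ^ 'n" assume x: "norm x \<le> R"
      have "(1 + cmod t) * norm x \<le> (1 + cmod t) * R0" using x R by (intro mult_left_mono) auto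
      then have Kx: "norm (K x) \<le> (1 + cmod t) * R0" using norm_tilt[of t r x] unfolding K_def by linarith
      then have "cmod (K x $ i0) \<le> (1 + cmod t) * R0" by (meson Finite_Cartesian_Product.norm_nth_le order_trans)
      then have ux: "cmod (u (K x $ i0)) \<le> d" by (rule u(4))
      have "cmod (G (u (K x $ i0)) (K x) - G 0 (K x)) \<le> L * cmod (u (K x $ i0) - 0)"
        using ux d by (intro L(2) Kx) auto
      also have "\<dots> \<le> L * d" using ux L by simp
      finally have "cmod (G (u (K x $ i0)) (K x)) \<le> L * d" by (simp add: G0)
      then have "norm (T x - x) \<le> (L * d) * (norm v + 1)"
        unfolding T_def using L d by (simp add: mult_mono)
      then show "norm (T x - x) \<le> e" using d(3) by (simp add: mult_ac)
    qed
  qed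
  then show ?thesis by (simp add: K_def v_def)
qed

text \<open>A tilt enlarges norms by the factor 1 + cmod t at most. For cmod t below this bound the
  tilted ball of radius R0 stays inside the open ball of radius k, where the cutoff can be made
  small.\<close>

definition tau :: real where "tau = real k / R0 - 1"

lemma tau_pos: "tau > 0"
  using R0 by (simp add: tau_def field_simps)

lemma tau_bound: "cmod t < tau \<Longrightarrow> (1 + cmod t) * R0 < real k"
  using R0 by (simp add: tau_def field_simps)

lemma realizable_shear:
  assumes r: "r \<noteq> l" and t: "cmod t < tau" and h: "entire h" and ind: "\<And>y c. h (y + c *s axis l 1) = h y" and h0: "h 0 = 0"
  shows "realizable (\<lambda>x. x + h (tilt t r (x - p)) *s (axis l 1 - t *s axis r 1))"
proof -
  have hs: "entire (\<lambda>y. h (y - p))" by (rule entire_shift'[OF h])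
  have ind': "h (y + c *s axis l 1 - p) = h (y - p)" for y c
    using ind[of "y - p" c] by (simp add: algebra_simps)
  have "realizable (\<lambda>x. x + 1 * h (tilt t r x - p) *s (axis l 1 - t *s axis r 1))"
  proof (rule realizable_generator[where G = "\<lambda>w y. w * h (y - p)"])
    fix u :: "complex ^ 'n \<Rightarrow> complex" assume u: "entire u" "\<And>y c. u (y + c *s axis l 1) = u y"
    show "(\<lambda>y. y + (u y * h (y - p)) *s axis l 1) \<in> Gr vol"
      by (intro shear_Gr(1) entire_mult hs u(1)) (simp only: u(2) ind')
  next
    fix \<rho>
    obtain M where M: "M > 0" "\<And>w. norm w \<le> \<rho> \<Longrightarrow> cmod (h (0 + w - p)) \<le> M"
      using entire_bounded[OF hs] by blast
    show "\<exists>L>0. \<forall>y w w'. norm y \<le> \<rho> \<longrightarrow> cmod w \<le> 2 \<longrightarrow> cmod w' \<le> 2 \<longrightarrow>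
        cmod (w * h (y - p) - w' * h (y - p)) \<le> L * cmod (w - w')"
    proof (intro exI[of _ M] conjI allI impI M(1))
      fix y :: "complex ^ 'n" and w w' assume "norm y \<le> \<rho>"
      then have "cmod (w - w') * cmod (h (y - p)) \<le> cmod (w - w') * M" using M(2)[of y] by (intro mult_left_mono) auto
      then show "cmod (w * h (y - p) - w' * h (y - p)) \<le> M * cmod (w - w')"
        by (simp add: left_diff_distrib[symmetric] norm_mult mult.commute)
    qed
  qed (use r tau_bound[OF t] h0 in auto)
  then show ?thesis by (simp add: tilt_diff)
qed

text \<open>Coordinate l of \<open>p\<close> is 0, so \<open>p\<close> is fixed whatever value h
  takes there. In particular h may be constant, which later yields diagonal matrices.\<close>

lemma realizable_overshear:
  assumes vol: "\<not> vol" and r: "r \<noteq> l" and t: "cmod t < tau" and h: "entire h"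
    and ind: "\<And>y c. h (y + c *s axis l 1) = h y"
  shows "realizable (\<lambda>x. x + ((exp (h (tilt t r (x - p))) - 1) * (x - p) $ l) *s (axis l 1 - t *s axis r 1))"
proof -
  have hs: "entire (\<lambda>y. h (y - p))" by (rule entire_shift'[OF h])
  have ind': "h (y + c *s axis l 1 - p) = h (y - p)" for y c
    using ind[of "y - p" c] by (simp add: algebra_simps)
  have "realizable (\<lambda>x. x + ((exp (1 * h (tilt t r x - p)) - 1) * tilt t r x $ l) *s (axis l 1 - t *s axis r 1))"
  proof (rule realizable_generator[where G = "\<lambda>w y. (exp (w * h (y - p)) - 1) * y $ l"])
    fix u :: "complex ^ 'n \<Rightarrow> complex" assume u: "entire u" "\<And>y c. u (y + c *s axis l 1) = u y"
    have "(\<lambda>y. y + ((exp (u y * h (y - p)) - 1) * y $ l) *s axis l 1) \<in> Gr False"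
      by (intro overshear_Gr entire_mult hs u(1)) (simp only: u(2) ind')
    then show "(\<lambda>y. y + ((exp (u y * h (y - p)) - 1) * y $ l) *s axis l 1) \<in> Gr vol" using vol by simp
  next
    fix \<rho>
    obtain M where M: "M > 0" "\<And>w. norm w \<le> \<rho> \<Longrightarrow> cmod (h (0 + w - p)) \<le> M"
      using entire_bounded[OF hs] by blast
    \<comment> \<open>The factor exp (2 M) bounds the derivative of exp on the disc containing all w
      * h, M bounds h, and the last factor bounds coordinate l.\<close>
    define L where "L = exp (2 * M) * M * (\<bar>\<rho>\<bar> + 1)"
    show "\<exists>L>0. \<forall>y w w'. norm y \<le> \<rho> \<longrightarrow> cmod w \<le> 2 \<longrightarrow> cmod w' \<le> 2 \<longrightarrow>
        cmod ((exp (w * h (y - p)) - 1) * y $ l - (exp (w' * h (y - p)) - 1) * y $ l) \<le> L * cmod (w - w')"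
    proof (intro exI[of _ L] conjI allI impI)
      show "L > 0" using M by (simp add: L_def add_nonneg_pos)
      fix y :: "complex ^ 'n" and w w' assume y: "norm y \<le> \<rho>" and w: "cmod w \<le> 2" "cmod w' \<le> 2"
      have hy: "cmod (h (y - p)) \<le> M" using M(2)[of y] y by simp
      have "cmod (exp (w * h (y - p)) - exp (w' * h (y - p))) \<le> exp (2 * M) * cmod (w * h (y - p) - w' * h (y - p))"
      proof (rule field_differentiable_bound[where S = "cball 0 (2 * M)" and f = exp and f' = exp])
        fix z :: complex assume "z \<in> cball 0 (2 * M)"
        then have "Re z \<le> 2 * M" using complex_Re_le_cmod[of z] by simp
        then show "cmod (exp z) \<le> exp (2 * M)" by simp
        show "(exp has_field_derivative exp z) (at z within cball 0 (2 * M))" by (auto intro!: derivative_eq_intros)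
      qed (use hy w M in \<open>auto simp: norm_mult intro!: mult_mono\<close>)
      also have "\<dots> = exp (2 * M) * (cmod (w - w') * cmod (h (y - p)))"
        by (simp add: left_diff_distrib[symmetric] norm_mult)
      also have "\<dots> \<le> exp (2 * M) * (cmod (w - w') * M)" using hy by (intro mult_left_mono) auto
      finally have e: "cmod (exp (w * h (y - p)) - exp (w' * h (y - p))) \<le> exp (2 * M) * (cmod (w - w') * M)" .
      have "cmod (y $ l) \<le> \<bar>\<rho>\<bar> + 1" using y Finite_Cartesian_Product.norm_nth_le[of y l] by linarith
      with e have "cmod (exp (w * h (y - p)) - exp (w' * h (y - p))) * cmod (y $ l)
          \<le> exp (2 * M) * (cmod (w - w') * M) * (\<bar>\<rho>\<bar> + 1)"
        using M by (intro mult_mono) auto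
      moreover have "(exp (w * h (y - p)) - 1) * y $ l - (exp (w' * h (y - p)) - 1) * y $ l
          = (exp (w * h (y - p)) - exp (w' * h (y - p))) * y $ l" by (simp add: left_diff_distrib)
      ultimately show "cmod ((exp (w * h (y - p)) - 1) * y $ l - (exp (w' * h (y - p)) - 1) * y $ l) \<le> L * cmod (w - w')"
        by (simp only: norm_mult L_def mult_ac)
    qed
  qed (use r tau_bound[OF t] in auto)
  moreover have "tilt t r x $ l = x $ l" for x using r by (simp add: tilt_def axis_def)
  ultimately show ?thesis by (simp add: tilt_diff)
qed

end

lemma exp_taylor_vanish:
  assumes h: "vanish j p h"
  shows "vanish (j + j) p (\<lambda>x. exp (h x) - 1 - h x :: complex)"
proof -
  have e: "cmod (exp z - 1 - z) \<le> exp B * cmod z ^ 2" if "cmod z \<le> B" for z B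
  proof -
    have "cmod (exp z - (\<Sum>i\<le>1. z ^ i / fact i)) \<le> exp \<bar>Re z\<bar> * cmod z ^ Suc 1 / fact 1"
      by (rule Taylor_exp)
    then have "cmod (exp z - 1 - z) \<le> exp \<bar>Re z\<bar> * cmod z ^ 2"
      by (simp add: diff_diff_eq numeral_2_eq_2)
    also have "\<dots> \<le> exp B * cmod z ^ 2"
      using that abs_Re_le_cmod[of z] by (intro mult_right_mono) auto
    finally show ?thesis .
  qed
  obtain C where C: "C > 0" "\<forall>\<^sub>F x in nhds p. cmod (h x) \<le> C * norm (x - p) ^ j"
    using h by (rule vanishE)
  obtain B where B: "\<forall>\<^sub>F x in nhds p. cmod (h x) \<le> B * norm (x - p) ^ 0"
    using vanish_mono[OF h, of 0] by (auto elim: vanishE)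
  have "\<forall>\<^sub>F x in nhds p. cmod (exp (h x) - 1 - h x) \<le> (exp B * C ^ 2) * norm (x - p) ^ (j + j)"
    using C(2) B
  proof eventually_elim
    case (elim x)
    have "cmod (exp (h x) - 1 - h x) \<le> exp B * cmod (h x) ^ 2" using elim by (intro e) simp
    also have "\<dots> \<le> exp B * (C * norm (x - p) ^ j) ^ 2" using elim by (intro mult_left_mono power_mono) auto
    finally show ?case by (simp add: power_mult_distrib power_add power2_eq_square mult_ac)
  qed
  then show ?thesis by (rule vanishI)
qed

text \<open>With a = r + b, neighbouring binomial coefficients have the ratios (b + 1) / r and (b +
  1) / (r + 1), so the two sides differ by the factor r / (r + 1). The inequality makes a 2 by 2
  determinant nonzero in \<open>realizable_field_l_of_not_vol\<close>.\<close>

lemma binomial_cross: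
  assumes "r \<le> a" "r \<ge> 1"
  shows "(a choose (r - 1)) * (Suc a choose Suc r) < (a choose r) * (Suc a choose r)"
proof -
  obtain b where a: "a = r + b" using assms le_Suc_ex by blast
  obtain r0 where r: "r = Suc r0" using assms by (cases r) auto
  have 1: "Suc r * (Suc a choose Suc r) = Suc b * (Suc a choose r)"
    using Suc_times_binomial_add[of r b] by (simp add: a)
  have 2: "Suc r0 * (a choose r) = Suc b * (a choose r0)"
    using Suc_times_binomial_add[of r0 b] by (simp add: a r)
  have "Suc r * ((a choose (r - 1)) * (Suc a choose Suc r)) = (a choose r0) * (Suc r * (Suc a choose Suc r))"
    by (simp only: r diff_Suc_1 mult.left_commute)
  also have "\<dots> = (Suc b * (a choose r0)) * (Suc a choose r)" unfolding 1 by (simp only: mult_ac)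
  also have "\<dots> = r * ((a choose r) * (Suc a choose r))" unfolding 2[symmetric] by (simp only: r mult_ac)
  also have "\<dots> < Suc r * ((a choose r) * (Suc a choose r))" using assms by (simp add: zero_less_binomial)
  finally show ?thesis by (simp only: mult_less_cancel1)
qed

context jet_realization
begin

section \<open>Leading terms of jets tangent to the identity\<close>

text \<open>Terms of degree above q are left free, so that composition adds the fields when q is at
  least 2. The quantifier over c builds in closure under scalars.\<close>

definition realizable_field :: "nat \<Rightarrow> (complex ^ 'n \<Rightarrow> complex ^ 'n) \<Rightarrow> bool" where
  "realizable_field q X \<longleftrightarrow> vanish q 0 X \<and> (\<forall>c. \<exists>F. realizable F \<and> jet_eq q p F (\<lambda>x. x + c *s X (x - p)))"

lemma vanish_at_p: "vanish q 0 X \<Longrightarrow> vanish q p (\<lambda>x. X (x - p))"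
  using vanish_compose[of q 0 X p "\<lambda>x. x - p"] by simp

lemma realizable_field_zero: "realizable_field q (\<lambda>x. 0)"
  unfolding realizable_field_def by (auto intro!: exI[of _ "\<lambda>x. x"])

lemma realizable_field_cmul: "realizable_field q X \<Longrightarrow> realizable_field q (\<lambda>x. c *s X x)"
  unfolding realizable_field_def by (auto simp: vector_smult_assoc intro: vanish_scmul)

text \<open>Write S = id + E. Then S (G x) is G x + E x up to E (G x) - E x, which has order 2 q -
  1, at least q + 1 as q is at least 2.\<close>

lemma realizable_field_add:
  assumes X: "realizable_field q X" and Y: "realizable_field q Y" and q: "2 \<le> q" "q \<le> m"
  shows "realizable_field q (\<lambda>x. X x + Y x)"
  unfolding realizable_field_def
proof (intro conjI allI)
  have vX: "vanish q 0 X" and vY: "vanish q 0 Y" using X Y by (auto simp: realizable_field_def)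
  then show "vanish q 0 (\<lambda>x. X x + Y x)" by (rule vanish_add)
  fix c
  obtain F where F: "realizable F" "jet_eq q p F (\<lambda>x. x + c *s X (x - p))" using X by (auto simp: realizable_field_def)
  obtain G where G: "realizable G" "jet_eq q p G (\<lambda>x. x + c *s Y (x - p))" using Y by (auto simp: realizable_field_def)
  \<comment> \<open>F is only known through its jet; an automorphism with the same jet makes E
    entire, as the perturbation estimate demands.\<close>
  obtain S where S: "S \<in> Gr vol" "jet_eq m p S F" "S p = p" using realizable_map[OF F(1)] .
  have S2: "jet_eq q p S (\<lambda>x. x + c *s X (x - p))"
    using jet_eq_mono[OF S(2) q(2)] F(2) by (rule jet_eq_trans)
  have rS: "realizable S" by (rule realizable_jet[OF F(1) jet_eq_sym[OF S(2)]])
  define E where "E x = S x - x" for x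
  have EX: "vanish (Suc q) p (\<lambda>x. E x - c *s X (x - p))"
    using S2 unfolding jet_eq_def E_def by (simp add: diff_diff_eq)
  have "vanish q p (\<lambda>x. (E x - c *s X (x - p)) + c *s X (x - p))"
    by (intro vanish_add vanish_mono[OF EX] vanish_scmul vanish_at_p vX) simp
  then have vE: "vanish q p E" by simp
  have GY: "vanish (Suc q) p (\<lambda>x. G x - x - c *s Y (x - p))"
    using G(2) unfolding jet_eq_def by (simp add: diff_diff_eq)
  have "vanish q p (\<lambda>x. (G x - x - c *s Y (x - p)) + c *s Y (x - p))"
    by (intro vanish_add vanish_mono[OF GY] vanish_scmul vanish_at_p vY) simp
  then have vG: "vanish q p (\<lambda>x. G x - x)" by simp
  obtain j where j: "q = Suc (Suc j)" using q by (metis Suc_le_D numeral_2_eq_2 Suc_le_mono)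
  have "vanish (Suc q) p (\<lambda>x. E (G x) - E x)"
    unfolding vanish_vec_iff
  proof
    fix i
    have e: "entire (\<lambda>x. E x $ i)"
      unfolding E_def using Gr_holo[OF S(1)] by (auto intro!: entire_diff holomorphic_map_entire)
    have "vanish (Suc j + Suc (Suc j)) p (\<lambda>x. E (G x) $ i - E x $ i)"
      by (rule vanish_perturb[OF e]) (use vE vG in \<open>simp_all add: j vanish_vec_iff\<close>)
    then show "vanish (Suc q) p (\<lambda>x. (E (G x) - E x) $ i)" by (simp add: j vanish_mono[of "Suc j + Suc (Suc j)" p _ "Suc (Suc (Suc j))"])
  qed
  from vanish_add[OF vanish_add[OF this EX] GY]
  have "vanish (Suc q) p (\<lambda>x. S (G x) - (x + c *s (X (x - p) + Y (x - p))))"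
    by (simp add: E_def vector_add_ldistrib algebra_simps)
  then show "\<exists>F. realizable F \<and> jet_eq q p F (\<lambda>x. x + c *s (X (x - p) + Y (x - p)))"
    using realizable_compose[OF rS G(1)] unfolding jet_eq_def by blast
qed

lemma realizable_field_diff: "realizable_field q X \<Longrightarrow> realizable_field q Y \<Longrightarrow> 2 \<le> q \<Longrightarrow> q \<le> m \<Longrightarrow> realizable_field q (\<lambda>x. X x - Y x)"
  using realizable_field_add[OF _ realizable_field_cmul, of q X Y "-1"] by simp

lemma realizable_field_sum: "(\<And>i. i \<in> I \<Longrightarrow> realizable_field q (X i)) \<Longrightarrow> 2 \<le> q \<Longrightarrow> q \<le> m \<Longrightarrow> realizable_field q (\<lambda>x. \<Sum>i\<in>I. X i x)"
  by (induction I rule: infinite_finite_induct) (auto intro: realizable_field_add realizable_field_zero)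

text \<open>Passing from \<open>f t\<close> to \<open>2 ^ d f (t / 2) - f t\<close> lowers the degree in \<open>t\<close>.\<close>

lemma realizable_field_coeff:
  assumes q: "2 \<le> q" "q \<le> m" and e: "e > 0"
    and f: "\<And>t. cmod t < e \<Longrightarrow> realizable_field q (\<lambda>x. \<Sum>s\<le>d. t ^ s *s w s x)" and s: "s \<le> d"
  shows "realizable_field q (w s)"
  using f s
proof (induction d arbitrary: w s)
  case 0
  then show ?case using "0.prems"(1)[of 0] e by simp
next
  case (Suc d)
  \<comment> \<open>The coefficients of 2^(d+1) f (t / 2) - f t; the one for s = d + 1 is
    zero.\<close>
  define w' where "w' s x = (2 ^ (Suc d - s) - 1) *s w s x" for s x
  have w': "realizable_field q (w' s)" if "s \<le> d" for s
  proof (rule Suc.IH[OF _ that])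
    fix t :: complex assume t: "cmod t < e"
    have "realizable_field q (\<lambda>x. 2 ^ Suc d *s (\<Sum>s\<le>Suc d. (t / 2) ^ s *s w s x) - (\<Sum>s\<le>Suc d. t ^ s *s w s x))"
      using t e by (intro realizable_field_diff realizable_field_cmul Suc.prems(1) q) (auto simp: norm_divide)
    moreover have "2 ^ Suc d *s (\<Sum>s\<le>Suc d. (t / 2) ^ s *s w s x) - (\<Sum>s\<le>Suc d. t ^ s *s w s x) = (\<Sum>s\<le>d. t ^ s *s w' s x)" for x
    proof -
      have "2 ^ Suc d *s (\<Sum>s\<le>Suc d. (t / 2) ^ s *s w s x) = (\<Sum>s\<le>Suc d. (t ^ s * 2 ^ (Suc d - s)) *s w s x)"
        unfolding vec.scale_sum_right
      proof (rule sum.cong)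
        fix s assume "s \<in> {..Suc d}"
        then have "(2::complex) ^ Suc d = 2 ^ s * 2 ^ (Suc d - s)" by (simp add: power_add[symmetric] del: power_Suc)
        then show "2 ^ Suc d *s ((t / 2) ^ s *s w s x) = (t ^ s * 2 ^ (Suc d - s)) *s w s x"
          by (simp add: vector_smult_assoc power_divide del: power_Suc)
      qed simp
      then have "2 ^ Suc d *s (\<Sum>s\<le>Suc d. (t / 2) ^ s *s w s x) - (\<Sum>s\<le>Suc d. t ^ s *s w s x)
          = (\<Sum>s\<le>Suc d. t ^ s *s w' s x)"
        by (simp only: sum_subtractf[symmetric]) (simp add: w'_def vector_smult_assoc algebra_simps vector_sub_rdistrib)
      then show ?thesis by (simp add: w'_def)
    qed
    ultimately show "realizable_field q (\<lambda>x. \<Sum>s\<le>d. t ^ s *s w' s x)" by simp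
  qed
  have low: "realizable_field q (w s)" if "s \<le> d" for s
  proof -
    have ne: "(2 ^ (Suc d - s) - 1 :: complex) \<noteq> 0"
    proof -
      have "Suc d - s = Suc (d - s)" using that by simp
      then have "(2::nat) ^ (Suc d - s) > 1" by (metis one_less_numeral_iff one_less_power semiring_norm(76) zero_less_Suc)
      then have "(2::nat) ^ (Suc d - s) \<noteq> 1" by linarith
      then have "of_nat (2 ^ (Suc d - s)) \<noteq> (of_nat 1 :: complex)" unfolding of_nat_eq_iff .
      then show ?thesis by simp
    qed
    have "w s = (\<lambda>x. inverse (2 ^ (Suc d - s) - 1) *s w' s x)"
      unfolding w'_def vector_smult_assoc left_inverse[OF ne] by simp
    then show ?thesis using realizable_field_cmul[OF w'[OF that]] by metis
  qed
  show ?case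
  proof (cases "s \<le> d")
    case False
    then have s: "s = Suc d" using Suc.prems by simp
    \<comment> \<open>With the lower coefficients already realizable, a single nonzero t isolates
      the top one.\<close>
    define t where "t = complex_of_real (e / 2)"
    have t: "cmod t < e" "t \<noteq> 0" using e by (auto simp: t_def)
    have "realizable_field q (\<lambda>x. inverse (t ^ Suc d) *s ((\<Sum>s\<le>Suc d. t ^ s *s w s x) - (\<Sum>s\<le>d. t ^ s *s w s x)))"
      using t by (intro realizable_field_cmul realizable_field_diff Suc.prems(1) realizable_field_sum low q) auto
    moreover have "inverse (t ^ Suc d) *s ((\<Sum>s\<le>Suc d. t ^ s *s w s x) - (\<Sum>s\<le>d. t ^ s *s w s x)) = w s x" for x
      using t by (simp add: s vector_smult_assoc del: power_Suc)
    ultimately show ?thesis by simp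
  qed (rule low)
qed

lemma realizable_field_shear:
  assumes r: "r \<noteq> l" and t: "cmod t < tau" and h: "entire h" and ind: "\<And>y c. h (y + c *s axis l 1) = h y"
    and q: "q \<ge> 1" and v: "vanish q 0 h"
  shows "realizable_field q (\<lambda>x. h (tilt t r x) *s (axis l 1 - t *s axis r 1))"
  unfolding realizable_field_def
proof (intro conjI allI)
  have "vanish (Suc 0) 0 (\<lambda>x. tilt t r x - 0)"
    using holomorphic_map_lipschitz_at[OF holomorphic_tilt, of 0 t r] by (simp add: lipschitz_at_def tilt_def)
  from vanish_smult[OF vanish_compose[OF v this] vanish_const]
  show "vanish q 0 (\<lambda>x. h (tilt t r x) *s (axis l 1 - t *s axis r 1))" by (simp only: add_0_right)
  fix c
  have h0: "h 0 = 0" using v q by (cases q) (auto dest: vanish_at)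
  have "realizable (\<lambda>x. x + (\<lambda>y. c * h y) (tilt t r (x - p)) *s (axis l 1 - t *s axis r 1))"
    by (rule realizable_shear[OF r t]) (auto intro: entire_mult h simp: ind h0)
  then have F: "realizable (\<lambda>x. x + c *s (h (tilt t r (x - p)) *s (axis l 1 - t *s axis r 1)))"
    by (simp only: vector_smult_assoc)
  show "\<exists>F. realizable F \<and> jet_eq q p F (\<lambda>x. x + c *s (h (tilt t r (x - p)) *s (axis l 1 - t *s axis r 1)))"
    by (rule exI, rule conjI, rule F, rule jet_eq_refl)
qed

lemma realizable_field_independent:
  assumes h: "entire h" and ind: "\<And>y c. h (y + c *s axis l 1) = h y"
    and q: "q \<ge> 1" and v: "vanish q 0 h"
  shows "realizable_field q (\<lambda>x. h x *s axis l 1)"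
  using realizable_field_shear[OF l[symmetric] _ h ind q v, of 0] tau_pos by (simp add: tilt_def)

lemma realizable_field_overshear:
  assumes vol: "\<not> vol" and r: "r \<noteq> l" and t: "cmod t < tau" and h: "entire h" and ind: "\<And>y c. h (y + c *s axis l 1) = h y"
    and q: "q \<ge> 1" and v: "vanish q 0 h"
  shows "realizable_field (Suc q) (\<lambda>x. (x $ l * h (tilt t r x)) *s (axis l 1 - t *s axis r 1))"
  unfolding realizable_field_def
proof (intro conjI allI)
  have lip: "vanish (Suc 0) 0 (\<lambda>x. tilt t r x - 0)"
    using holomorphic_map_lipschitz_at[OF holomorphic_tilt, of 0 t r] by (simp add: lipschitz_at_def tilt_def)
  have vl: "vanish (Suc 0) 0 (\<lambda>x::complex ^ 'n. x $ l)"
    using vanish_diff_self[of "0 :: complex ^ 'n"] unfolding vanish_vec_iff by simp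
  have vh: "vanish q 0 (\<lambda>x. h (tilt t r x))" by (rule vanish_compose[OF v lip])
  have "vanish (Suc 0 + q + 0) 0 (\<lambda>x. (x $ l * h (tilt t r x)) *s (axis l 1 - t *s axis r 1))"
    by (intro vanish_smult vanish_mult vl vh vanish_const)
  then show "vanish (Suc q) 0 (\<lambda>x. (x $ l * h (tilt t r x)) *s (axis l 1 - t *s axis r 1))" by simp
  fix c
  define F where "F x = x + ((exp ((\<lambda>y. c * h y) (tilt t r (x - p))) - 1) * (x - p) $ l) *s (axis l 1 - t *s axis r 1)" for x
  have rF: "realizable F" unfolding F_def
    by (rule realizable_overshear[OF vol r t]) (auto intro: entire_mult h simp: ind)
  \<comment> \<open>Beyond its linear term the exponential contributes order 2 q; coordinate l
    raises this to 2 q + 1, at least q + 2.\<close>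
  have "vanish (q + q + Suc 0 + 0) 0 (\<lambda>x. ((exp (c * h (tilt t r x)) - 1 - c * h (tilt t r x)) * x $ l) *s (axis l 1 - t *s axis r 1))"
    by (intro vanish_smult vanish_mult vl exp_taylor_vanish vanish_cmul vh vanish_const)
  then have van: "vanish (Suc (Suc q)) 0 (\<lambda>x. ((exp (c * h (tilt t r x)) - 1 - c * h (tilt t r x)) * x $ l) *s (axis l 1 - t *s axis r 1))"
    by (rule vanish_mono) (use q in simp)
  have eq: "(x + (a * b) *s w) - (x + d *s ((b * g) *s w)) = ((a - d * g) * b) *s w"
    for a b d g :: complex and x w :: "complex ^ 'n"
    by (simp add: vec_eq_iff algebra_simps)
  from vanish_at_p[OF van]
  have "jet_eq (Suc q) p F (\<lambda>x. x + c *s (((x - p) $ l * h (tilt t r (x - p))) *s (axis l 1 - t *s axis r 1)))"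
    unfolding jet_eq_def F_def eq .
  then show "\<exists>F. realizable F \<and> jet_eq (Suc q) p F (\<lambda>x. x + c *s (((x - p) $ l * h (tilt t r (x - p))) *s (axis l 1 - t *s axis r 1)))"
    using rF by blast
qed

section \<open>Monomial fields and the span of the tilted shears\<close>

text \<open>The exponents of x_r and x_l are separate arguments because a tilt trades one for the
  other, while \<beta> fixes those of the remaining coordinates.\<close>

definition M :: "'n \<Rightarrow> ('n \<Rightarrow> nat) \<Rightarrow> nat \<Rightarrow> nat \<Rightarrow> complex ^ 'n \<Rightarrow> complex" where
  "M r \<beta> a b x = x $ r ^ a * x $ l ^ b * (\<Prod>i\<in>UNIV - {r} - {l}. x $ i ^ \<beta> i)"

definition rest :: "'n \<Rightarrow> ('n \<Rightarrow> nat) \<Rightarrow> nat" where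
  "rest r \<beta> = (\<Sum>i\<in>UNIV - {r} - {l}. \<beta> i)"

lemma sum_rest: "r \<noteq> l \<Longrightarrow> (\<Sum>i\<in>UNIV. \<alpha> i) = \<alpha> r + \<alpha> l + rest r \<alpha>"
  by (simp add: rest_def sum.remove[of UNIV r] sum.remove[of "UNIV - {r}" l])

lemma prod_M: "r \<noteq> l \<Longrightarrow> (\<Prod>i\<in>UNIV. x $ i ^ \<alpha> i) = M r \<alpha> (\<alpha> r) (\<alpha> l) x"
  by (simp add: M_def prod.remove[of UNIV r] prod.remove[of "UNIV - {r}" l] mult.assoc)

lemma hpoly_M:
  assumes r: "r \<noteq> l" shows "hpoly (a + b + rest r \<beta>) (\<lambda>x. c * M r \<beta> a b x)"
proof -
  define \<alpha> where "\<alpha> = \<beta>(r := a, l := b)"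
  have "rest r \<alpha> = rest r \<beta>" unfolding rest_def by (rule sum.cong) (auto simp: \<alpha>_def)
  then have s: "(\<Sum>i\<in>UNIV. \<alpha> i) = a + b + rest r \<beta>"
    using r by (simp add: sum_rest[OF r]) (simp add: \<alpha>_def)
  have "M r \<alpha> a b x = M r \<beta> a b x" for x
  proof -
    have "(\<Prod>i\<in>UNIV - {r} - {l}. x $ i ^ \<alpha> i) = (\<Prod>i\<in>UNIV - {r} - {l}. x $ i ^ \<beta> i)"
      by (rule prod.cong) (auto simp: \<alpha>_def)
    then show ?thesis by (simp add: M_def)
  qed
  moreover have "\<alpha> r = a" "\<alpha> l = b" using r by (auto simp: \<alpha>_def)
  ultimately have "(\<Prod>i\<in>UNIV. x $ i ^ \<alpha> i) = M r \<beta> a b x" for x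
    using prod_M[OF r, of x \<alpha>] by simp
  then show ?thesis using hpoly.mono[OF s, of c] by simp
qed

lemma M_indep:
  assumes r: "r \<noteq> l" shows "M r \<beta> a 0 (y + c *s axis l 1) = M r \<beta> a 0 y"
proof -
  have "(\<Prod>i\<in>UNIV - {r} - {l}. (y + c *s axis l 1) $ i ^ \<beta> i) = (\<Prod>i\<in>UNIV - {r} - {l}. y $ i ^ \<beta> i)"
    by (rule prod.cong) (auto simp: axis_def)
  then show ?thesis using r by (simp add: M_def axis_def)
qed

lemma M_tilt:
  assumes r: "r \<noteq> l"
  shows "M r \<beta> a 0 (tilt t r x) = (\<Sum>s\<le>a. t ^ s * (of_nat (a choose s) * M r \<beta> (a - s) s x))"
proof -
  have p: "(\<Prod>i\<in>UNIV - {r} - {l}. tilt t r x $ i ^ \<beta> i) = (\<Prod>i\<in>UNIV - {r} - {l}. x $ i ^ \<beta> i)"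
    by (rule prod.cong) (auto simp: axis_def tilt_def)
  have "M r \<beta> a 0 (tilt t r x) = (t * x $ l + x $ r) ^ a * (\<Prod>i\<in>UNIV - {r} - {l}. x $ i ^ \<beta> i)"
    unfolding M_def p by (simp add: tilt_def axis_def add.commute)
  also have "\<dots> = (\<Sum>s\<le>a. t ^ s * (of_nat (a choose s) * M r \<beta> (a - s) s x))"
    unfolding binomial_ring sum_distrib_right
    by (rule sum.cong) (auto simp: M_def power_mult_distrib mult_ac)
  finally show ?thesis .
qed

text \<open>The coefficient of \<open>t ^ s\<close> in the tilted shear field, see \<open>W_expand\<close>.\<close>

definition W :: "'n \<Rightarrow> ('n \<Rightarrow> nat) \<Rightarrow> nat \<Rightarrow> nat \<Rightarrow> complex ^ 'n \<Rightarrow> complex ^ 'n" where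
  "W r \<beta> a s x = (of_nat (a choose s) * M r \<beta> (a - s) s x) *s axis l 1 -
     (case s of 0 \<Rightarrow> 0 | Suc s' \<Rightarrow> of_nat (a choose s') * M r \<beta> (a - s') s' x) *s axis r 1"

text \<open>Expand (x_r + t x_l)^a. The part - t e_r of the direction shifts the index by one,
  whence the degree a + 1 in t and the case distinction in \<open>W\<close>.\<close>

lemma W_expand:
  assumes r: "r \<noteq> l"
  shows "M r \<beta> a 0 (tilt t r x) *s (axis l 1 - t *s axis r 1) = (\<Sum>s\<le>Suc a. t ^ s *s W r \<beta> a s x)"
proof -
  define S where "S = (\<Sum>s\<le>a. t ^ s * (of_nat (a choose s) * M r \<beta> (a - s) s x))"
  define D where "D s = (case s of 0 \<Rightarrow> 0 | Suc s' \<Rightarrow> of_nat (a choose s') * M r \<beta> (a - s') s' x)" for s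
  have 1: "(\<Sum>s\<le>Suc a. t ^ s * (of_nat (a choose s) * M r \<beta> (a - s) s x)) = S"
    by (simp add: S_def)
  have 2: "(\<Sum>s\<le>Suc a. t ^ s * D s) = t * S"
    by (simp add: sum.atMost_Suc_shift D_def S_def sum_distrib_left mult_ac del: sum.atMost_Suc)
  have "(\<Sum>s\<le>Suc a. t ^ s *s W r \<beta> a s x) =
      (\<Sum>s\<le>Suc a. t ^ s * (of_nat (a choose s) * M r \<beta> (a - s) s x)) *s axis l 1 - (\<Sum>s\<le>Suc a. t ^ s * D s) *s axis r 1"
    unfolding W_def D_def[symmetric] vec.scale_sum_left sum_subtractf[symmetric]
    by (rule sum.cong) (auto simp: vec_eq_iff algebra_simps)
  also have "\<dots> = S *s (axis l 1 - t *s axis r 1)"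
    unfolding 1 2 by (simp add: vec_eq_iff algebra_simps)
  finally show ?thesis unfolding M_tilt[OF r] S_def ..
qed

lemma realizable_field_W:
  assumes r: "r \<noteq> l" and q: "2 \<le> a + rest r \<beta>" "a + rest r \<beta> \<le> m" and s: "s \<le> Suc a"
  shows "realizable_field (a + rest r \<beta>) (W r \<beta> a s)"
proof (rule realizable_field_coeff[OF q tau_pos _ s])
  fix t assume t: "cmod t < tau"
  have h: "hpoly (a + rest r \<beta>) (M r \<beta> a 0)" using hpoly_M[OF r, of a 0 \<beta> 1] by simp
  have "realizable_field (a + rest r \<beta>) (\<lambda>x. M r \<beta> a 0 (tilt t r x) *s (axis l 1 - t *s axis r 1))"
    by (rule realizable_field_shear[OF r t hpoly_entire[OF h] M_indep[OF r] _ hpoly_vanish[OF h]]) (use q in simp)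
  then show "realizable_field (a + rest r \<beta>) (\<lambda>x. \<Sum>s\<le>Suc a. t ^ s *s W r \<beta> a s x)"
    unfolding W_expand[OF r] .
qed

lemma realizable_field_W_overshear:
  assumes vol: "\<not> vol" and r: "r \<noteq> l" and q: "1 \<le> a + rest r \<beta>" "Suc (a + rest r \<beta>) \<le> m" and s: "s \<le> Suc a"
  shows "realizable_field (Suc (a + rest r \<beta>)) (\<lambda>x. x $ l *s W r \<beta> a s x)"
proof (rule realizable_field_coeff[OF _ q(2) tau_pos _ s, where w = "\<lambda>s x. x $ l *s W r \<beta> a s x"])
  show "2 \<le> Suc (a + rest r \<beta>)" using q by simp
  fix t assume t: "cmod t < tau"
  have h: "hpoly (a + rest r \<beta>) (M r \<beta> a 0)" using hpoly_M[OF r, of a 0 \<beta> 1] by simp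
  have "realizable_field (Suc (a + rest r \<beta>)) (\<lambda>x. (x $ l * M r \<beta> a 0 (tilt t r x)) *s (axis l 1 - t *s axis r 1))"
    by (rule realizable_field_overshear[OF vol r t hpoly_entire[OF h] M_indep[OF r] q(1) hpoly_vanish[OF h]])
  moreover have "(x $ l * M r \<beta> a 0 (tilt t r x)) *s (axis l 1 - t *s axis r 1) = (\<Sum>s\<le>Suc a. t ^ s *s (x $ l *s W r \<beta> a s x))" for x
  proof -
    have "(x $ l * M r \<beta> a 0 (tilt t r x)) *s (axis l 1 - t *s axis r 1) = x $ l *s (\<Sum>s\<le>Suc a. t ^ s *s W r \<beta> a s x)"
      unfolding W_expand[OF r, symmetric] by (simp only: vector_smult_assoc)
    also have "\<dots> = (\<Sum>s\<le>Suc a. t ^ s *s (x $ l *s W r \<beta> a s x))"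
      unfolding vec.scale_sum_right by (rule sum.cong) (simp_all only: vector_smult_assoc mult.commute)
    finally show ?thesis .
  qed
  ultimately show "realizable_field (Suc (a + rest r \<beta>)) (\<lambda>x. \<Sum>s\<le>Suc a. t ^ s *s (x $ l *s W r \<beta> a s x))" by simp
qed

text \<open>In \<open>W\<close> with index Suc (\<alpha> l) the component along e_r is a nonzero
  multiple of the given monomial. Modulo realizable fields, a component along e_r is thus exchanged
  for one along e_l.\<close>

lemma realizable_field_transfer:
  fixes f :: "complex ^ 'n \<Rightarrow> complex"
  assumes f: "hpoly q f" and r: "r \<noteq> l" and q: "2 \<le> q" "q \<le> m"
  shows "\<exists>Y. hpoly q Y \<and> realizable_field q (\<lambda>x. f x *s axis r 1 - Y x *s axis l 1)"
  using f q
proof induction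
  case (zero s)
  show ?case by (rule exI[of _ "\<lambda>x. 0"]) (simp add: hpoly.zero realizable_field_zero)
next
  case (mono \<alpha> q c)
  define a where "a = \<alpha> r + \<alpha> l"
  define C where "C = (of_nat (a choose \<alpha> l) :: complex)"
  define Y where "Y x = (c / C * of_nat (a choose Suc (\<alpha> l))) * M r \<alpha> (a - Suc (\<alpha> l)) (Suc (\<alpha> l)) x" for x
  have C: "C \<noteq> 0" by (simp add: C_def a_def)
  have CC: "of_nat (\<alpha> l + \<alpha> r choose \<alpha> l) = C" by (simp add: C_def a_def add.commute)
  have qa: "q = a + rest r \<alpha>" using sum_rest[OF r, of \<alpha>] mono by (simp add: a_def)
  have "hpoly q Y"
  \<comment> \<open>Without a factor x_r the binomial coefficient in Y is 0; otherwise the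
    subtraction in the exponent of x_r is exact.\<close>
  proof (cases "\<alpha> r = 0")
    case True
    then show ?thesis by (simp add: Y_def[abs_def] a_def hpoly.zero binomial_eq_0)
  next
    case False
    then have "q = (a - Suc (\<alpha> l)) + Suc (\<alpha> l) + rest r \<alpha>" by (simp add: qa a_def)
    then show ?thesis unfolding Y_def[abs_def] using hpoly_M[OF r] by metis
  qed
  moreover have "realizable_field q (\<lambda>x. (- (c / C)) *s W r \<alpha> a (Suc (\<alpha> l)) x)"
    unfolding qa by (intro realizable_field_cmul realizable_field_W r) (use mono.prems in \<open>auto simp: qa a_def\<close>)
  moreover have "(- (c / C)) *s W r \<alpha> a (Suc (\<alpha> l)) x = (c * (\<Prod>i\<in>UNIV. x $ i ^ \<alpha> i)) *s axis r 1 - Y x *s axis l 1" for x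
    using C unfolding W_def Y_def prod_M[OF r]
    by (simp add: a_def CC vec_eq_iff algebra_simps)
  ultimately show ?case by auto
next
  case (add q f g)
  then obtain Y Z where Y: "hpoly q Y" "realizable_field q (\<lambda>x. f x *s axis r 1 - Y x *s axis l 1)"
    and Z: "hpoly q Z" "realizable_field q (\<lambda>x. g x *s axis r 1 - Z x *s axis l 1)" by blast
  have "realizable_field q (\<lambda>x. (f x *s axis r 1 - Y x *s axis l 1) + (g x *s axis r 1 - Z x *s axis l 1))"
    by (intro realizable_field_add Y Z add.prems)
  then have "realizable_field q (\<lambda>x. (f x + g x) *s axis r 1 - (Y x + Z x) *s axis l 1)"
    by (simp add: vector_sadd_rdistrib algebra_simps)
  then show ?case using hpoly.add[OF Y(1) Z(1)] by blast
qed

lemma realizable_field_reduce: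
  assumes X: "\<And>i. hpoly q (\<lambda>x. X x $ i)" and q: "2 \<le> q" "q \<le> m"
  shows "\<exists>Z. hpoly q Z \<and> realizable_field q (\<lambda>x. X x - Z x *s axis l 1)"
proof -
  have "\<forall>r\<in>UNIV - {l}. \<exists>Y. hpoly q Y \<and> realizable_field q (\<lambda>x. X x $ r *s axis r 1 - Y x *s axis l 1)"
  proof
    fix r assume "r \<in> UNIV - {l}"
    then show "\<exists>Y. hpoly q Y \<and> realizable_field q (\<lambda>x. X x $ r *s axis r 1 - Y x *s axis l 1)"
      by (intro realizable_field_transfer[OF X _ q]) simp
  qed
  from bchoice[OF this] obtain Y where
    "\<forall>r\<in>UNIV - {l}. hpoly q (Y r) \<and> realizable_field q (\<lambda>x. X x $ r *s axis r 1 - Y r x *s axis l 1)" ..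
  then have Y: "\<And>r. r \<noteq> l \<Longrightarrow> hpoly q (Y r)"
    "\<And>r. r \<noteq> l \<Longrightarrow> realizable_field q (\<lambda>x. X x $ r *s axis r 1 - Y r x *s axis l 1)" by auto
  define Z where "Z x = X x $ l + (\<Sum>r\<in>UNIV - {l}. Y r x)" for x
  have "hpoly q Z" unfolding Z_def[abs_def] by (intro hpoly.add X hpoly_sum Y) auto
  moreover have "realizable_field q (\<lambda>x. \<Sum>r\<in>UNIV - {l}. X x $ r *s axis r 1 - Y r x *s axis l 1)"
    by (intro realizable_field_sum Y q) auto
  moreover have "(\<Sum>r\<in>UNIV - {l}. X x $ r *s axis r 1 - Y r x *s axis l 1) = X x - Z x *s axis l 1" for x
  proof -
    have "X x = (\<Sum>r\<in>UNIV. X x $ r *s axis r 1)" by (rule basis_expansion[symmetric])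
    also have "\<dots> = X x $ l *s axis l 1 + (\<Sum>r\<in>UNIV - {l}. X x $ r *s axis r 1)" by (simp add: sum.remove)
    finally have e: "(\<Sum>r\<in>UNIV - {l}. X x $ r *s axis r 1) = X x - X x $ l *s axis l 1" by (simp add: algebra_simps)
    show ?thesis unfolding sum_subtractf e Z_def vec.scale_sum_left[symmetric]
      by (simp add: vector_sadd_rdistrib)
  qed
  ultimately show ?thesis by auto
qed

text \<open>A monomial free of x_l belongs to a plain shear. With x_l^(s+1), the overshear field
  \<open>x $ l *s W i0 \<alpha> a s x\<close> and the shear field
  \<open>W i0 \<alpha> (Suc a) (Suc s)\<close> involve the same two monomials, one along e_l and one
  along e_i0. Eliminating the latter leaves the desired field.\<close>

lemma realizable_field_l_of_not_vol:
  fixes f :: "complex ^ 'n \<Rightarrow> complex"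
  assumes vol: "\<not> vol" and f: "hpoly q f" and q: "2 \<le> q" "q \<le> m"
  shows "realizable_field q (\<lambda>x. f x *s axis l 1)"
  using f q
proof induction
  case (zero s)
  then show ?case using realizable_field_zero by simp
next
  case (mono \<alpha> q c)
  note r = l[symmetric]
  have "realizable_field q (\<lambda>x. M i0 \<alpha> (\<alpha> i0) (\<alpha> l) x *s axis l 1)"
  proof (cases "\<alpha> l")
    case 0
    have "hpoly (\<alpha> i0 + 0 + rest i0 \<alpha>) (\<lambda>x. 1 * M i0 \<alpha> (\<alpha> i0) 0 x)" by (rule hpoly_M[OF r])
    moreover have "q = \<alpha> i0 + 0 + rest i0 \<alpha>" using sum_rest[OF r, of \<alpha>] mono 0 by simp
    ultimately have h: "hpoly q (M i0 \<alpha> (\<alpha> i0) 0)" by simp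
    show ?thesis unfolding 0
      by (rule realizable_field_independent[OF hpoly_entire[OF h] M_indep[OF r] _ hpoly_vanish[OF h]]) (use mono in auto)
  next
    case (Suc s)
    define a where "a = \<alpha> i0 + s"
    have qa: "q = Suc (a + rest i0 \<alpha>)" using sum_rest[OF r, of \<alpha>] mono Suc by (simp add: a_def)
    have xM: "x $ l * M i0 \<alpha> b d x = M i0 \<alpha> b (Suc d) x" for b d x by (simp add: M_def)
    have O: "realizable_field q (\<lambda>x. x $ l *s W i0 \<alpha> a s x)"
      unfolding qa by (rule realizable_field_W_overshear[OF vol r]) (use mono.prems in \<open>auto simp: qa a_def\<close>)
    have W2: "realizable_field q (W i0 \<alpha> (Suc a) (Suc s))"
    proof -
      have "realizable_field (Suc a + rest i0 \<alpha>) (W i0 \<alpha> (Suc a) (Suc s))"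
        by (rule realizable_field_W[OF r]) (use mono.prems in \<open>auto simp: qa a_def\<close>)
      then show ?thesis by (simp add: qa)
    qed
    show ?thesis
    proof (cases s)
      \<comment> \<open>For s = 0 the overshear field has no component along e_i0, and nothing is to
        be eliminated.\<close>
      case 0
      have "x $ l *s W i0 \<alpha> a s x = M i0 \<alpha> (\<alpha> i0) (\<alpha> l) x *s axis l 1" for x
        using Suc by (simp add: W_def 0 a_def xM vector_smult_assoc)
      with O show ?thesis by simp
    next
      case (Suc s')
      \<comment> \<open>The determinant of the elimination, nonzero by
        \<open>binomial_cross\<close>.\<close>
      define D where "D = (of_nat (a choose s) * of_nat (Suc a choose s) - of_nat (a choose s') * of_nat (Suc a choose Suc s) :: complex)"
      have "(a choose (s - 1)) * (Suc a choose Suc s) < (a choose s) * (Suc a choose s)"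
        by (rule binomial_cross) (auto simp: a_def Suc)
      then have "(a choose s) * (Suc a choose s) \<noteq> (a choose s') * (Suc a choose Suc s)" by (simp add: Suc)
      then have D: "D \<noteq> 0" unfolding D_def of_nat_mult[symmetric] right_minus_eq of_nat_eq_iff .
      have sa: "a - s' = Suc a - s" by (simp add: Suc a_def)
      have sb: "a - s = \<alpha> i0" "Suc a - Suc s = \<alpha> i0" by (simp_all add: a_def)
      have 1: "x $ l *s W i0 \<alpha> a s x = (of_nat (a choose s) * M i0 \<alpha> (\<alpha> i0) (Suc s) x) *s axis l 1
          - (of_nat (a choose s') * M i0 \<alpha> (Suc a - s) s x) *s axis i0 1" for x
      proof -
        have "x $ l *s W i0 \<alpha> a s x = (of_nat (a choose s) * (x $ l * M i0 \<alpha> (a - s) s x)) *s axis l 1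
          - (of_nat (a choose s') * (x $ l * M i0 \<alpha> (a - s') s' x)) *s axis i0 1"
          by (simp add: W_def Suc vec_eq_iff algebra_simps)
        then show ?thesis unfolding xM sa sb Suc[symmetric] .
      qed
      have 2: "W i0 \<alpha> (Suc a) (Suc s) x = (of_nat (Suc a choose Suc s) * M i0 \<alpha> (\<alpha> i0) (Suc s) x) *s axis l 1
          - (of_nat (Suc a choose s) * M i0 \<alpha> (Suc a - s) s x) *s axis i0 1" for x
        unfolding W_def nat.case sb ..
      have V: "realizable_field q (\<lambda>x. inverse D *s (of_nat (Suc a choose s) *s (x $ l *s W i0 \<alpha> a s x) - of_nat (a choose s') *s W i0 \<alpha> (Suc a) (Suc s) x))"
        by (intro realizable_field_cmul realizable_field_diff O W2 mono.prems)
      have e: "of_nat (Suc a choose s) *s (x $ l *s W i0 \<alpha> a s x) - of_nat (a choose s') *s W i0 \<alpha> (Suc a) (Suc s) x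
          = (D * M i0 \<alpha> (\<alpha> i0) (Suc s) x) *s axis l 1" for x
        unfolding 1 2 D_def
        unfolding vec_eq_iff vector_minus_component vector_smult_component by (intro allI) (simp only: algebra_simps)
      have "\<alpha> l = Suc s" by fact
      then show ?thesis
        using V[unfolded e, unfolded vector_smult_assoc mult.assoc[symmetric] left_inverse[OF D]] by simp
    qed
  qed
  from realizable_field_cmul[OF this, of c] show ?case unfolding prod_M[OF r] by (simp add: vector_smult_assoc)
next
  case (add q f g)
  then have "realizable_field q (\<lambda>x. f x *s axis l 1 + g x *s axis l 1)" by (intro realizable_field_add) auto
  then show ?case by (simp add: vector_sadd_rdistrib)
qed

text \<open>A realizing automorphism has Jacobian determinant 1, so \<open>divergence_zero\<close>
  applies to its leading term.\<close>

lemma realizable_field_divergence: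
  assumes vol: vol and X: "\<And>i. hpoly q (\<lambda>x. X x $ i)" and V: "realizable_field q X" and q: "2 \<le> q" "q \<le> m"
  shows "(\<Sum>i\<in>UNIV. jac X y $ i $ i) = 0"
proof -
  obtain F where F: "realizable F" "jet_eq q p F (\<lambda>x. x + 1 *s X (x - p))" using V unfolding realizable_field_def by blast
  obtain S where S: "S \<in> Gr vol" "jet_eq m p S F" "S p = p" using realizable_map[OF F(1)] .
  have j: "jet_eq q p S (\<lambda>x. x + X (x - p))"
    using jet_eq_trans[OF jet_eq_mono[OF S(2) q(2)] F(2)] by simp
  obtain q' where q': "q = Suc q'" "q' \<ge> 1" using q by (cases q) auto
  have "jacobian_det S x = 1" for x using S(1) vol by (simp add: Gr_jac)
  then show ?thesis
    using j X q'(2) by (intro divergence_zero[where R = S and q = q' and p = p])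
      (auto simp: q' holomorphic_map_iff intro: hpoly_entire hpoly_homogeneous Gr_holo[OF S(1), unfolded holomorphic_map_iff, rule_format])
qed

text \<open>The reduction leaves a field Z e_l. In the volume preserving case both X and the removed
  part are divergence free, so Z does not depend on x_l and Z e_l comes from a shear. Otherwise
  overshears take care of it.\<close>

lemma realizable_field_homogeneous:
  assumes X: "holomorphic_map X" and h: "\<And>i. homogeneous q (\<lambda>x. X x $ i)" and q: "2 \<le> q" "q \<le> m"
    and div: "\<And>y. vol \<Longrightarrow> (\<Sum>i\<in>UNIV. jac X y $ i $ i) = 0"
  shows "realizable_field q X"
proof -
  have hX: "hpoly q (\<lambda>x. X x $ i)" for i
    by (rule homogeneous_hpoly[OF holomorphic_map_entire[OF X] h])
  obtain Z where Z: "hpoly q Z" "realizable_field q (\<lambda>x. X x - Z x *s axis l 1)"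
    using realizable_field_reduce[OF hX q] by blast
  have ZZ: "realizable_field q (\<lambda>x. Z x *s axis l 1)"
  proof (cases vol)
    case True
    have eZ: "entire Z" by (rule hpoly_entire[OF Z(1)])
    have V: "holomorphic_map (\<lambda>x. Z x *s axis l 1 :: complex ^ 'n)" by (intro holomorphic_map_smult eZ) simp
    have W: "holomorphic_map (\<lambda>x. X x - Z x *s axis l 1)" by (intro holomorphic_map_diff X V)
    have hW: "hpoly q (\<lambda>x. (X x - Z x *s axis l 1) $ i)" for i
      using hpoly.add[OF hX[of i] hpoly_cmul[OF Z(1), of "- axis l 1 $ i"]] by (simp add: mult.commute)
    have "jac X y = jac (\<lambda>x. X x - Z x *s axis l 1) y + jac (\<lambda>x. Z x *s axis l 1) y" for y
      using jac_add[OF W V, of y] by simp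
    then have d0: "(\<Sum>i\<in>UNIV. jac (\<lambda>x. Z x *s axis l 1 :: complex ^ 'n) y $ i $ i) = 0" for y
      using div[OF True, of y] realizable_field_divergence[OF True hW Z(2) q, of y] by (simp add: sum.distrib)
    have c: "(\<lambda>z. (Z z *s axis l 1 :: complex ^ 'n) $ i) = (if i = l then Z else (\<lambda>_. 0))" for i
      by (auto simp: axis_def fun_eq_iff)
    have "jac (\<lambda>x. Z x *s axis l 1 :: complex ^ 'n) y $ i $ i = (if i = l then taylor_term Z y 1 (axis l 1) else 0)" for y i
      using partial_deriv_taylor_term[OF holomorphic_map_entire[OF V], of i i y] unfolding c by (simp add: jac_def taylor_term_def)
    with d0 have "taylor_term Z y 1 (axis l 1) = 0" for y by simp
    then have "Z (y + c *s axis l 1) = Z y" for y c by (rule entire_independent[OF eZ])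
    then show ?thesis by (intro realizable_field_independent eZ hpoly_vanish Z) (use q in auto)
  next
    case False
    then show ?thesis by (rule realizable_field_l_of_not_vol[OF _ Z(1) q])
  qed
  from realizable_field_add[OF Z(2) ZZ q] show ?thesis by simp
qed

end

subsection \<open>Generation of the linear group by transvections\<close>

definition rowadd :: "'n \<Rightarrow> 'n \<Rightarrow> 'a::field \<Rightarrow> 'a ^ 'm ^ 'n \<Rightarrow> 'a ^ 'm ^ 'n::finite" where
  "rowadd i j c A = (\<chi> a. if a = i then A $ i + c *s A $ j else A $ a)"

definition diag1 :: "'n::finite \<Rightarrow> 'a::field \<Rightarrow> 'a ^ 'n ^ 'n" where
  "diag1 l d = (\<chi> i j. if i = j then if i = l then d else 1 else 0)"

lemma rowadd_mult:
  fixes A :: "'a::field ^ 'm ^ 'n::finite"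
  shows "rowadd i j c A = rowadd i j c (mat 1) ** A"
proof -
  have "(\<Sum>b\<in>UNIV. (rowadd i j c (mat 1) :: 'a ^ 'n ^ 'n) $ a $ b * A $ b $ e) = rowadd i j c A $ a $ e" for a e
  proof -
    have "(rowadd i j c (mat 1) :: 'a ^ 'n ^ 'n) $ a $ b * A $ b $ e
        = (if b = a then A $ b $ e else 0) + (if b = j then (if a = i then c * A $ b $ e else 0) else 0)" for b
      by (auto simp: rowadd_def mat_def distrib_right)
    then show ?thesis by (simp add: sum.distrib rowadd_def)
  qed
  then show ?thesis by (simp add: matrix_matrix_mult_def vec_eq_iff)
qed

lemma det_rowadd: "i \<noteq> j \<Longrightarrow> det (rowadd i j c A) = det A"
  using det_row_operation[of i j A c] by (simp add: rowadd_def row_def cong: if_cong)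

text \<open>Gaussian elimination, one column after the other; column \<open>l\<close> comes last and keeps the determinant.\<close>

lemma transvections_generate:
  fixes Q :: "'a::field ^ 'n::finite ^ 'n \<Rightarrow> bool" and l :: 'n
  assumes one: "Q (mat 1)" and mult: "\<And>A B. Q A \<Longrightarrow> Q B \<Longrightarrow> Q (A ** B)"
    and transvection: "\<And>i j c. i \<noteq> j \<Longrightarrow> Q (rowadd i j c (mat 1))" and A: "det A \<noteq> 0"
  shows "\<exists>E. Q E \<and> A = E ** diag1 l (det A)"
proof -
  define rel where "rel A B \<longleftrightarrow> det A = det B \<and> (\<exists>E. Q E \<and> A = E ** B)" for A B
  have rel_refl: "rel A A" for A unfolding rel_def by (metis one matrix_mul_lid)
  have rel_trans: "rel A C" if "rel A B" "rel B C" for A B C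
    using that mult unfolding rel_def by (metis matrix_mul_assoc)
  have rel_row: "rel A (rowadd i j c A)" if "i \<noteq> j" for A i j c
  proof -
    have "A = rowadd i j (- c) (rowadd i j c A)" using that by (auto simp: rowadd_def vec_eq_iff)
    then have "A = rowadd i j (- c) (mat 1) ** rowadd i j c A" using rowadd_mult by metis
    then show ?thesis unfolding rel_def using transvection[OF that] det_rowadd[OF that] by metis
  qed
  have rel_rows: "rel A (\<chi> a. if a \<in> I then A $ a - f a *s A $ j else A $ a)" if "finite I" "j \<notin> I" for A I j f
    using that
  proof (induction I rule: finite_induct)
    case empty
    then show ?case using rel_refl[of A] by simp
  next
    case (insert i I)
    define B where "B = (\<chi> a. if a \<in> I then A $ a - f a *s A $ j else A $ a)"
    have "(\<chi> a. if a \<in> insert i I then A $ a - f a *s A $ j else A $ a) = rowadd i j (- f i) B"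
      using insert by (auto simp: B_def rowadd_def vec_eq_iff)
    moreover have "rel A B" using insert by (simp add: B_def)
    moreover have "rel B (rowadd i j (- f i) B)" using insert by (intro rel_row) auto
    ultimately show ?case using rel_trans by metis
  qed
  have cols: "\<exists>B. rel A B \<and> (\<forall>k\<in>K. \<forall>i. B $ i $ k = (if i = k then 1 else 0))" if "finite K" "l \<notin> K" for K
    using that
  proof (induction K rule: finite_induct)
    case empty
    then show ?case using rel_refl by auto
  next
    case (insert k K)
    then obtain B where B: "rel A B" "\<And>k i. k \<in> K \<Longrightarrow> B $ i $ k = (if i = k then 1 else 0)" by auto
    have kl: "k \<noteq> l" "l \<notin> K" using insert by auto
    have dB: "det B \<noteq> 0" using B(1) A by (simp add: rel_def)
    have "\<exists>i. i \<notin> K \<and> B $ i $ k \<noteq> 0"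
    proof (rule ccontr)
      assume "\<not> ?thesis"
      then have z: "\<And>i. i \<notin> K \<Longrightarrow> B $ i $ k = 0" by blast
      \<comment> \<open>If column k had no pivot outside K, it would be a combination of the unit
        columns of K; x is the resulting kernel vector.\<close>
      define x where "x = (\<chi> i. if i = k then 1 else if i \<in> K then - B $ i $ k else (0 :: 'a))"
      have "(B *v x) $ i = 0" for i
      proof -
        have "(B *v x) $ i = (\<Sum>j\<in>UNIV. (if j = k then B $ i $ k else 0) + (if j = i then (if i \<in> K then - B $ i $ k else 0) else 0))"
          unfolding matrix_vector_mult_def vec_lambda_beta
          by (rule sum.cong) (use B(2) insert in \<open>auto simp: x_def\<close>)
        also have "\<dots> = 0" using z[of i] by (auto simp: sum.distrib)
        finally show ?thesis .
      qed
      then have Bx: "B *v x = 0" by (simp add: vec_eq_iff)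
      obtain C where "C ** B = mat 1" using dB invertible_det_nz[of B] by (auto simp: invertible_def)
      then have "x = C *v (B *v x)" by (simp add: matrix_vector_mul_assoc)
      then have "x $ k = 0" using Bx by simp
      then show False by (simp add: x_def)
    qed
    then obtain i where i: "i \<notin> K" "B $ i $ k \<noteq> 0" by blast
    \<comment> \<open>Rows cannot be scaled, so the diagonal entry is made 1 by adding a multiple of
      another row; hence the pivot row must differ from k. If the pivot found is in row k and row l
      offers none, row k is first added to row l.\<close>
    obtain B' i' where B': "rel B B'" "\<And>k i. k \<in> K \<Longrightarrow> B' $ i $ k = (if i = k then 1 else 0)"
      "i' \<notin> K" "i' \<noteq> k" "B' $ i' $ k \<noteq> 0"
    proof (cases "i = k")
      case False
      then show ?thesis using that[of B i] rel_refl B(2) i by blast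
    next
      case True
      show ?thesis
      proof (cases "B $ l $ k = 0")
        case False
        then show ?thesis using that[of B l] rel_refl B(2) kl by blast
      next
        case 0: True
        show ?thesis
        proof (rule that[of "rowadd l k 1 B" l])
          show "rel B (rowadd l k 1 B)" by (rule rel_row) (use kl in auto)
          show "rowadd l k 1 B $ i $ k' = (if i = k' then 1 else 0)" if "k' \<in> K" for i k'
            using that B(2) insert kl by (auto simp: rowadd_def)
        qed (use kl i True 0 in \<open>auto simp: rowadd_def\<close>)
      qed
    qed
    define c where "c = (1 - B' $ k $ k) / B' $ i' $ k"
    define C where "C = rowadd k i' c B'"
    have C: "rel B' C" unfolding C_def by (rule rel_row) (use B' in auto)
    have CK: "C $ i $ k' = (if i = k' then 1 else 0)" if "k' \<in> K" for i k'
      using that B'(2,3) insert by (auto simp: C_def rowadd_def)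
    have Ckk: "C $ k $ k = 1" using B'(5) by (simp add: C_def rowadd_def c_def)
    define D where "D = (\<chi> a. if a \<in> UNIV - {k} then C $ a - (C $ a $ k) *s C $ k else C $ a)"
    have D: "rel C D" unfolding D_def by (rule rel_rows) auto
    have "rel A D" using B(1) B'(1) C D rel_trans by blast
    moreover have "D $ i $ k' = (if i = k' then 1 else 0)" if "k' \<in> insert k K" for i k'
      using that insert Ckk by (auto simp: D_def CK)
    ultimately show ?case by blast
  qed
  obtain B where B: "rel A B" "\<And>k i. k \<noteq> l \<Longrightarrow> B $ i $ k = (if i = k then 1 else 0)"
    using cols[of "UNIV - {l}"] by auto
  have dB: "det B = B $ l $ l"
  proof -
    \<comment> \<open>Column l is treated as a row of the transpose: its off-diagonal part lies in
      the span of the other rows.\<close>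
    have "det (transpose B) = (\<Prod>i\<in>UNIV. B $ i $ i)" if "True"
    proof -
      define x where "x = (\<chi> i. B $ i $ l)"
      have "transpose B = (\<chi> k. if k = l then row l (diag1 l (B $ l $ l)) + (x - (B $ l $ l) *s axis l 1) else row k (diag1 l (B $ l $ l)))"
        using B(2) by (auto simp: vec_eq_iff transpose_def row_def diag1_def x_def axis_def)
      also have "det \<dots> = det (diag1 l (B $ l $ l))"
      proof (rule det_row_span)
        have "x - (B $ l $ l) *s axis l 1 = (\<Sum>k\<in>UNIV. (x - (B $ l $ l) *s axis l 1) $ k *s axis k 1)"
          by (rule basis_expansion[symmetric])
        also have "\<dots> = (\<Sum>k\<in>UNIV - {l}. (x - (B $ l $ l) *s axis l 1) $ k *s axis k 1)"
          by (rule sum.mono_neutral_right) (auto simp: x_def axis_def)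
        also have "\<dots> \<in> vec.span {row j (diag1 l (B $ l $ l)) |j. j \<noteq> l}"
        proof (intro vec.span_sum vec.span_scale vec.span_base)
          fix k assume "k \<in> UNIV - {l}"
          then have "axis k 1 = row k (diag1 l (B $ l $ l))" by (auto simp: vec_eq_iff axis_def row_def diag1_def)
          then show "axis k 1 \<in> {row j (diag1 l (B $ l $ l)) |j. j \<noteq> l}" using \<open>k \<in> UNIV - {l}\<close> by blast
        qed
        finally show "x - (B $ l $ l) *s axis l 1 \<in> vec.span {row j (diag1 l (B $ l $ l)) |j. j \<noteq> l}" .
      qed
      also have "\<dots> = (\<Prod>i\<in>UNIV. diag1 l (B $ l $ l) $ i $ i)"
        by (rule det_diagonal) (auto simp: diag1_def)
      also have "\<dots> = (\<Prod>i\<in>UNIV. B $ i $ i)"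
        by (rule prod.cong) (use B(2) in \<open>auto simp: diag1_def\<close>)
      finally show ?thesis .
    qed
    moreover have "(\<Prod>i\<in>UNIV. B $ i $ i) = B $ l $ l * (\<Prod>i\<in>UNIV - {l}. B $ i $ i)"
      by (simp add: prod.remove)
    moreover have "(\<Prod>i\<in>UNIV - {l}. B $ i $ i) = 1" by (rule prod.neutral) (use B(2) in auto)
    ultimately show ?thesis by (simp add: det_transpose)
  qed
  have Bll: "B $ l $ l \<noteq> 0" using dB B(1) A by (simp add: rel_def)
  define D where "D = (\<chi> a. if a \<in> UNIV - {l} then B $ a - (B $ a $ l / B $ l $ l) *s B $ l else B $ a)"
  have "rel B D" unfolding D_def by (rule rel_rows) auto
  then have "rel A D" using B(1) rel_trans by blast
  moreover have "D = diag1 l (B $ l $ l)"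
  proof -
    have "D $ i $ j = diag1 l (B $ l $ l) $ i $ j" for i j
      using B(2)[of j] Bll by (cases "j = l") (auto simp: D_def diag1_def)
    then show ?thesis by (simp add: vec_eq_iff)
  qed
  moreover have "det A = B $ l $ l" using B(1) dB by (simp add: rel_def)
  ultimately show ?thesis unfolding rel_def by auto
qed

subsection \<open>Every jet is realized\<close>

context jet_realization
begin

section \<open>The linear part of a jet\<close>

definition realizable_linear :: "(complex ^ 'n \<Rightarrow> complex ^ 'n) \<Rightarrow> bool" where
  "realizable_linear f \<longleftrightarrow> realizable (\<lambda>x. p + f (x - p))"

lemma realizable_linear_compose: "realizable_linear f \<Longrightarrow> realizable_linear g \<Longrightarrow> realizable_linear (\<lambda>x. f (g x))"
  unfolding realizable_linear_def using realizable_compose[of "\<lambda>x. p + f (x - p)" "\<lambda>x. p + g (x - p)"] by simp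

lemma realizable_linear_id: "realizable_linear (\<lambda>x. x)"
  by (simp add: realizable_linear_def)

definition transvection :: "'n \<Rightarrow> 'n \<Rightarrow> complex \<Rightarrow> complex ^ 'n \<Rightarrow> complex ^ 'n" where
  "transvection i j c x = x + (c * x $ j) *s axis i 1"

lemma realizable_linear_shear:
  assumes r: "r \<noteq> l" and t: "cmod t < tau" and j: "j \<noteq> l"
  shows "realizable_linear (\<lambda>x. x + (c * tilt t r x $ j) *s (axis l 1 - t *s axis r 1))"
proof -
  have "realizable (\<lambda>x. x + (\<lambda>y. c * y $ j) (tilt t r (x - p)) *s (axis l 1 - t *s axis r 1))"
    by (rule realizable_shear[OF r t]) (use j in \<open>auto intro!: entire_mult simp: axis_def\<close>)
  then show ?thesis by (simp add: realizable_linear_def algebra_simps)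
qed

lemma realizable_linear_transvection_l: "j \<noteq> l \<Longrightarrow> realizable_linear (transvection l j c)"
  using realizable_linear_shear[OF l[symmetric], of 0 j c] tau_pos by (simp add: transvection_def[abs_def] tilt_def)

lemma realizable_linear_transvection:
  assumes "i \<noteq> j" shows "realizable_linear (transvection i j c)"
proof (cases "i = l")
  case True
  then show ?thesis using realizable_linear_transvection_l assms by auto
next
  case i: False
  define t where "t = complex_of_real (tau / 2)"
  have t: "cmod t < tau" "t \<noteq> 0" using tau_pos by (auto simp: t_def)
  show ?thesis
  proof (cases "j = l")
    case False
    \<comment> \<open>The tilted shear yields c x_j e_i together with - (c / t) x_j e_l; the outer
      transvection removes the latter.\<close>
    have "realizable_linear (\<lambda>x. transvection l j (c / t) (x + (- (c / t) * tilt t i x $ j) *s (axis l 1 - t *s axis i 1)))"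
      by (intro realizable_linear_compose[OF realizable_linear_transvection_l realizable_linear_shear] i t False)
    moreover have "transvection l j (c / t) (x + (- (c / t) * tilt t i x $ j) *s (axis l 1 - t *s axis i 1)) = transvection i j c x" for x
      using t assms False i by (auto simp: transvection_def tilt_def vec_eq_iff axis_def field_simps)
    ultimately show ?thesis by (metis (no_types, lifting) ext)
  next
    case True
    \<comment> \<open>Replacing x_l by x_l - x_i / t turns x_i + t x_l into t x_l, and the outer
      transvection turns e_l - t e_i into - t e_i. The added term is - d t^2 x_l e_i, which
      determines d.\<close>
    define d where "d = - (c / t\<^sup>2)"
    have "realizable_linear (\<lambda>x. transvection l i (1 / t) ((\<lambda>x. x + (d * tilt t i x $ i) *s (axis l 1 - t *s axis i 1)) (transvection l i (- (1 / t)) x)))"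
      by (rule realizable_linear_compose[OF realizable_linear_transvection_l realizable_linear_compose[OF realizable_linear_shear realizable_linear_transvection_l]]) (use i t in auto)
    moreover have "transvection l i (1 / t) ((\<lambda>x. x + (d * tilt t i x $ i) *s (axis l 1 - t *s axis i 1)) (transvection l i (- (1 / t)) x)) = transvection i j c x" for x
      using t i True by (auto simp: d_def transvection_def tilt_def vec_eq_iff axis_def field_simps power2_eq_square)
    ultimately show ?thesis by (metis (no_types, lifting) ext)
  qed
qed

text \<open>An overshear with the constant exponent Ln d scales coordinate l by d.\<close>

lemma realizable_linear_diag1:
  assumes "\<not> vol" "d \<noteq> 0" shows "realizable_linear ((*v) (diag1 l d))"
proof -
  have "realizable (\<lambda>x. x + ((exp ((\<lambda>y. Ln d) (tilt 0 i0 (x - p))) - 1) * (x - p) $ l) *s (axis l 1 - 0 *s axis i0 1))"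
    by (rule realizable_overshear[OF assms(1) l[symmetric]]) (use tau_pos in auto)
  moreover have "x + ((exp (Ln d) - 1) * (x - p) $ l) *s (axis l 1 - 0 *s axis i0 1) = p + diag1 l d *v (x - p)" for x
  proof -
    have "(diag1 l d *v y) $ i = y $ i + (if i = l then (d - 1) * y $ l else 0)" for i y
    proof -
      have "(diag1 l d *v y) $ i = (\<Sum>j\<in>UNIV. if j = i then (if i = l then d else 1) * y $ i else 0)"
        unfolding matrix_vector_mult_def vec_lambda_beta by (rule sum.cong) (auto simp: diag1_def)
      then show ?thesis by (simp add: algebra_simps)
    qed
    then show ?thesis using assms by (simp add: vec_eq_iff axis_def)
  qed
  ultimately show ?thesis by (simp add: realizable_linear_def)
qed

lemma realizable_linear_matrix:
  assumes A: "det A \<noteq> 0" and vol: "vol \<Longrightarrow> det A = 1"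
  shows "realizable_linear ((*v) A)"
proof -
  have "\<exists>E. realizable_linear ((*v) E) \<and> A = E ** diag1 l (det A)"
  proof (rule transvections_generate[OF _ _ _ A])
    have "(*v) (mat 1) = (\<lambda>x :: complex ^ 'n. x)" by (simp add: fun_eq_iff)
    then show "realizable_linear ((*v) (mat 1))" using realizable_linear_id by simp
    show "realizable_linear ((*v) (A ** B))" if "realizable_linear ((*v) A)" "realizable_linear ((*v) B)" for A B
      using realizable_linear_compose[OF that] by (simp add: matrix_vector_mul_assoc)
    fix i j :: 'n and c :: complex assume ij: "i \<noteq> j"
    have "(rowadd i j c (mat 1) *v x) $ a = transvection i j c x $ a" for x a
    proof -
      have "(rowadd i j c (mat 1) *v x) $ a = (\<Sum>b\<in>UNIV. (if b = a then x $ a else 0) + (if b = j then (if a = i then c * x $ j else 0) else 0))"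
        unfolding matrix_vector_mult_def vec_lambda_beta by (rule sum.cong) (auto simp: rowadd_def mat_def algebra_simps)
      then show ?thesis by (simp add: sum.distrib transvection_def axis_def)
    qed
    then have "(*v) (rowadd i j c (mat 1)) = transvection i j c" by (simp add: fun_eq_iff vec_eq_iff)
    then show "realizable_linear ((*v) (rowadd i j c (mat 1)))" using realizable_linear_transvection[OF ij] by simp
  qed
  then obtain E where E: "realizable_linear ((*v) E)" "A = E ** diag1 l (det A)" by blast
  have "realizable_linear ((*v) (diag1 l (det A)))"
  proof (cases vol)
    case True
    have "diag1 l (1::complex) = mat 1" by (auto simp: diag1_def mat_def vec_eq_iff)
    moreover have "(*v) (mat 1) = (\<lambda>x :: complex ^ 'n. x)" by (simp add: fun_eq_iff)
    ultimately show ?thesis using vol[OF True] realizable_linear_id by simp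
  qed (rule realizable_linear_diag1[OF _ A])
  from realizable_linear_compose[OF E(1) this] show ?thesis using E(2) by (simp add: matrix_vector_mul_assoc)
qed

text \<open>Induction on the degree. If the automorphism S has the q-jet of Q, then R = inv S o Q is
  tangent to the identity to order q. Its next homogeneous term X is the leading term of some
  realizable G, and S o G is right to order q + 1. With \<open>vol\<close>, R has the Jacobian
  determinant of Q, so X is divergence free.\<close>

lemma realizable_holomorphic:
  assumes Q: "holomorphic_map Q" and Qp: "Q p = p" and det: "jacobian_det Q p \<noteq> 0" and m: "m \<ge> 1"
    and vol: "vol \<Longrightarrow> vanish m p (\<lambda>x. jacobian_det Q x - 1)"
  shows "realizable Q"
proof -
  have "\<exists>F. realizable F \<and> jet_eq q p F Q" if "1 \<le> q" "q \<le> m" for q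
    using that
  proof (induction q rule: nat_induct_at_least)
    case base
    have "realizable_linear ((*v) (jac Q p))"
    proof (rule realizable_linear_matrix)
      show "det (jac Q p) \<noteq> 0" using det by (simp add: jacobian_det_jac)
      assume v: vol
      obtain m' where "m = Suc m'" using m by (cases m) auto
      with vanish_at vol[OF v] have "jacobian_det Q p - 1 = 0" by blast
      then show "det (jac Q p) = 1" by (simp add: jacobian_det_jac)
    qed
    moreover have "jet_eq 1 p Q (\<lambda>x. p + jac Q p *v (x - p))"
      using jac_vanish[OF holomorphic_map_entire[OF Q], of p] by (simp add: jet_eq_def Qp diff_diff_eq)
    ultimately show ?case unfolding realizable_linear_def using jet_eq_sym by blast
  next
    case (Suc q)
    then obtain F where F: "realizable F" "jet_eq q p F Q" by auto
    obtain S where S: "S \<in> Gr vol" "jet_eq m p S F" "S p = p" using realizable_map[OF F(1)] .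
    have rS: "realizable S" by (rule realizable_jet[OF F(1) jet_eq_sym[OF S(2)]])
    have qm: "q \<le> m" "Suc q \<le> m" "2 \<le> Suc q" using Suc by auto
    have SQ: "jet_eq q p S Q" by (rule jet_eq_trans[OF jet_eq_mono[OF S(2) qm(1)] F(2)])
    note hol = Gr_holo[OF S(1)] Gr_inv_holo[OF S(1)]
    define R where "R x = inv S (Q x)" for x
    have R: "holomorphic_map R" unfolding R_def by (rule holomorphic_map_compose[OF hol(2) Q])
    have "jet_eq q p (\<lambda>x. inv S (S x)) (\<lambda>x. inv S (Q x))"
      by (rule jet_eq_compose_left[OF SQ holomorphic_map_locally_lipschitz[OF hol(2)] holomorphic_map_lipschitz_at[OF hol(1)]])
    then have "jet_eq q p (\<lambda>x. x) R" using S(1) by (simp add: R_def[abs_def])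
    then have R1: "jet_eq q p R (\<lambda>x. x)" by (rule jet_eq_sym)
    have ER: "entire (\<lambda>x. R x $ i - x $ i)" for i by (intro entire_diff holomorphic_map_entire[OF R]) simp
    have vR: "vanish (Suc q) p (\<lambda>x. R x $ i - x $ i)" for i
      using R1 unfolding jet_eq_def vanish_vec_iff by simp
    define X where "X v = (\<chi> i. taylor_term (\<lambda>x. R x $ i - x $ i) p (Suc q) v)" for v
    have X: "holomorphic_map X" unfolding holomorphic_map_iff X_def by (simp add: taylor_term_entire[OF ER])
    have hX: "homogeneous (Suc q) (\<lambda>x. X x $ i)" for i unfolding X_def by (simp add: taylor_term_homogeneous[OF ER])
    have RX: "jet_eq (Suc q) p R (\<lambda>x. x + X (x - p))"
      unfolding jet_eq_def vanish_vec_iff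
    proof
      fix i
      show "vanish (Suc (Suc q)) p (\<lambda>x. (R x - (x + X (x - p))) $ i)"
        using vanish_minus_taylor_term[OF ER vR, of i] by (simp add: X_def diff_diff_eq)
    qed
    have "realizable_field (Suc q) X"
    proof (rule realizable_field_homogeneous[OF X hX qm(3,2)])
      fix y assume v: vol
      have "jacobian_det R x = jacobian_det Q x" for x
        unfolding R_def using jacobian_det_compose[OF hol(2) Q, of x] Gr_jac[of "inv S"] Gr_inv(1)[OF S(1)] v by simp
      then have "vanish (Suc q) p (\<lambda>x. jacobian_det R x - 1)"
        using vanish_mono[OF vol[OF v] qm(2)] by simp
      then show "(\<Sum>i\<in>UNIV. jac X y $ i $ i) = 0"
        using qm by (intro divergence_zero[OF R X hX _ RX]) auto
    qed
    then obtain G where G: "realizable G" "jet_eq (Suc q) p G (\<lambda>x. x + 1 *s X (x - p))" unfolding realizable_field_def by blast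
    have GR: "jet_eq (Suc q) p G R" using jet_eq_trans[OF G(2)] jet_eq_sym[OF RX] by simp
    have Gp: "G p = p" using G(1) by (simp add: realizable_def)
    have "jet_eq (Suc q) p (\<lambda>x. S (G x)) (\<lambda>x. S (R x))"
      by (rule jet_eq_compose_left[OF GR holomorphic_map_locally_lipschitz[OF hol(1)] realizable_lips[OF G(1)]])
    then have "jet_eq (Suc q) p (\<lambda>x. S (G x)) Q" using S(1) by (simp add: R_def)
    then show ?case using realizable_compose[OF rS G(1)] by blast
  qed
  then obtain F where "realizable F" "jet_eq m p F Q" using m by auto
  then show ?thesis by (rule realizable_jet)
qed

end

subsection \<open>Limits of automorphisms\<close>

text \<open>Step n is controlled on the ball of radius n only; on a given ball the telescoping sum
  starts once n exceeds the radius.\<close>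

lemma geometric_uniform_limit:
  fixes f :: "nat \<Rightarrow> 'a::real_normed_vector \<Rightarrow> 'b::banach"
  assumes step: "\<And>n x. norm x \<le> real n \<Longrightarrow> norm (f (Suc n) x - f n x) \<le> (1/2) ^ n"
  obtains g where "\<And>R. uniform_limit (cball 0 R) f g sequentially"
proof -
  have tele: "norm (f (n + i) x - f n x) \<le> 2 * (1/2) ^ n - 2 * (1/2) ^ (n + i)" if "norm x \<le> real n" for n i x
  proof (induction i)
    case (Suc i)
    have "norm (f (n + Suc i) x - f n x) \<le> norm (f (Suc (n + i)) x - f (n + i) x) + norm (f (n + i) x - f n x)"
      using norm_triangle_ineq[of "f (Suc (n + i)) x - f (n + i) x" "f (n + i) x - f n x"] by simp
    also have "\<dots> \<le> (1/2) ^ (n + i) + (2 * (1/2) ^ n - 2 * (1/2) ^ (n + i))"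
      using that by (intro add_mono step Suc) simp
    finally show ?case by simp
  qed simp
  have "uniformly_Cauchy_on (cball 0 R) f" for R
  proof (rule uniformly_Cauchy_onI')
    fix e :: real assume e: "e > 0"
    have "(\<lambda>n. 2 * (1/2) ^ n :: real) \<longlonglongrightarrow> 2 * 0" by (intro tendsto_mult tendsto_const LIMSEQ_power_zero) simp
    then have "\<forall>\<^sub>F n in sequentially. 2 * (1/2) ^ n < e" using e by (intro order_tendstoD(2)) auto
    then obtain N where N: "\<And>n. n \<ge> N \<Longrightarrow> 2 * (1/2) ^ n < e" by (auto simp: eventually_sequentially)
    obtain K :: nat where K: "real K \<ge> R" using real_arch_simple by blast
    show "\<exists>M. \<forall>x\<in>cball 0 R. \<forall>m\<ge>M. \<forall>n>m. dist (f m x) (f n x) < e"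
    proof (intro exI[of _ "max N K"] ballI allI impI)
      fix x :: 'a and m n :: nat assume x: "x \<in> cball 0 R" and m: "max N K \<le> m" and n: "m < n"
      obtain i where i: "n = m + i" using n by (metis less_imp_add_positive)
      have "norm (f (m + i) x - f m x) \<le> 2 * (1/2) ^ m - 2 * (1/2) ^ (m + i)"
        using x m K by (intro tele) auto
      also have "\<dots> < e" using N[of m] m by (smt (verit) max.boundedE zero_le_power divide_nonneg_nonneg)
      finally show "dist (f m x) (f n x) < e" by (simp add: i dist_norm norm_minus_commute)
    qed
  qed
  then have "uniform_limit (cball 0 R) f (\<lambda>x. lim (\<lambda>n. f n x)) sequentially" for R
    using Cauchy_uniformly_convergent uniformly_convergent_uniform_limit_iff by blast
  then show ?thesis by (rule that)
qed

lemma uniform_limit_tendsto_compose: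
  fixes f :: "nat \<Rightarrow> 'a::real_normed_vector \<Rightarrow> 'b::real_normed_vector"
  assumes ul: "\<And>R. uniform_limit (cball 0 R) f g sequentially" and z: "z \<longlonglongrightarrow> c" and g: "isCont g c"
  shows "(\<lambda>n. f n (z n)) \<longlonglongrightarrow> g c"
proof -
  have "\<forall>\<^sub>F n in sequentially. dist (z n) c < 1" using z by (rule tendstoD) simp
  then have ev: "\<forall>\<^sub>F n in sequentially. z n \<in> cball 0 (norm c + 1)"
  proof eventually_elim
    case (elim n)
    then show ?case using norm_triangle_sub[of "z n" c] by (simp add: dist_norm)
  qed
  have "(\<lambda>n. f n (z n) - g (z n)) \<longlonglongrightarrow> 0"
  proof (rule tendstoI)
    fix e :: real assume "e > 0"
    from uniform_limitD[OF ul this, of "norm c + 1"] ev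
    show "\<forall>\<^sub>F n in sequentially. dist (f n (z n) - g (z n)) 0 < e"
      by eventually_elim (simp add: dist_norm)
  qed
  moreover have "(\<lambda>n. g (z n)) \<longlonglongrightarrow> g c" using g z by (rule isCont_tendsto_compose)
  ultimately show ?thesis using tendsto_add[of "\<lambda>n. f n (z n) - g (z n)" 0 sequentially "\<lambda>n. g (z n)" "g c"] by simp
qed

lemma uniform_limit_pointwise:
  assumes "\<And>R. uniform_limit (cball 0 R) f g sequentially"
  shows "(\<lambda>n. f n (x::'a::real_normed_vector)) \<longlonglongrightarrow> g x"
  using assms[of "norm x"] by (rule tendsto_uniform_limitI) simp

lemma holomorphic_map_limit:
  assumes f: "\<And>n. holomorphic_map (f n)" and ul: "\<And>R. uniform_limit (cball 0 R) f g sequentially"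
  shows "holomorphic_map g"
  unfolding holomorphic_map_iff
proof
  fix i
  show "entire (\<lambda>z. g z $ i)"
  proof (rule entire_limit[where f = "\<lambda>n z. f n z $ i"])
    fix R
    show "uniform_limit (cball 0 R) (\<lambda>n z. f n z $ i) (\<lambda>z. g z $ i) sequentially"
    proof (rule uniform_limitI)
      fix e :: real assume "e > 0"
      from uniform_limitD[OF ul this, of R]
      show "\<forall>\<^sub>F n in sequentially. \<forall>x\<in>cball 0 R. dist (f n x $ i) (g x $ i) < e"
        by eventually_elim (meson dist_vec_nth_le order_le_less_trans)
    qed
  qed (rule holomorphic_map_entire[OF f])
qed

text \<open>Cauchy's estimate on the unit ball about z turns uniform convergence into convergence of
  the partial derivatives.\<close>

lemma jacobian_det_limit:
  assumes f: "\<And>n. holomorphic_map (f n)" and ul: "\<And>R. uniform_limit (cball 0 R) f g sequentially"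
  shows "(\<lambda>n. jacobian_det (f n) z) \<longlonglongrightarrow> jacobian_det g z"
proof -
  have g: "holomorphic_map g" by (rule holomorphic_map_limit[OF f ul])
  have "(\<lambda>n. jac (f n) z $ i $ k) \<longlonglongrightarrow> jac g z $ i $ k" for i k
  proof (rule LIM_zero_cancel, rule tendstoI)
    fix e :: real assume e: "e > 0"
    from uniform_limitD[OF ul, of "e / 2" "norm z + 1"] e
    have "\<forall>\<^sub>F n in sequentially. \<forall>x\<in>cball 0 (norm z + 1). dist (f n x) (g x) < e / 2" by simp
    then show "\<forall>\<^sub>F n in sequentially. dist (jac (f n) z $ i $ k - jac g z $ i $ k) 0 < e"
    proof eventually_elim
      case (elim n)
      define d where "d x = f n x - g x" for x
      have d: "holomorphic_map d" unfolding d_def by (intro holomorphic_map_diff f g)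
      have "jac (f n) z = jac d z + jac g z" using jac_add[OF d g] by (simp add: d_def)
      then have "jac (f n) z $ i $ k - jac g z $ i $ k = taylor_term (\<lambda>x. d x $ i) z 1 (axis k 1)"
        by (simp add: jac_def partial_deriv_taylor_term[OF holomorphic_map_entire[OF d]])
      moreover have "cmod (taylor_term (\<lambda>x. d x $ i) z 1 (axis k 1)) \<le> (e / 2) * (norm (axis k (1::complex)) / 1) ^ 1"
      proof (rule taylor_term_bound[OF holomorphic_map_entire[OF d]])
        fix w :: "complex ^ 'a" assume "norm w \<le> 1"
        then have "z + w \<in> cball 0 (norm z + 1)" using norm_triangle_ineq[of z w] by simp
        then have "norm (d (z + w)) < e / 2" using elim by (simp add: d_def dist_norm)
        then show "cmod (d (z + w) $ i) \<le> e / 2" using Finite_Cartesian_Product.norm_nth_le[of "d (z + w)" i] by linarith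
      qed simp
      ultimately show ?case using e by (simp add: norm_eq_sqrt_inner[of "axis k 1"] inner_axis_axis)
    qed
  qed
  then show ?thesis unfolding jacobian_det_jac det_def
    by (intro tendsto_sum tendsto_mult tendsto_const tendsto_prod)
qed

text \<open>Local uniformity lets both compositions of \<open>f n\<close> with its inverse pass to
  the limit, which makes the two limits inverse to each other.\<close>

lemma Gr_limit:
  assumes G: "\<And>n. f n \<in> Gr vol"
    and step: "\<And>n x. norm x \<le> real n \<Longrightarrow> norm (f (Suc n) x - f n x) \<le> (1/2) ^ n"
    and step': "\<And>n y. norm y \<le> real n \<Longrightarrow> norm (inv (f (Suc n)) y - inv (f n) y) \<le> (1/2) ^ n"
  obtains g where "g \<in> Gr vol" "\<And>R. uniform_limit (cball 0 R) f g sequentially"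
proof -
  obtain g where g: "\<And>R. uniform_limit (cball 0 R) f g sequentially"
    using geometric_uniform_limit[of f] step by blast
  obtain h where h: "\<And>R. uniform_limit (cball 0 R) (\<lambda>n. inv (f n)) h sequentially"
    using geometric_uniform_limit[of "\<lambda>n. inv (f n)"] step' by blast
  have gh: "holomorphic_map g" by (rule holomorphic_map_limit[OF Gr_holo[OF G] g])
  have hh: "holomorphic_map h" by (rule holomorphic_map_limit[OF Gr_inv_holo[OF G] h])
  have "g \<in> Gr vol"
  proof (rule GrI(1)[OF gh hh])
    fix z
    have "(\<lambda>n. f n (inv (f n) z)) \<longlonglongrightarrow> g (h z)"
      by (rule uniform_limit_tendsto_compose[OF g uniform_limit_pointwise[OF h] holomorphic_map_isCont[OF gh]])
    then have "(\<lambda>n. z) \<longlonglongrightarrow> g (h z)" by (simp only: Gr_f_inv[OF G])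
    then show "g (h z) = z" by (rule LIMSEQ_unique[OF _ tendsto_const])
    have "(\<lambda>n. inv (f n) (f n z)) \<longlonglongrightarrow> h (g z)"
      by (rule uniform_limit_tendsto_compose[OF h uniform_limit_pointwise[OF g] holomorphic_map_isCont[OF hh]])
    then have "(\<lambda>n. z) \<longlonglongrightarrow> h (g z)" by (simp only: Gr_inv_f[OF G])
    then show "h (g z) = z" by (rule LIMSEQ_unique[OF _ tendsto_const])
  next
    fix z assume vol
    then have "jacobian_det (f n) z = 1" for n using Gr_jac[of "f n" z] G[of n] by simp
    then have "(\<lambda>n. 1) \<longlonglongrightarrow> jacobian_det g z" using jacobian_det_limit[OF Gr_holo[OF G] g, of z] by simp
    then show "jacobian_det g z = 1" by (rule LIMSEQ_unique[OF _ tendsto_const])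
  qed
  then show ?thesis using that g by blast
qed

text \<open>The constants in the jets of \<open>f n\<close> might grow with n. A common bound on a
  ball about p, obtained from g, together with vanishing Taylor terms up to degree m, gives one
  constant for all large n.\<close>

lemma jet_eq_limit:
  assumes f: "\<And>n. holomorphic_map (f n)" and ul: "\<And>R. uniform_limit (cball 0 R) f g sequentially"
    and G: "holomorphic_map G" and j: "\<And>n. n \<ge> N \<Longrightarrow> jet_eq m p (f n) G"
  shows "jet_eq m p g G"
  unfolding jet_eq_def vanish_vec_iff
proof
  fix i
  have g: "holomorphic_map g" by (rule holomorphic_map_limit[OF f ul])
  have e: "entire (\<lambda>x. (F x - G x) $ i)" if "holomorphic_map F" for F
    by (rule holomorphic_map_entire[OF holomorphic_map_diff[OF that G]])
  obtain B where B: "B > 0" "\<And>w. norm w \<le> 2 \<Longrightarrow> cmod ((g (p + w) - G (p + w)) $ i) \<le> B"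
    using entire_bounded[OF e[OF g]] by blast
  have le: "cmod ((g x - G x) $ i) \<le> (B + 1) * norm (x - p) ^ Suc m" if x: "norm (x - p) < 1" for x
  proof (rule LIMSEQ_le_const2)
    show "(\<lambda>n. cmod ((f n x - G x) $ i)) \<longlonglongrightarrow> cmod ((g x - G x) $ i)"
      by (intro tendsto_norm tendsto_vec_nth tendsto_diff tendsto_const uniform_limit_pointwise[OF ul])
    from uniform_limitD[OF ul zero_less_one, of "norm p + 2"] obtain K where
      "\<forall>n\<ge>K. \<forall>x\<in>cball 0 (norm p + 2). dist (f n x) (g x) < 1"
      unfolding eventually_sequentially by blast
    then have K: "\<And>n x. n \<ge> K \<Longrightarrow> norm x \<le> norm p + 2 \<Longrightarrow> dist (f n x) (g x) < 1" by simp
    show "\<exists>N. \<forall>n\<ge>N. cmod ((f n x - G x) $ i) \<le> (B + 1) * norm (x - p) ^ Suc m"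
    proof (intro exI[of _ "max N K"] allI impI)
      fix n assume n: "n \<ge> max N K"
      let ?E = "\<lambda>x. (f n x - G x) $ i"
      have vE: "vanish (Suc m) p ?E"
        using j[of n] n unfolding jet_eq_def vanish_vec_iff by simp
      have z: "taylor_term ?E p s w = 0" if "s \<le> m" for s w
        by (rule taylor_term_zero_of_vanish[OF e[OF f] vE]) (use that in simp)
      have "cmod (?E (p + (x - p)) - (\<Sum>s\<le>m. taylor_term ?E p s (x - p))) \<le> (B + 1) * norm (x - p) ^ Suc m"
      proof (rule taylor_term_remainder[OF e[OF f]])
        fix w :: "complex ^ 'a" assume w: "norm w \<le> 2"
        have "norm (p + w) \<le> norm p + 2" using norm_triangle_ineq[of p w] w by simp
        then have "norm (f n (p + w) - g (p + w)) < 1" using K[of n "p + w"] n by (simp add: dist_norm)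
        then have "cmod ((f n (p + w) - g (p + w)) $ i) \<le> 1"
          using Finite_Cartesian_Product.norm_nth_le[of "f n (p + w) - g (p + w)" i] by linarith
        then show "cmod (?E (p + w)) \<le> B + 1"
          using B(2)[OF w] norm_triangle_ineq[of "(f n (p + w) - g (p + w)) $ i" "(g (p + w) - G (p + w)) $ i"] by simp
      qed (use x in simp)
      moreover have "(\<Sum>s\<le>m. taylor_term ?E p s (x - p)) = 0" by (intro sum.neutral ballI z) simp
      ultimately show "cmod (?E x) \<le> (B + 1) * norm (x - p) ^ Suc m"
        by (simp only: diff_0_right add_diff_cancel_left' diff_add_cancel add_diff_eq)
    qed
  qed
  have "\<forall>\<^sub>F x in nhds p. dist x p < 1"
    unfolding eventually_nhds_metric by (intro exI[of _ 1]) auto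
  then show "vanish (Suc m) p (\<lambda>x. (g x - G x) $ i)"
    by (intro vanishI[where C = "B + 1"], eventually_elim) (use le in \<open>simp add: dist_norm\<close>)
qed

subsection \<open>Interpolation at the integer points of an axis\<close>

lemma Gr_jac_nonzero:
  assumes "F \<in> Gr vol" shows "jacobian_det F z \<noteq> 0"
proof -
  have "jacobian_det (\<lambda>z. inv F (F z)) z = jacobian_det (inv F) (F z) * jacobian_det F z"
    by (rule jacobian_det_compose[OF Gr_inv_holo[OF assms] Gr_holo[OF assms]])
  then show ?thesis using assms by (auto simp: jacobian_det_jac)
qed

lemma realize_jet:
  fixes Q :: "complex ^ 'n::finite \<Rightarrow> complex ^ 'n" and i0 l :: 'n
  assumes l: "l \<noteq> i0" and k: "k \<ge> 1" and R: "R < real k" and e: "e > 0" and m: "m \<ge> 1"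
    and Q: "holomorphic_map Q" "Q (of_nat k *s axis i0 1) = of_nat k *s axis i0 1"
      "jacobian_det Q (of_nat k *s axis i0 1) \<noteq> 0"
      "vol \<Longrightarrow> vanish m (of_nat k *s axis i0 1) (\<lambda>x. jacobian_det Q x - 1)"
  obtains T where "T \<in> Gr vol" "jet_eq m (of_nat k *s axis i0 1) T Q"
    "\<And>j. j \<noteq> k \<Longrightarrow> jet_eq mo (of_nat j *s axis i0 1) T (\<lambda>x. x)"
    "\<And>x. norm x \<le> R \<Longrightarrow> norm (T x - x) \<le> e"
proof -
  \<comment> \<open>Positive and strictly between R and k, even for negative R.\<close>
  define R0 where "R0 = (max R 0 + real k) / 2"
  interpret jet_realization vol k m mo R0 i0 l "of_nat k *s axis i0 1"
    by unfold_locales (use k R l in \<open>auto simp: R0_def\<close>)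
  have "realizable Q" by (rule realizable_holomorphic[OF Q(1,2,3) m Q(4)])
  moreover have "R < R0" using R k by (auto simp: R0_def max_def)
  ultimately show ?thesis
  proof (rule realizableE[OF _ _ e])
    fix T assume "T \<in> Gr vol" "jet_eq m (of_nat k *s axis i0 1) T Q"
      "\<And>j. j \<noteq> k \<Longrightarrow> jet_eq mo (of_nat j *s axis i0 1) T (\<lambda>x. x)"
      "\<And>x. norm x \<le> R \<Longrightarrow> norm (T x - x) \<le> e"
    then show ?thesis by (rule that)
  qed
qed

locale axis_interpolation =
  fixes vol :: bool and i0 l :: "'n::finite" and m :: "nat \<Rightarrow> nat"
  assumes l: "l \<noteq> i0" and m: "\<And>j. j \<ge> 1 \<Longrightarrow> m j \<ge> 1"
begin

definition pt :: "nat \<Rightarrow> complex ^ 'n" where "pt j = of_nat j *s axis i0 1"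

text \<open>Stable under composition with \<open>fixes_pts\<close> maps on either side, so that
  prescribed jets can be transported through the automorphisms built so far.\<close>

definition good :: "nat \<Rightarrow> (complex ^ 'n \<Rightarrow> complex ^ 'n) \<Rightarrow> bool" where
  "good j Q \<longleftrightarrow> holomorphic_map Q \<and> Q (pt j) = pt j \<and> jacobian_det Q (pt j) \<noteq> 0 \<and>
     (vol \<longrightarrow> vanish (m j) (pt j) (\<lambda>x. jacobian_det Q x - 1))"

definition fixes_pts :: "(complex ^ 'n \<Rightarrow> complex ^ 'n) \<Rightarrow> bool" where
  "fixes_pts S \<longleftrightarrow> S \<in> Gr vol \<and> (\<forall>j. S (pt j) = pt j)"

lemma fixes_inv: "fixes_pts S \<Longrightarrow> fixes_pts (inv S)"
  unfolding fixes_pts_def by (metis Gr_inv(1) Gr_inv_f)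

lemma fixes_comp: "fixes_pts S \<Longrightarrow> fixes_pts T \<Longrightarrow> fixes_pts (\<lambda>x. S (T x))"
  unfolding fixes_pts_def by (auto intro: Gr_comp(1))

lemma good_left:
  assumes S: "fixes_pts S" and Q: "good j Q" shows "good j (\<lambda>x. S (Q x))"
proof -
  have SG: "S \<in> Gr vol" using S by (simp add: fixes_pts_def)
  have q: "holomorphic_map Q" using Q by (simp add: good_def)
  have J: "jacobian_det (\<lambda>x. S (Q x)) x = jacobian_det S (Q x) * jacobian_det Q x" for x
    by (rule jacobian_det_compose[OF Gr_holo[OF SG] q])
  have "jacobian_det S x = 1" if vol for x using SG that by (simp add: Gr_jac)
  then show ?thesis
    using Q S Gr_jac_nonzero[OF SG] holomorphic_map_compose[OF Gr_holo[OF SG] q]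
    by (simp add: good_def fixes_pts_def J)
qed

lemma good_right:
  assumes S: "fixes_pts S" and Q: "good j Q" shows "good j (\<lambda>x. Q (S x))"
proof -
  have SG: "S \<in> Gr vol" and Sp: "S (pt j) = pt j" using S by (auto simp: fixes_pts_def)
  have q: "holomorphic_map Q" using Q by (simp add: good_def)
  have J: "jacobian_det (\<lambda>x. Q (S x)) x = jacobian_det Q (S x) * jacobian_det S x" for x
    by (rule jacobian_det_compose[OF q Gr_holo[OF SG]])
  have S1: "jacobian_det S x = 1" if vol for x using SG that by (simp add: Gr_jac)
  have "vanish (m j) (pt j) (\<lambda>x. jacobian_det Q (S x) - 1)" if vol
  proof (rule vanish_compose[where E = "\<lambda>x. jacobian_det Q x - 1"])
    show "vanish (m j) (pt j) (\<lambda>x. jacobian_det Q x - 1)" using Q that unfolding good_def by blast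
    show "vanish (Suc 0) (pt j) (\<lambda>x. S x - pt j)"
      using holomorphic_map_lipschitz_at[OF Gr_holo[OF SG], of "pt j"] by (simp add: lipschitz_at_def Sp)
  qed
  then show ?thesis
    using Q S S1 Gr_jac_nonzero[OF SG] holomorphic_map_compose[OF q Gr_holo[OF SG]]
    by (simp add: good_def fixes_pts_def J)
qed

text \<open>The points beyond r are treated one at a time. For the point with index N + 1 the map S
  gets the jet of Q o inv T there, so that S o T has that of Q. It is flat at the other points to
  the highest order in use up to N + 1, so the jets obtained before survive.\<close>

lemma block:
  assumes r: "r \<ge> 0" and Q: "\<And>j. r < real j \<Longrightarrow> good j (Q j)" and e: "e > 0"
  shows "\<exists>T. fixes_pts T \<and> (\<forall>x. norm x \<le> r \<longrightarrow> norm (T x - x) \<le> e) \<and>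
    (\<forall>j. real j \<le> r \<longrightarrow> jet_eq (m j) (pt j) T (\<lambda>x. x)) \<and>
    (\<forall>j. r < real j \<longrightarrow> j \<le> N \<longrightarrow> jet_eq (m j) (pt j) T (Q j))"
  using e
proof (induction N arbitrary: e)
  case 0
  show ?case by (rule exI[of _ "\<lambda>x. x"]) (use r 0 in \<open>auto simp: fixes_pts_def\<close>)
next
  case (Suc N)
  show ?case
  proof (cases "real (Suc N) \<le> r")
    case True
    from Suc.IH[OF Suc.prems] obtain T where T: "fixes_pts T" "\<forall>x. norm x \<le> r \<longrightarrow> norm (T x - x) \<le> e"
      "\<forall>j. real j \<le> r \<longrightarrow> jet_eq (m j) (pt j) T (\<lambda>x. x)" by blast
    have "\<not> (r < real j \<and> j \<le> Suc N)" for j using True by auto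
    with T show ?thesis by blast
  next
    case False
    \<comment> \<open>The second entry keeps r + e' below N + 1: S must be near the identity on the
      T-image of the ball, and this is available only for radii below the index of its
      point.\<close>
    define e' where "e' = min (e / 2) ((real (Suc N) - r) / 2)"
    have "e' \<le> (real (Suc N) - r) / 2" unfolding e'_def by (rule min.cobounded2)
    moreover have "(real (Suc N) - r) / 2 < real (Suc N) - r" using False by simp
    ultimately have "e' < real (Suc N) - r" by (rule order.strict_trans1)
    then have "r + e' < real (Suc N)" by (simp only: less_diff_eq add.commute)
    moreover have "e' > 0" using False Suc.prems by (simp add: e'_def)
    ultimately have e': "e' > 0" "r + e' < real (Suc N)" by simp_all
    from Suc.IH[OF e'(1)] obtain T where T: "fixes_pts T" "\<And>x. norm x \<le> r \<Longrightarrow> norm (T x - x) \<le> e'"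
      "\<And>j. real j \<le> r \<Longrightarrow> jet_eq (m j) (pt j) T (\<lambda>x. x)"
      "\<And>j. r < real j \<Longrightarrow> j \<le> N \<Longrightarrow> jet_eq (m j) (pt j) T (Q j)" by blast
    have TG: "T \<in> Gr vol" and Tp: "\<And>j. T (pt j) = pt j" using T(1) by (auto simp: fixes_pts_def)
    define Q' where "Q' x = Q (Suc N) (inv T x)" for x
    have Q': "good (Suc N) Q'" unfolding Q'_def
      by (rule good_right[OF fixes_inv[OF T(1)] Q]) (use False in simp)
    define mo where "mo = Max (m ` {..Suc N})"
    have mo: "m j \<le> mo" if "j \<le> Suc N" for j unfolding mo_def using that by (intro Max_ge) auto
    obtain S where S: "S \<in> Gr vol" "jet_eq (m (Suc N)) (pt (Suc N)) S Q'"
      "\<And>j. j \<noteq> Suc N \<Longrightarrow> jet_eq mo (pt j) S (\<lambda>x. x)"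
      "\<And>x. norm x \<le> r + e' \<Longrightarrow> norm (S x - x) \<le> e'"
      using realize_jet[OF l, of "Suc N" "r + e'" e' "m (Suc N)" Q' vol mo] e' Q' m[of "Suc N"]
      unfolding good_def pt_def by auto
    have "S (pt j) = pt j" for j
      using jet_eq_at[OF S(2)] jet_eq_at[OF S(3)[of j]] Q' by (cases "j = Suc N") (auto simp: good_def)
    then have fS: "fixes_pts S" using S(1) by (simp add: fixes_pts_def)
    have ST: "jet_eq a (pt j) (\<lambda>x. S (T x)) (\<lambda>x. F (T x))" if "jet_eq a (pt j) S F" for a j F
      by (rule jet_eq_compose_right[where K = T, OF _ holomorphic_map_lipschitz_at[OF Gr_holo[OF TG]]]) (simp add: Tp that)
    have SId: "jet_eq (m j) (pt j) (\<lambda>x. S (T x)) T" if "j \<le> N" for j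
      using ST[OF jet_eq_mono[OF S(3) mo], of j j] that by simp
    show ?thesis
    proof (intro exI[of _ "\<lambda>x. S (T x)"] conjI allI impI)
      show "fixes_pts (\<lambda>x. S (T x))" by (rule fixes_comp[OF fS T(1)])
    next
      fix x :: "complex ^ 'n" assume x: "norm x \<le> r"
      have "norm (T x) \<le> r + e'" using T(2)[OF x] x norm_triangle_sub[of "T x" x] by simp
      then have "norm (S (T x) - T x) \<le> e'" by (rule S(4))
      then show "norm (S (T x) - x) \<le> e"
        using T(2)[OF x] norm_triangle_ineq[of "S (T x) - T x" "T x - x"] by (simp add: e'_def)
    next
      fix j assume j: "real j \<le> r"
      then have "j \<le> N" using False by simp
      then show "jet_eq (m j) (pt j) (\<lambda>x. S (T x)) (\<lambda>x. x)" using SId T(3)[OF j] jet_eq_trans by blast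
    next
      fix j assume j: "r < real j" "j \<le> Suc N"
      show "jet_eq (m j) (pt j) (\<lambda>x. S (T x)) (Q j)"
      proof (cases "j = Suc N")
        case True
        then show ?thesis using ST[OF S(2)] TG by (simp add: Q'_def)
      next
        case False
        then have "j \<le> N" using j by simp
        then show ?thesis using SId T(4)[OF j(1)] jet_eq_trans by blast
      qed
    qed
  qed
qed

lemma Gr_bounded:
  assumes "F \<in> Gr vol" obtains K :: nat where "\<And>x. norm x \<le> R \<Longrightarrow> norm (F x) \<le> real K" "real K \<ge> B"
proof -
  have "compact (F ` cball 0 R)"
    by (intro compact_continuous_image holomorphic_map_continuous[OF Gr_holo[OF assms]]) auto
  then obtain M where "\<forall>x\<in>F ` cball 0 R. norm x \<le> M" by (meson bounded_iff compact_imp_bounded)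
  then have M: "\<And>x. norm x \<le> R \<Longrightarrow> norm (F x) \<le> M" by auto
  obtain K :: nat where "real K \<ge> max M B" using real_arch_simple by blast
  then show ?thesis using that[of K] M by (meson max.bounded_iff order_trans)
qed

text \<open>The bound on \<open>inv F\<close> couples the radii: a correction close to the identity
  on a ball slightly larger than that of radius \<rho> changes both F and \<open>inv F\<close>
  little on the ball of radius n, and it may leave the jets up to index \<rho> alone.\<close>

definition stage :: "(nat \<Rightarrow> complex ^ 'n \<Rightarrow> complex ^ 'n) \<Rightarrow> nat \<Rightarrow> (complex ^ 'n \<Rightarrow> complex ^ 'n) \<times> nat \<Rightarrow> bool" where
  "stage G n = (\<lambda>(F, \<rho>). fixes_pts F \<and> (\<forall>j\<ge>1. j \<le> \<rho> \<longrightarrow> jet_eq (m j) (pt j) F (G j)) \<and>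
     (\<forall>y. norm y \<le> real n \<longrightarrow> norm (inv F y) \<le> real \<rho>) \<and> n \<le> \<rho>)"

text \<open>The map \<open>T\<close> may only be controlled on the ball of radius \<open>\<rho>\<close>, so the preimage of the next ball is
  first enclosed in a ball of radius \<open>\<rho>'\<close>. The factor \<open>T1\<close> treats the points up to \<open>\<rho>' + 1\<close>;
  the size of its inverse then fixes the range of points that is left to \<open>T2\<close>, which is close to the
  identity on the ball of radius \<open>\<rho>' + 1\<close> and so hardly affects this size.\<close>

lemma stage_step:
  assumes G: "\<And>j. j \<ge> 1 \<Longrightarrow> good j (G j)" and F: "stage G n (F, \<rho>)"
  shows "\<exists>F' \<rho>'. stage G (Suc n) (F', \<rho>') \<and>
    (\<forall>x. norm x \<le> real n \<longrightarrow> norm (F' x - F x) \<le> (1/2) ^ n) \<and>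
    (\<forall>y. norm y \<le> real n \<longrightarrow> norm (inv F' y - inv F y) \<le> (1/2) ^ n)"
proof -
  have fF: "fixes_pts F" and FG: "F \<in> Gr vol" and Fj: "\<And>j. j \<ge> 1 \<Longrightarrow> j \<le> \<rho> \<Longrightarrow> jet_eq (m j) (pt j) F (G j)"
    and Fi: "\<And>y. norm y \<le> real n \<Longrightarrow> norm (inv F y) \<le> real \<rho>" and n: "n \<le> \<rho>"
    using F by (auto simp: stage_def fixes_pts_def)
  obtain L where L: "L > 0" "\<And>x y. norm (x - 0) \<le> real \<rho> + 1 \<Longrightarrow> norm (y - 0) \<le> real \<rho> + 1 \<Longrightarrow> norm (F x - F y) \<le> L * norm (x - y)"
    using holomorphic_map_lipschitz[OF Gr_holo[OF FG]] by blast
  \<comment> \<open>The entry 1/2 is the margin between \<rho> and r, the next controls the inverse,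
    and the last, through the Lipschitz constant L, controls F.\<close>
  define d where "d = min (1/2) (min ((1/2) ^ n) ((1/2) ^ n / L))"
  have d: "d > 0" "d \<le> 1/2" "d \<le> (1/2) ^ n" "L * d \<le> (1/2) ^ n"
  proof -
    show "d > 0" using L by (simp add: d_def)
    show "d \<le> 1/2" "d \<le> (1/2) ^ n" unfolding d_def min_le_iff_disj by blast+
    have "d \<le> (1/2) ^ n / L" unfolding d_def min_le_iff_disj by blast
    then show "L * d \<le> (1/2) ^ n" using L by (simp add: pos_le_divide_eq mult.commute)
  qed
  \<comment> \<open>This is the enclosing radius called \<rho>' in the explanation above; the
    witness for \<rho>' in the statement is J.\<close>
  obtain R :: nat where R: "\<And>y. norm y \<le> real (Suc n) \<Longrightarrow> norm (inv F y) \<le> real R" "real R \<ge> real (Suc \<rho>)"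
    using Gr_bounded[OF Gr_inv(1)[OF FG]] by metis
  \<comment> \<open>A half-integer separates the indices up to \<rho> from the next one and leaves
    the margin that the estimate of the inverse consumes.\<close>
  define r where "r = real \<rho> + 1/2"
  have Q1: "good j (\<lambda>x. inv F (G j x))" if "r < real j" for j
    by (rule good_left[OF fixes_inv[OF fF] G]) (use that in \<open>auto simp: r_def\<close>)
  obtain T1 where T1: "fixes_pts T1" "\<And>x. norm x \<le> r \<Longrightarrow> norm (T1 x - x) \<le> d / 2"
    "\<And>j. real j \<le> r \<Longrightarrow> jet_eq (m j) (pt j) T1 (\<lambda>x. x)"
    "\<And>j. r < real j \<Longrightarrow> j \<le> Suc R \<Longrightarrow> jet_eq (m j) (pt j) T1 (\<lambda>x. inv F (G j x))"
    using block[where r = r and Q = "\<lambda>j x. inv F (G j x)" and e = "d / 2" and N = "Suc R"] Q1 d by (auto simp: r_def)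
  have T1G: "T1 \<in> Gr vol" and T1p: "\<And>j. T1 (pt j) = pt j" using T1(1) by (auto simp: fixes_pts_def)
  \<comment> \<open>\<open>inv F'\<close> is inv T1 o inv T2 o inv F, so J bounds the new preimage
    as soon as inv T2 moves points by less than 1. The indices from R + 2 to J remain for
    T2.\<close>
  obtain J :: nat where J: "\<And>y. norm y \<le> real (Suc R) \<Longrightarrow> norm (inv T1 y) \<le> real J" "real J \<ge> real (Suc R)"
    using Gr_bounded[OF Gr_inv(1)[OF T1G]] by metis
  have Q2: "good j (\<lambda>x. inv F (G j (inv T1 x)))" if "real (Suc R) < real j" for j
    by (rule good_left[OF fixes_inv[OF fF] good_right[OF fixes_inv[OF T1(1)] G]]) (use that in auto)
  obtain T2 where T2: "fixes_pts T2" "\<And>x. norm x \<le> real (Suc R) \<Longrightarrow> norm (T2 x - x) \<le> d / 2"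
    "\<And>j. real j \<le> real (Suc R) \<Longrightarrow> jet_eq (m j) (pt j) T2 (\<lambda>x. x)"
    "\<And>j. real (Suc R) < real j \<Longrightarrow> j \<le> J \<Longrightarrow> jet_eq (m j) (pt j) T2 (\<lambda>x. inv F (G j (inv T1 x)))"
    using block[where r = "real (Suc R)" and Q = "\<lambda>j x. inv F (G j (inv T1 x))" and e = "d / 2" and N = J] Q2 d
    by (auto simp del: of_nat_Suc)
  have T2G: "T2 \<in> Gr vol" using T2(1) by (auto simp: fixes_pts_def)
  define T where "T x = T2 (T1 x)" for x
  have fT: "fixes_pts T" unfolding T_def by (rule fixes_comp[OF T2(1) T1(1)])
  have TG: "T \<in> Gr vol" and Tp: "\<And>j. T (pt j) = pt j" using fT by (auto simp: fixes_pts_def)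
  have Tinv: "inv T z = inv T1 (inv T2 z)" for z unfolding T_def[abs_def] by (simp add: Gr_comp(2)[OF T2G T1G])
  have near: "norm (T x - x) \<le> d" if x: "norm x \<le> r" for x
  proof -
    have t1: "norm (T1 x - x) \<le> d / 2" by (rule T1(2)[OF x])
    then have "norm (T1 x) \<le> real (Suc R)"
      using x norm_triangle_sub[of "T1 x" x] d R(2) by (simp add: r_def)
    from T2(2)[OF this] show ?thesis
      using t1 norm_triangle_ineq[of "T2 (T1 x) - T1 x" "T1 x - x"] by (simp add: T_def)
  qed
  define F' where "F' x = F (T x)" for x
  have fF': "fixes_pts F'" unfolding F'_def by (rule fixes_comp[OF fF fT])
  have F'inv: "inv F' y = inv T (inv F y)" for y unfolding F'_def[abs_def] by (simp add: Gr_comp(2)[OF FG TG])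
  have T2T1: "jet_eq a (pt j) T (\<lambda>x. H (T1 x))" if "jet_eq a (pt j) T2 H" for a j H
    unfolding T_def[abs_def]
    by (rule jet_eq_compose_right[where K = T1, OF _ holomorphic_map_lipschitz_at[OF Gr_holo[OF T1G]]]) (simp add: T1p that)
  have FT: "jet_eq a (pt j) F' (\<lambda>x. F (H x))" if "jet_eq a (pt j) T H" for a j H
    unfolding F'_def[abs_def]
    by (rule jet_eq_compose_left[OF that holomorphic_map_locally_lipschitz[OF Gr_holo[OF FG]] holomorphic_map_lipschitz_at[OF Gr_holo[OF TG]]])
  have jets: "jet_eq (m j) (pt j) F' (G j)" if j: "j \<ge> 1" "j \<le> J" for j
  proof (cases "j \<le> \<rho>")
    case True
    then have "real j \<le> r" "real j \<le> real (Suc R)" using R(2) by (auto simp: r_def)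
    then have "jet_eq (m j) (pt j) T (\<lambda>x. x)"
      using T2T1[OF T2(3)] T1(3) jet_eq_trans by blast
    from jet_eq_trans[OF FT[OF this] Fj[OF j(1) True]] show ?thesis by simp
  next
    case False
    then have rj: "r < real j" by (simp add: r_def)
    show ?thesis
    proof (cases "j \<le> Suc R")
      case True
      have "jet_eq (m j) (pt j) T (\<lambda>x. inv F (G j x))"
        using T2T1[OF T2(3)] T1(4)[OF rj True] jet_eq_trans True by (metis of_nat_mono)
      from FT[OF this] show ?thesis using FG by simp
    next
      case False
      then have "jet_eq (m j) (pt j) T2 (\<lambda>x. inv F (G j (inv T1 x)))" using j by (intro T2(4)) auto
      from FT[OF T2T1[OF this]] show ?thesis using FG T1G by simp
    qed
  qed
  show ?thesis
  proof (intro exI[of _ F'] exI[of _ J] conjI allI impI)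
    show "stage G (Suc n) (F', J)"
      unfolding stage_def prod.case
    proof (intro conjI allI impI fF' jets)
      fix y :: "complex ^ 'n" assume "norm y \<le> real (Suc n)"
      then have z: "norm (inv F y) \<le> real R" by (rule R(1))
      have "norm (inv T2 (inv F y) - inv F y) \<le> d / 2"
        by (rule near_identity_inverse[OF T2G T2(2) _ z]) (use d in auto)
      then have "norm (inv T2 (inv F y)) \<le> real (Suc R)"
        using z norm_triangle_sub[of "inv T2 (inv F y)" "inv F y"] d by simp
      then show "norm (inv F' y) \<le> real J" unfolding F'inv Tinv by (rule J(1))
    next
      show "Suc n \<le> J" using J(2) R(2) n by simp
    qed
  next
    fix x :: "complex ^ 'n" assume "norm x \<le> real n"
    then have x: "norm x \<le> real \<rho>" using n by simp
    then have Tx: "norm (T x - x) \<le> d" by (intro near) (simp add: r_def)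
    then have "norm (T x) \<le> real \<rho> + 1" using x norm_triangle_sub[of "T x" x] d by simp
    then have "norm (F (T x) - F x) \<le> L * norm (T x - x)" using x by (intro L(2)) auto
    also have "\<dots> \<le> L * d" using Tx L by simp
    finally show "norm (F' x - F x) \<le> (1/2) ^ n" using d(4) by (simp add: F'_def)
  next
    fix y :: "complex ^ 'n" assume "norm y \<le> real n"
    then have z: "norm (inv F y) \<le> real \<rho>" by (rule Fi)
    have "norm (inv T (inv F y) - inv F y) \<le> d"
      by (rule near_identity_inverse[OF TG near d(1) z]) (use d in \<open>auto simp: r_def\<close>)
    then show "norm (inv F' y - inv F y) \<le> (1/2) ^ n" using d(3) by (simp add: F'inv)
  qed
qed

text \<open>Stages are picked by dependent choice, starting from the identity. At stage n the jets
  are right up to an index of at least n, so each jet is right from some stage on and passes to the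
  limit.\<close>

lemma interpolation:
  assumes G: "\<And>j. j \<ge> 1 \<Longrightarrow> good j (G j)"
  shows "\<exists>F\<in>Gr vol. \<forall>j\<ge>1. jet_eq (m j) (pt j) F (G j)"
proof -
  define rel where "rel n s s' \<longleftrightarrow> (\<forall>x. norm x \<le> real n \<longrightarrow> norm (fst s' x - fst s x) \<le> (1/2) ^ n) \<and>
    (\<forall>y. norm y \<le> real n \<longrightarrow> norm (inv (fst s') y - inv (fst s) y) \<le> (1/2) ^ n)"
    for n and s s' :: "(complex ^ 'n \<Rightarrow> complex ^ 'n) \<times> nat"
  have "\<exists>f. \<forall>n. stage G n (f n) \<and> rel n (f n) (f (Suc n))"
  proof (rule dependent_nat_choice)
    have "inv (\<lambda>x :: complex ^ 'n. x) = (\<lambda>x. x)" by (rule inv_equality) auto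
    then show "\<exists>s. stage G 0 s"
      by (intro exI[of _ "(\<lambda>x. x, 0)"]) (auto simp: stage_def fixes_pts_def)
    fix s n assume "stage G n s"
    then show "\<exists>s'. stage G (Suc n) s' \<and> rel n s s'"
      using stage_step[OF G, of n "fst s" "snd s"] by (auto simp: rel_def)
  qed
  then obtain f where f: "\<And>n. stage G n (f n)" "\<And>n. rel n (f n) (f (Suc n))" by blast
  have Gf: "fst (f n) \<in> Gr vol" for n using f(1)[of n] by (auto simp: stage_def fixes_pts_def split: prod.splits)
  obtain g where g: "g \<in> Gr vol" "\<And>R. uniform_limit (cball 0 R) (\<lambda>n. fst (f n)) g sequentially"
    by (rule Gr_limit[of "\<lambda>n. fst (f n)" vol]) (use Gf f(2) in \<open>auto simp: rel_def\<close>)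
  have "jet_eq (m j) (pt j) g (G j)" if j: "j \<ge> 1" for j
  proof (rule jet_eq_limit[OF Gr_holo[OF Gf] g(2)])
    show "holomorphic_map (G j)" using G[OF j] by (simp add: good_def)
    fix n assume "j \<le> n"
    then show "jet_eq (m j) (pt j) (fst (f n)) (G j)"
      using f(1)[of n] j by (auto simp: stage_def split: prod.splits)
  qed
  with g(1) show ?thesis by blast
qed

end

section \<open>Reduction of the theorem to interpolation on the axis\<close>

lemma poly_map_holomorphic:
  assumes "poly_map_deg_le k P" shows "holomorphic_map P"
proof -
  obtain c where c: "\<And>z. P z = (\<Sum>\<alpha>\<in>multi_indices k. (\<Prod>i\<in>UNIV. (z $ i) ^ \<alpha> i) *s c \<alpha>)"
    using assms unfolding poly_map_deg_le_def by blast
  show ?thesis unfolding holomorphic_map_iff c sum_component vector_smult_component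
    by (intro allI entire_sum entire_mult entire_prod entire_power entire_coord entire_const)
qed

text \<open>The Landau bound leaves out the point 0; the value there is supplied by continuity,
  since k is positive.\<close>

lemma vanish_jacobian_of_bigo:
  assumes P: "holomorphic_map P" and k: "k \<ge> 1"
    and O: "(\<lambda>z. norm (jacobian_det P z - 1)) \<in> O[at 0](\<lambda>z. norm z ^ k)"
  shows "vanish k 0 (\<lambda>z. jacobian_det P z - 1)"
proof -
  obtain C where C: "C > 0" "\<forall>\<^sub>F z in at 0. norm (norm (jacobian_det P z - 1)) \<le> C * norm (norm z ^ k)"
    using O by (rule landau_o.bigE)
  then have ev: "\<forall>\<^sub>F z in at 0. cmod (jacobian_det P z - 1) \<le> C * norm z ^ k" by simp
  have "((\<lambda>z::complex ^ 'a. C * norm z ^ k) \<longlongrightarrow> C * norm (0 :: complex ^ 'a) ^ k) (at 0)"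
    by (intro tendsto_intros)
  then have "((\<lambda>z::complex ^ 'a. C * norm z ^ k) \<longlongrightarrow> 0) (at 0)" using k by (simp add: power_0_left)
  from Lim_null_comparison[OF ev this] have "((\<lambda>z. jacobian_det P z - 1) \<longlongrightarrow> 0) (at 0)" .
  moreover have "((\<lambda>z. jacobian_det P z - 1) \<longlongrightarrow> jacobian_det P 0 - 1) (at 0)"
    using entire_isCont[OF entire_diff[OF entire_jacobian_det[OF P] entire_const]] unfolding isCont_def .
  ultimately have P0: "jacobian_det P 0 - 1 = 0" by (metis at_neq_bot tendsto_unique)
  have "\<forall>\<^sub>F z in nhds 0. cmod (jacobian_det P z - 1) \<le> C * norm (z - 0) ^ k"
    using ev unfolding eventually_at_filter
    by eventually_elim (use P0 C(1) k in \<open>auto simp: power_0_left\<close>)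
  then show ?thesis by (rule vanishI)
qed

lemma jet_eq_imp_bigo:
  assumes "jet_eq k p F G"
  shows "(\<lambda>z. norm (F z - G z)) \<in> O[at p](\<lambda>z. norm (z - p) ^ (k + 1))"
proof -
  obtain C where C: "\<forall>\<^sub>F x in nhds p. norm (F x - G x) \<le> C * norm (x - p) ^ Suc k"
    using assms unfolding jet_eq_def vanish_def by blast
  show ?thesis
  proof (rule landau_o.bigI[where c = "\<bar>C\<bar> + 1"])
    show "\<forall>\<^sub>F x in at p. norm (norm (F x - G x)) \<le> (\<bar>C\<bar> + 1) * norm (norm (x - p) ^ (k + 1))"
      unfolding eventually_at_filter using C
    proof eventually_elim
      case (elim x)
      have "C * norm (x - p) ^ Suc k \<le> (\<bar>C\<bar> + 1) * norm (x - p) ^ Suc k"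
        by (intro mult_right_mono) auto
      then show ?case using elim by simp
    qed
  qed simp
qed

text \<open>Straightening turns the prescribed map into B o (b_j + P_j (x - a_j)) o inv A, in
  general no longer a polynomial; hence jets of arbitrary holomorphic maps were treated. Since A and
  B have nonzero Jacobian determinant, equal to 1 in the volume preserving case, the conditions on
  P_j carry over.\<close>

lemma interpolation_of_straightened:
  fixes a b :: "nat \<Rightarrow> complex ^ 'n::finite" and P :: "nat \<Rightarrow> complex ^ 'n \<Rightarrow> complex ^ 'n" and i0 l :: 'n
  assumes l: "l \<noteq> i0" and A: "A \<in> Gr vol" "\<And>j. j \<ge> 1 \<Longrightarrow> A (a j) = of_nat j *s axis i0 1"
    and B: "B \<in> Gr vol" "\<And>j. j \<ge> 1 \<Longrightarrow> B (b j) = of_nat j *s axis i0 1"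
    and m: "\<And>j. j \<ge> 1 \<Longrightarrow> m j \<ge> 1"
    and P: "\<And>j. j \<ge> 1 \<Longrightarrow> holomorphic_map (P j)" "\<And>j. j \<ge> 1 \<Longrightarrow> P j 0 = 0"
      "\<And>j. j \<ge> 1 \<Longrightarrow> jacobian_det (P j) 0 \<noteq> 0"
      "\<And>j. j \<ge> 1 \<Longrightarrow> vol \<Longrightarrow> vanish (m j) 0 (\<lambda>z. jacobian_det (P j) z - 1)"
  shows "\<exists>F\<in>Gr vol. \<forall>j\<ge>1. jet_eq (m j) (a j) F (\<lambda>z. b j + P j (z - a j))"
proof -
  interpret axis_interpolation vol i0 l m by unfold_locales (use l m in auto)
  have pt: "A (a j) = pt j" "inv A (pt j) = a j" "B (b j) = pt j" "inv B (pt j) = b j" if "j \<ge> 1" for j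
    using A(2)[OF that] B(2)[OF that] Gr_inv_f[OF A(1), of "a j"] Gr_inv_f[OF B(1), of "b j"] by (simp_all add: pt_def)
  define K where "K j x = inv A x - a j" for j x
  define H where "H j x = b j + P j x" for j x
  define G where "G j x = B (H j (K j x))" for j x
  have sh: "holomorphic_map (\<lambda>x. x - c)" for c :: "complex ^ 'n" by (intro holomorphic_map_diff) auto
  have Kh: "holomorphic_map (K j)" for j
    unfolding K_def by (rule holomorphic_map_compose[OF sh Gr_inv_holo[OF A(1)]])
  have Hh: "holomorphic_map (H j)" if "j \<ge> 1" for j
    unfolding H_def by (intro holomorphic_map_add P that) simp
  have HK: "holomorphic_map (\<lambda>x. H j (K j x))" if "j \<ge> 1" for j by (rule holomorphic_map_compose[OF Hh[OF that] Kh])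
  have "good j (G j)" if j: "j \<ge> 1" for j
  proof -
    have "jac (K j) x = jac (inv A) x" for x
      unfolding K_def using jac_compose[OF sh Gr_inv_holo[OF A(1)], of "a j"] by simp
    then have JK: "jacobian_det (K j) x = jacobian_det (inv A) x" for x by (simp add: jacobian_det_jac)
    have "jac (H j) x = jac (P j) x" for x
    proof -
      have "holomorphic_map (\<lambda>x. b j + x)" by (intro holomorphic_map_add) simp_all
      from jac_compose[OF this P(1)[OF j]] show ?thesis unfolding H_def by simp
    qed
    then have JH: "jacobian_det (H j) x = jacobian_det (P j) x" for x by (simp add: jacobian_det_jac)
    have JG: "jacobian_det (G j) x = jacobian_det B (H j (K j x)) * (jacobian_det (P j) (K j x) * jacobian_det (inv A) x)" for x
      unfolding G_def jacobian_det_compose[OF Gr_holo[OF B(1)] HK[OF j]] jacobian_det_compose[OF Hh[OF j] Kh] JK JH ..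
    have K0: "K j (pt j) = 0" using j by (simp add: K_def pt)
    have "vanish (m j) (pt j) (\<lambda>x. jacobian_det (G j) x - 1)" if v: vol
    proof -
      have "jacobian_det (G j) x = jacobian_det (P j) (K j x)" for x
        using JG[of x] Gr_jac[of B "H j (K j x)"] Gr_jac[of "inv A" x] B(1) Gr_inv(1)[OF A(1)] v by simp
      moreover have "vanish (m j) (pt j) (\<lambda>x. jacobian_det (P j) (K j x) - 1)"
        by (rule vanish_compose[OF P(4)[OF j v]])
          (use holomorphic_map_lipschitz_at[OF Kh, of "pt j" j] K0 in \<open>simp add: lipschitz_at_def\<close>)
      ultimately show ?thesis by simp
    qed
    moreover have "G j (pt j) = pt j" using j by (simp add: G_def K0 H_def P(2) pt)
    moreover have "jacobian_det (G j) (pt j) \<noteq> 0"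
      using Gr_jac_nonzero[OF B(1)] Gr_jac_nonzero[OF Gr_inv(1)[OF A(1)]] P(3)[OF j] by (simp add: JG K0)
    moreover have "holomorphic_map (G j)"
      unfolding G_def by (rule holomorphic_map_compose[OF Gr_holo[OF B(1)] HK[OF j]])
    ultimately show ?thesis by (simp add: good_def)
  qed
  from interpolation[OF this] obtain F where F: "F \<in> Gr vol" "\<And>j. j \<ge> 1 \<Longrightarrow> jet_eq (m j) (pt j) F (G j)" by blast
  define E where "E x = inv B (F (A x))" for x
  have "E \<in> Gr vol" unfolding E_def by (rule Gr_comp(1)[OF Gr_inv(1)[OF B(1)] Gr_comp(1)[OF F(1) A(1)]])
  moreover have "jet_eq (m j) (a j) E (\<lambda>z. b j + P j (z - a j))" if j: "j \<ge> 1" for j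
  proof -
    have "jet_eq (m j) (a j) (\<lambda>x. F (A x)) (\<lambda>x. G j (A x))"
      by (rule jet_eq_compose_right[where K = A, OF _ holomorphic_map_lipschitz_at[OF Gr_holo[OF A(1)]]])
        (use F(2)[OF j] in \<open>simp add: pt(1)[OF j]\<close>)
    from jet_eq_compose_left[OF this holomorphic_map_locally_lipschitz[OF Gr_inv_holo[OF B(1)]]
        holomorphic_map_lipschitz_at[OF holomorphic_map_compose[OF Gr_holo[OF F(1)] Gr_holo[OF A(1)]]]]
    show ?thesis using A(1) B(1) by (simp add: E_def[abs_def] G_def K_def H_def)
  qed
  ultimately show ?thesis by blast
qed

theorem theorem0p1:
  fixes a b :: "nat \<Rightarrow> complex ^ 'n::{finite,linorder}"
    and m :: "nat \<Rightarrow> nat"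
    and P :: "nat \<Rightarrow> complex ^ 'n::{finite,linorder} \<Rightarrow> complex ^ 'n::{finite,linorder}"
  assumes "CARD('n::{finite,linorder}) > 1"
    and "tame a" and "tame b"
    and "\<And>j. j \<ge> 1 \<Longrightarrow> m j \<ge> 1"
    and "\<And>j. j \<ge> 1 \<Longrightarrow> poly_map_deg_le (m j) (P j)"
    and "\<And>j. j \<ge> 1 \<Longrightarrow> P j 0 = 0"
    and "\<And>j. j \<ge> 1 \<Longrightarrow> jacobian_det (P j) 0 \<noteq> 0"
  shows "(\<exists>F\<in>Aut. \<forall>j\<ge>1. F (a j) = b j \<and>
            (\<lambda>z. norm (F z - (b j + P j (z - a j)))) \<in> O[at (a j)](\<lambda>z. norm (z - a j) ^ (m j + 1)))
       \<and> ((\<forall>j\<ge>1. (\<lambda>z. norm (jacobian_det (P j) z - 1)) \<in> O[at 0](\<lambda>z. norm z ^ m j)) \<longrightarrow>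
          very_tame a \<longrightarrow> very_tame b \<longrightarrow>
          (\<exists>F\<in>Aut1. \<forall>j\<ge>1. F (a j) = b j \<and>
            (\<lambda>z. norm (F z - (b j + P j (z - a j)))) \<in> O[at (a j)](\<lambda>z. norm (z - a j) ^ (m j + 1))))"
proof -
  define i0 :: 'n where "i0 = Min UNIV"
  \<comment> \<open>The dimension enters here: a direction transversal to the axis must
    exist.\<close>
  obtain l :: 'n where l: "l \<noteq> i0"
  proof -
    have "\<not> (UNIV :: 'n set) \<subseteq> {i0}"
      using assms(1) card_mono[of "{i0}" "UNIV :: 'n set"] by auto
    then show ?thesis using that by blast
  qed
  have e1: "(e1 :: (complex, 'n) vec) = axis i0 1" by (simp add: e1_def i0_def)
  have jets: "F (a j) = b j \<and> (\<lambda>z. norm (F z - (b j + P j (z - a j)))) \<in> O[at (a j)](\<lambda>z. norm (z - a j) ^ (m j + 1))"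
    if "jet_eq (m j) (a j) F (\<lambda>z. b j + P j (z - a j))" "j \<ge> 1" for F j
    using jet_eq_at[OF that(1)] jet_eq_imp_bigo[OF that(1)] assms(6)[OF that(2)] by simp
  note P = poly_map_holomorphic[OF assms(5)] assms(6,7)
  show ?thesis
  proof (intro conjI impI)
    obtain A B where A: "A \<in> Gr False" "\<And>j. j \<ge> 1 \<Longrightarrow> A (a j) = of_nat j *s axis i0 1"
      and B: "B \<in> Gr False" "\<And>j. j \<ge> 1 \<Longrightarrow> B (b j) = of_nat j *s axis i0 1"
      using assms(2,3) by (auto simp: tame_def Gr_def e1)
    have "\<exists>F\<in>Gr False. \<forall>j\<ge>1. jet_eq (m j) (a j) F (\<lambda>z. b j + P j (z - a j))"
      by (rule interpolation_of_straightened[OF l A B assms(4) P]) auto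
    then obtain F where "F \<in> Gr False" "\<forall>j\<ge>1. jet_eq (m j) (a j) F (\<lambda>z. b j + P j (z - a j))" by blast
    then show "\<exists>F\<in>Aut. \<forall>j\<ge>1. F (a j) = b j \<and>
            (\<lambda>z. norm (F z - (b j + P j (z - a j)))) \<in> O[at (a j)](\<lambda>z. norm (z - a j) ^ (m j + 1))"
      by (intro bexI[of _ F] allI impI jets) (auto simp: Gr_def)
  next
    assume J: "\<forall>j\<ge>1. (\<lambda>z. norm (jacobian_det (P j) z - 1)) \<in> O[at 0](\<lambda>z. norm z ^ m j)"
      and "very_tame a" "very_tame b"
    then obtain A B where A: "A \<in> Gr True" "\<And>j. j \<ge> 1 \<Longrightarrow> A (a j) = of_nat j *s axis i0 1"
      and B: "B \<in> Gr True" "\<And>j. j \<ge> 1 \<Longrightarrow> B (b j) = of_nat j *s axis i0 1"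
      by (auto simp: very_tame_def Gr_def e1)
    have "\<exists>F\<in>Gr True. \<forall>j\<ge>1. jet_eq (m j) (a j) F (\<lambda>z. b j + P j (z - a j))"
      by (rule interpolation_of_straightened[OF l A B assms(4) P vanish_jacobian_of_bigo[OF P(1) assms(4)]])
        (use J in auto)
    then obtain F where "F \<in> Gr True" "\<forall>j\<ge>1. jet_eq (m j) (a j) F (\<lambda>z. b j + P j (z - a j))" by blast
    then show "\<exists>F\<in>Aut1. \<forall>j\<ge>1. F (a j) = b j \<and>
            (\<lambda>z. norm (F z - (b j + P j (z - a j)))) \<in> O[at (a j)](\<lambda>z. norm (z - a j) ^ (m j + 1))"
      by (intro bexI[of _ F] allI impI jets) (auto simp: Gr_def)
  qed
qed

end
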